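(* Assume $g_h$ satisfies (EP1), (EP3) and (EP4), and $\beta$ is large enough that $|||v|||_{A_h}^2\lesssim A_h(v,v)$ on $V_h$. Let $\{\phi_i\}_{i=1}^N$ be the standard elementwise (local nodal) basis of $V_h=\mathbb P_k(\mathcal T_h)$ and $\mathcal A\in\mathbb R^{N\times N}$ the stiffness matrix defined by $(\mathcal AV,W)_{\mathbb R^N}=A_h(v,w)$ for $v=\sum_iV_i\phi_i$, $w=\sum_iW_i\phi_i$. Then the Euclidean condition number satisfies $\kappa(\mathcal A)=\|\mathcal A\|_{\mathbb R^N}\|\mathcal A^{-1}\|_{\mathbb R^N}\lesssim h^{-2}$, with constant depending only on $d$, $k$ and the quasi-uniformity/shape regularity of the mesh, not on the cut configuration.
   Context: Setting. $d\in\{2,3\}$, $k\ge1$, $\Omega\subset\mathbb R^d$ bounded open with $C^2$ boundary $\Gamma$, outward normal $n$. $\widetilde{\mathcal T}_h$: quasi-uniform shape-regular meshes of closed $d$-simplices covering $\overline\Omega$, $h=\max\operatorname{diam}T$; active mesh $\mathcal T_h=\{T:T\cap\Omega\ne\emptyset\}$; $\mathcal T_\Gamma=\{T:T\cap\Gamma\ne\emptyset\}$; $\mathcal F_h$ interior faces of $\mathcal T_h$; $h$ small enough that the closest point projection onto $\Gamma$ is defined on $\mathcal T_\Gamma$; fat intersection: for each $T\in\mathcal T_\Gamma$ some $T'$ sharing a vertex with $T$ has $|T'\cap\Omega|_d\ge c_s|T'|_d$. $V_h=\mathbb P_k(\mathcal T_h)$ discontinuous piecewise polynomials of degree $\le k$.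 Jumps/averages on faces with fixed normal: $[w]=w^+-w^-$, $\{\partial_nw\}=\frac12n\cdot(\nabla w^++\nabla w^-)$; on $\Gamma$ $\partial_nw=n\cdot\nabla w$; broken norms over collections are sums; $\mathcal P\cap\Omega=\{P\cap\Omega\}$. $a_h(v,w)=(\nabla v,\nabla w)_{\mathcal T_h\cap\Omega}-(\partial_nv,w)_\Gamma-(v,\partial_nw)_\Gamma+\beta(h^{-1}v,w)_\Gamma-(\{\partial_nv\},[w])_{\mathcal F_h\cap\Omega}-([v],\{\partial_nw\})_{\mathcal F_h\cap\Omega}+\beta(h^{-1}[v],[w])_{\mathcal F_h\cap\Omega}$; $g_h$ symmetric positive semidefinite on $V_h$, $|v|^2_{g_h}=g_h(v,v)$, $A_h=a_h+g_h$; $|||v|||_{A_h}^2=\|\nabla v\|^2_{\mathcal T_h\cap\Omega}+\|h^{-1/2}[v]\|^2_{\mathcal F_h\cap\Omega}+\|h^{-1/2}v\|^2_\Gamma+|v|^2_{g_h}$. (EP1): $\|\nabla v\|^2_{\mathcal T_h}\lesssim\|\nabla v\|^2_\Omega+|v|^2_{g_h}$; (EP3): $\|v\|^2_{\mathcal T_h}\lesssim\|v\|^2_\Omega+|v|^2_{g_h}$; (EP4): $|v|_{g_h}\lesssim h^{-1}\|v\|_{\mathcal T_h}$; all for $v\in V_h$. $a\lesssim b$: $a\le Cb$, $C$ independent of $h$ and of the position of $\Gamma$ relative to the mesh.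
   Formalization: The constant may also depend on Ω, β, c_s and the constants in (EP1), (EP3), (EP4) and the coercivity bound; dependence only on d, k and mesh regularity fails, e.g. for balls of growing radius at fixed h. It is uniform over all meshes and cut positions. *)

theory Defs
  imports "HOL-Analysis.Analysis"
begin

type_synonym 'n dgfun = "(real^'n) set \<Rightarrow> real^'n \<Rightarrow> real"

definition hnorm :: "real \<Rightarrow> real" where
  "hnorm s = pi powr (s/2) / Gamma (s/2 + 1)"

definition hausdorff_outer :: "real \<Rightarrow> 'a::metric_space set \<Rightarrow> ennreal" where
  "hausdorff_outer s A =
     (SUP \<delta>\<in>{0::real<..}. INF C\<in>{C::nat \<Rightarrow> 'a set. A \<subseteq> (\<Union>i. C i) \<and>
              (\<forall>i. bounded (C i) \<and> diameter (C i) \<le> \<delta>)}.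
        (\<Sum>i. ennreal (hnorm s * (diameter (C i) / 2) powr s)))"

definition haus :: "real \<Rightarrow> 'a::metric_space measure" where
  "haus s = measure_of UNIV (sets borel) (hausdorff_outer s)"

definition surf_int :: "real \<Rightarrow> 'a::metric_space set \<Rightarrow> ('a \<Rightarrow> real) \<Rightarrow> real" where
  "surf_int s A f = set_lebesgue_integral (haus s) A f"

definition grad :: "(real^'n \<Rightarrow> real) \<Rightarrow> real^'n \<Rightarrow> real^'n" where
  "grad f x = (\<chi> i. frechet_derivative f (at x) (axis i 1))"

definition poly_deg_le :: "nat \<Rightarrow> (real^'n \<Rightarrow> real) \<Rightarrow> bool" where
  "poly_deg_le k p \<longleftrightarrow> (\<exists>c::('n \<Rightarrow> nat) \<Rightarrow> real.
     p = (\<lambda>x. \<Sum>\<alpha>\<in>{\<alpha>::'n \<Rightarrow> nat. sum \<alpha> UNIV \<le> k}. c \<alpha> * (\<Prod>i\<in>UNIV. (x$i) ^ (\<alpha> i))))"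

definition local_defining_fn ::
  "(real^'n) set \<Rightarrow> (real^'n) set \<Rightarrow> (real^'n \<Rightarrow> real) \<Rightarrow> (real^'n \<Rightarrow> real^'n) \<Rightarrow> bool" where
  "local_defining_fn \<Omega> U \<phi> G \<longleftrightarrow> open U \<and>
     (\<forall>x\<in>U. (\<phi> has_derivative (\<lambda>h. G x \<bullet> h)) (at x)) \<and>
     (\<exists>H :: real^'n \<Rightarrow> real^'n^'n. (\<forall>x\<in>U. (G has_derivative (\<lambda>h. H x *v h)) (at x)) \<and> continuous_on U H) \<and>
     (\<forall>x\<in>U. G x \<noteq> 0) \<and>
     \<Omega> \<inter> U = {x\<in>U. \<phi> x < 0}"

definition C2_domain :: "(real^'n) set \<Rightarrow> bool" where
  "C2_domain \<Omega> \<longleftrightarrow> (\<forall>p\<in>frontier \<Omega>. \<exists>U \<phi> G. p \<in> U \<and> local_defining_fn \<Omega> U \<phi> G)"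

definition outward_normal :: "(real^'n) set \<Rightarrow> real^'n \<Rightarrow> real^'n" where
  "outward_normal \<Omega> p = (SOME \<nu>. \<exists>U \<phi> G. p \<in> U \<and> local_defining_fn \<Omega> U \<phi> G \<and> \<nu> = G p /\<^sub>R norm (G p))"

definition is_simplex :: "(real^'n) set \<Rightarrow> bool" where
  "is_simplex T \<longleftrightarrow> (\<exists>S. finite S \<and> card S = CARD('n) + 1 \<and> \<not> affine_dependent S \<and> T = convex hull S)"

definition simplex_verts :: "(real^'n) set \<Rightarrow> (real^'n) set" where
  "simplex_verts T = {x. x extreme_point_of T}"

definition inradius :: "(real^'n) set \<Rightarrow> real" where
  "inradius T = Sup {r. \<exists>c. ball c r \<subseteq> T}"

definition meshsize :: "(real^'n) set set \<Rightarrow> real" where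
  "meshsize M = Max (diameter ` M)"

text \<open>Background mesh: finite conforming mesh of closed d-simplices covering the closure
  of the domain; sigma bounds both shape regularity and quasi-uniformity
  (h \<le> sigma * inradius T for every element T).\<close>
definition background_mesh :: "(real^'n) set set \<Rightarrow> (real^'n) set \<Rightarrow> real \<Rightarrow> bool" where
  "background_mesh M \<Omega> \<sigma> \<longleftrightarrow> finite M \<and> M \<noteq> {} \<and> (\<forall>T\<in>M. is_simplex T) \<and>
     closure \<Omega> \<subseteq> \<Union>M \<and>
     (\<forall>T\<in>M. \<forall>T'\<in>M. T \<noteq> T' \<longrightarrow> T \<inter> T' = convex hull (simplex_verts T \<inter> simplex_verts T')) \<and>
     (\<forall>T\<in>M. meshsize M \<le> \<sigma> * inradius T)"

definition active :: "(real^'n) set set \<Rightarrow> (real^'n) set \<Rightarrow> (real^'n) set set" where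
  "active M \<Omega> = {T\<in>M. T \<inter> \<Omega> \<noteq> {}}"

definition cut_cells :: "(real^'n) set set \<Rightarrow> (real^'n) set \<Rightarrow> (real^'n) set set" where
  "cut_cells M \<Omega> = {T\<in>M. T \<inter> frontier \<Omega> \<noteq> {}}"

text \<open>Ordered pairs of distinct active elements sharing a facet; every interior face
  of the active mesh appears exactly twice (once per orientation).\<close>
definition facet_pairs :: "(real^'n) set set \<Rightarrow> (real^'n) set \<Rightarrow> ((real^'n) set \<times> (real^'n) set) set" where
  "facet_pairs M \<Omega> = {(T,T'). T \<in> active M \<Omega> \<and> T' \<in> active M \<Omega> \<and> T \<noteq> T' \<and>
      aff_dim (T \<inter> T') = int CARD('n) - 1}"

definition facet_normal :: "(real^'n) set \<Rightarrow> (real^'n) set \<Rightarrow> real^'n" where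
  "facet_normal T F = (SOME \<nu>. norm \<nu> = 1 \<and> (\<forall>x\<in>T. \<forall>y\<in>F. \<nu> \<bullet> (x - y) \<le> 0))"

definition fat_intersection :: "(real^'n) set set \<Rightarrow> (real^'n) set \<Rightarrow> real \<Rightarrow> bool" where
  "fat_intersection M \<Omega> cs \<longleftrightarrow> (\<forall>T\<in>cut_cells M \<Omega>. \<exists>T'\<in>M.
     simplex_verts T \<inter> simplex_verts T' \<noteq> {} \<and> measure lebesgue (T' \<inter> \<Omega>) \<ge> cs * measure lebesgue T')"

definition cpp_defined :: "(real^'n) set set \<Rightarrow> (real^'n) set \<Rightarrow> bool" where
  "cpp_defined M \<Omega> \<longleftrightarrow> (\<forall>x\<in>\<Union>(cut_cells M \<Omega>).
      \<exists>!p. p \<in> frontier \<Omega> \<and> dist x p = infdist x (frontier \<Omega>))"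

definition Vh :: "nat \<Rightarrow> (real^'n) set set \<Rightarrow> (real^'n) set \<Rightarrow> 'n dgfun set" where
  "Vh k M \<Omega> = {v. (\<forall>T\<in>active M \<Omega>. poly_deg_le k (v T)) \<and> (\<forall>T. T \<notin> active M \<Omega> \<longrightarrow> v T = (\<lambda>_. 0))}"

definition ah :: "(real^'n) set \<Rightarrow> (real^'n) set set \<Rightarrow> real \<Rightarrow> 'n dgfun \<Rightarrow> 'n dgfun \<Rightarrow> real" where
  "ah \<Omega> M \<beta> v w =
    (let h = meshsize M; s = real CARD('n) - 1; \<Gamma> = frontier \<Omega>;
         Th = active M \<Omega>; Fh = facet_pairs M \<Omega>;
         dnG = (\<lambda>u T x. outward_normal \<Omega> x \<bullet> grad (u T) x);
         jump = (\<lambda>u T T' x. u T x - u T' x);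
         avg = (\<lambda>u T T' x. (1/2) * (facet_normal T (T \<inter> T') \<bullet> (grad (u T) x + grad (u T') x)))
     in (\<Sum>T\<in>Th. integral (T \<inter> \<Omega>) (\<lambda>x. grad (v T) x \<bullet> grad (w T) x))
      - (\<Sum>T\<in>Th. surf_int s (\<Gamma> \<inter> T) (\<lambda>x. dnG v T x * w T x))
      - (\<Sum>T\<in>Th. surf_int s (\<Gamma> \<inter> T) (\<lambda>x. v T x * dnG w T x))
      + \<beta> * (\<Sum>T\<in>Th. surf_int s (\<Gamma> \<inter> T) (\<lambda>x. v T x * w T x / h))
      - (\<Sum>(T,T')\<in>Fh. (1/2) * surf_int s (T \<inter> T' \<inter> \<Omega>) (\<lambda>x. avg v T T' x * jump w T T' x))
      - (\<Sum>(T,T')\<in>Fh. (1/2) * surf_int s (T \<inter> T' \<inter> \<Omega>) (\<lambda>x. jump v T T' x * avg w T T' x))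
      + \<beta> * (\<Sum>(T,T')\<in>Fh. (1/2) * surf_int s (T \<inter> T' \<inter> \<Omega>) (\<lambda>x. jump v T T' x * jump w T T' x / h)))"

definition Ah :: "(real^'n) set \<Rightarrow> (real^'n) set set \<Rightarrow> real \<Rightarrow> ('n dgfun \<Rightarrow> 'n dgfun \<Rightarrow> real)
     \<Rightarrow> 'n dgfun \<Rightarrow> 'n dgfun \<Rightarrow> real" where
  "Ah \<Omega> M \<beta> g v w = ah \<Omega> M \<beta> v w + g v w"

definition tnorm2 :: "(real^'n) set \<Rightarrow> (real^'n) set set \<Rightarrow> ('n dgfun \<Rightarrow> 'n dgfun \<Rightarrow> real) \<Rightarrow> 'n dgfun \<Rightarrow> real" where
  "tnorm2 \<Omega> M g v =
    (let h = meshsize M; s = real CARD('n) - 1; \<Gamma> = frontier \<Omega>;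
         Th = active M \<Omega>; Fh = facet_pairs M \<Omega>
     in (\<Sum>T\<in>Th. integral (T \<inter> \<Omega>) (\<lambda>x. (norm (grad (v T) x))\<^sup>2))
      + (\<Sum>(T,T')\<in>Fh. (1/2) * surf_int s (T \<inter> T' \<inter> \<Omega>) (\<lambda>x. (v T x - v T' x)\<^sup>2 / h))
      + (\<Sum>T\<in>Th. surf_int s (\<Gamma> \<inter> T) (\<lambda>x. (v T x)\<^sup>2 / h))
      + g v v)"

definition g_sym_psd :: "('n dgfun \<Rightarrow> 'n dgfun \<Rightarrow> real) \<Rightarrow> 'n dgfun set \<Rightarrow> bool" where
  "g_sym_psd g V \<longleftrightarrow> (\<forall>u\<in>V. \<forall>v\<in>V. g u v = g v u) \<and> (\<forall>u\<in>V. g u u \<ge> 0) \<and>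
     (\<forall>u\<in>V. \<forall>v\<in>V. \<forall>w\<in>V. \<forall>a b. g (\<lambda>T x. a * u T x + b * v T x) w = a * g u w + b * g v w)"

definition EP1 :: "nat \<Rightarrow> (real^'n) set \<Rightarrow> (real^'n) set set \<Rightarrow> ('n dgfun \<Rightarrow> 'n dgfun \<Rightarrow> real) \<Rightarrow> real \<Rightarrow> bool" where
  "EP1 k \<Omega> M g C \<longleftrightarrow> (\<forall>v\<in>Vh k M \<Omega>.
     (\<Sum>T\<in>active M \<Omega>. integral T (\<lambda>x. (norm (grad (v T) x))\<^sup>2))
       \<le> C * ((\<Sum>T\<in>active M \<Omega>. integral (T \<inter> \<Omega>) (\<lambda>x. (norm (grad (v T) x))\<^sup>2)) + g v v))"

definition EP3 :: "nat \<Rightarrow> (real^'n) set \<Rightarrow> (real^'n) set set \<Rightarrow> ('n dgfun \<Rightarrow> 'n dgfun \<Rightarrow> real) \<Rightarrow> real \<Rightarrow> bool" where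
  "EP3 k \<Omega> M g C \<longleftrightarrow> (\<forall>v\<in>Vh k M \<Omega>.
     (\<Sum>T\<in>active M \<Omega>. integral T (\<lambda>x. (v T x)\<^sup>2))
       \<le> C * ((\<Sum>T\<in>active M \<Omega>. integral (T \<inter> \<Omega>) (\<lambda>x. (v T x)\<^sup>2)) + g v v))"

definition EP4 :: "nat \<Rightarrow> (real^'n) set \<Rightarrow> (real^'n) set set \<Rightarrow> ('n dgfun \<Rightarrow> 'n dgfun \<Rightarrow> real) \<Rightarrow> real \<Rightarrow> bool" where
  "EP4 k \<Omega> M g C \<longleftrightarrow> (\<forall>v\<in>Vh k M \<Omega>.
     sqrt (g v v) \<le> C / meshsize M * sqrt (\<Sum>T\<in>active M \<Omega>. integral T (\<lambda>x. (v T x)\<^sup>2)))"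

definition coercive :: "nat \<Rightarrow> (real^'n) set \<Rightarrow> (real^'n) set set \<Rightarrow> real \<Rightarrow> ('n dgfun \<Rightarrow> 'n dgfun \<Rightarrow> real) \<Rightarrow> real \<Rightarrow> bool" where
  "coercive k \<Omega> M \<beta> g C \<longleftrightarrow> (\<forall>v\<in>Vh k M \<Omega>. tnorm2 \<Omega> M g v \<le> C * Ah \<Omega> M \<beta> g v v)"

definition lagrange_nodes :: "nat \<Rightarrow> (real^'n) set \<Rightarrow> (real^'n) set" where
  "lagrange_nodes k T = {(\<Sum>p\<in>simplex_verts T. (real (\<alpha> p) / real k) *\<^sub>R p) | \<alpha>.
       (\<Sum>p\<in>simplex_verts T. \<alpha> p) = k}"

definition local_basis :: "nat \<Rightarrow> (real^'n) set \<Rightarrow> real^'n \<Rightarrow> (real^'n \<Rightarrow> real)" where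
  "local_basis k T z = (THE p. poly_deg_le k p \<and>
       (\<forall>y\<in>lagrange_nodes k T. p y = (if y = z then 1 else 0)))"

definition dof_index :: "nat \<Rightarrow> (real^'n) set set \<Rightarrow> (real^'n) set \<Rightarrow> ((real^'n) set \<times> (real^'n)) set" where
  "dof_index k M \<Omega> = {(T,z). T \<in> active M \<Omega> \<and> z \<in> lagrange_nodes k T}"

definition nodal_basis :: "nat \<Rightarrow> (real^'n) set \<times> (real^'n) \<Rightarrow> 'n dgfun" where
  "nodal_basis k i = (\<lambda>T'. if T' = fst i then local_basis k (fst i) (snd i) else (\<lambda>_. 0))"

text \<open>(A V, W) = A_h(v,w) for v = sum V_i phi_i, w = sum W_j phi_j, i.e. A_ji = A_h(phi_i, phi_j).\<close>
definition stiffness :: "nat \<Rightarrow> (real^'n) set \<Rightarrow> (real^'n) set set \<Rightarrow> real \<Rightarrow> ('n dgfun \<Rightarrow> 'n dgfun \<Rightarrow> real)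
    \<Rightarrow> (real^'n) set \<times> (real^'n) \<Rightarrow> (real^'n) set \<times> (real^'n) \<Rightarrow> real" where
  "stiffness k \<Omega> M \<beta> g i j = Ah \<Omega> M \<beta> g (nodal_basis k j) (nodal_basis k i)"

definition vec_norm :: "'i set \<Rightarrow> ('i \<Rightarrow> real) \<Rightarrow> real" where
  "vec_norm I V = sqrt (\<Sum>i\<in>I. (V i)\<^sup>2)"

definition mat_vec :: "'i set \<Rightarrow> ('i \<Rightarrow> 'i \<Rightarrow> real) \<Rightarrow> ('i \<Rightarrow> real) \<Rightarrow> 'i \<Rightarrow> real" where
  "mat_vec I A V = (\<lambda>i. \<Sum>j\<in>I. A i j * V j)"

definition mat_opnorm :: "'i set \<Rightarrow> ('i \<Rightarrow> 'i \<Rightarrow> real) \<Rightarrow> real" where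
  "mat_opnorm I A = Sup {vec_norm I (mat_vec I A V) / vec_norm I V | V. vec_norm I V \<noteq> 0}"

definition is_inverse_on :: "'i set \<Rightarrow> ('i \<Rightarrow> 'i \<Rightarrow> real) \<Rightarrow> ('i \<Rightarrow> 'i \<Rightarrow> real) \<Rightarrow> bool" where
  "is_inverse_on I A B \<longleftrightarrow> (\<forall>i\<in>I. \<forall>j\<in>I.
      (\<Sum>l\<in>I. A i l * B l j) = (if i = j then 1 else 0) \<and>
      (\<Sum>l\<in>I. B i l * A l j) = (if i = j then 1 else 0))"

end

(* With h the mesh size and d the dimension, both extreme eigenvalues of the (symmetric) stiffness matrix
   are compared with h^d |V|^2, which is equivalent to the L2 norm of v over the active mesh.

   Upper bound: inverse estimates and the surface bounds H(frontier \<Omega> Int T), H(facet) <= C h^(d-1) give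
   A_h(v,v) <= C h^-2 |v|^2.

   Lower bound: a broken Poincare inequality, proved without any divergence theorem. From almost every point x of \<Omega>
   follow a coordinate direction until \<Omega> is left. By telescoping, v(x) is at most the sum of the oscillations of v
   on the elements crossed, its jumps across the facets crossed and its value at the exit point. At most C/h elements
   are crossed, so Cauchy-Schwarz produces exactly the weights 1/h of the energy norm. To integrate over x one only needs that
   moving points along a fixed direction into a set B costs at most C H(B) of Lebesgue measure, which is
   immediate from covers of B; thus neither the isodiametric inequality nor an area formula is used.

   The bound on h comes from the closest point projection: if every active element were cut, it would
   retract the closure of \<Omega> onto its boundary. So some element lies inside \<Omega>. *)

theory Submission
  imports Defs
begin

section \<open>Polynomials of bounded degree\<close>

text \<open>Estimates with a constant are made on the full element \<open>T\<close>, which contains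
  a ball of radius proportional to \<open>h\<close>; on \<open>T \<inter> \<Omega>\<close> the
  constant would depend on the cut. This is where the extension properties enter: the oscillation
  along a line is bounded by the gradient on all of \<open>T\<close>, and \<open>EP1\<close> brings
  it back to \<open>\<Omega>\<close>; \<open>EP3\<close> does the same for values, and
  \<open>EP4\<close> bounds the stabilisation from above. Elements are compared only through
  inscribed and circumscribed balls, so that translations and dilations replace the affine maps to a
  reference simplex. The nodal basis needs no such map either: its bound \<open>k ^ k\<close> on
  \<open>T\<close> comes from barycentric coordinates lying between 0 and 1. Hausdorff measure is
  given by an explicit set function, so it must be shown to be a measure on the Borel sets before
  surface integrals have any content. The directions are coordinate axes, which need not be in
  general position with respect to the mesh. Lines through a face of low dimension fill a null set,
  and so do the lines inside the hyperplane of a facet parallel to the axis; every other line passes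
  from element to element through transversal facets.\<close>

definition mono_fn :: "('n \<Rightarrow> nat) \<Rightarrow> real^'n \<Rightarrow> real" where
  "mono_fn \<alpha> x = (\<Prod>i\<in>UNIV. (x$i) ^ (\<alpha> i))"

lemma finite_multi_indices: "finite {\<alpha>::'n::finite \<Rightarrow> nat. sum \<alpha> UNIV \<le> k}"
proof -
  have "{\<alpha>::'n \<Rightarrow> nat. sum \<alpha> UNIV \<le> k} \<subseteq> PiE UNIV (\<lambda>_. {..k})"
  proof
    fix \<alpha> :: "'n \<Rightarrow> nat" assume a: "\<alpha> \<in> {\<alpha>. sum \<alpha> UNIV \<le> k}"
    have "\<alpha> i \<le> k" for i
      using a member_le_sum[of i UNIV \<alpha>] by auto
    then show "\<alpha> \<in> PiE UNIV (\<lambda>_. {..k})" by auto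
  qed
  then show ?thesis by (rule finite_subset) (auto intro: finite_PiE)
qed

lemma poly_deg_le_iff:
  "poly_deg_le k p \<longleftrightarrow> (\<exists>c. p = (\<lambda>x. \<Sum>\<alpha>\<in>{\<alpha>. sum \<alpha> UNIV \<le> k}. c \<alpha> * mono_fn \<alpha> x))"
  by (simp add: poly_deg_le_def mono_fn_def)

lemma poly_deg_le_add:
  assumes "poly_deg_le k p" "poly_deg_le k q"
  shows "poly_deg_le k (\<lambda>x. p x + q x)"
proof -
  obtain c e where "p = (\<lambda>x. \<Sum>\<alpha>\<in>{\<alpha>. sum \<alpha> UNIV \<le> k}. c \<alpha> * mono_fn \<alpha> x)"
    "q = (\<lambda>x. \<Sum>\<alpha>\<in>{\<alpha>. sum \<alpha> UNIV \<le> k}. e \<alpha> * mono_fn \<alpha> x)"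
    using assms by (auto simp: poly_deg_le_iff)
  then show ?thesis unfolding poly_deg_le_iff
    by (intro exI[of _ "\<lambda>\<alpha>. c \<alpha> + e \<alpha>"]) (auto simp: distrib_right sum.distrib)
qed

lemma poly_deg_le_cmult:
  assumes "poly_deg_le k p" shows "poly_deg_le k (\<lambda>x. a * p x)"
proof -
  obtain c where "p = (\<lambda>x. \<Sum>\<alpha>\<in>{\<alpha>. sum \<alpha> UNIV \<le> k}. c \<alpha> * mono_fn \<alpha> x)"
    using assms by (auto simp: poly_deg_le_iff)
  then show ?thesis unfolding poly_deg_le_iff
    by (intro exI[of _ "\<lambda>\<alpha>. a * c \<alpha>"]) (auto simp: sum_distrib_left mult.assoc)
qed

lemma poly_deg_le_0 [simp]: "poly_deg_le k (\<lambda>x. 0)"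
  unfolding poly_deg_le_iff by (intro exI[of _ "\<lambda>\<alpha>. 0"]) auto

lemma poly_deg_le_sum:
  assumes "\<And>i. i \<in> I \<Longrightarrow> poly_deg_le k (f i)"
  shows "poly_deg_le k (\<lambda>x. \<Sum>i\<in>I. f i x)"
  using assms by (induction I rule: infinite_finite_induct) (auto intro: poly_deg_le_add)

lemma poly_deg_le_mono_fn:
  assumes "sum \<alpha> UNIV \<le> k" shows "poly_deg_le k (mono_fn \<alpha>)"
  unfolding poly_deg_le_iff
proof (intro exI[of _ "\<lambda>\<beta>. if \<beta> = \<alpha> then 1 else 0"] ext)
  fix x
  have "(\<Sum>\<beta>\<in>{\<alpha>. sum \<alpha> UNIV \<le> k}. (if \<beta> = \<alpha> then 1 else 0) * mono_fn \<beta> x)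
      = (\<Sum>\<beta>\<in>{\<alpha>. sum \<alpha> UNIV \<le> k}. if \<beta> = \<alpha> then mono_fn \<beta> x else 0)"
    by (intro sum.cong) auto
  also have "\<dots> = mono_fn \<alpha> x"
    using assms by (simp add: finite_multi_indices)
  finally show "mono_fn \<alpha> x = (\<Sum>\<beta>\<in>{\<alpha>. sum \<alpha> UNIV \<le> k}. (if \<beta> = \<alpha> then 1 else 0) * mono_fn \<beta> x)" by simp
qed

lemma poly_deg_le_trans:
  assumes "poly_deg_le k p" "k \<le> m" shows "poly_deg_le m p"
proof -
  obtain c where p: "p = (\<lambda>x. \<Sum>\<alpha>\<in>{\<alpha>. sum \<alpha> UNIV \<le> k}. c \<alpha> * mono_fn \<alpha> x)"
    using assms by (auto simp: poly_deg_le_iff)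
  show ?thesis unfolding p
    using assms by (intro poly_deg_le_sum poly_deg_le_cmult poly_deg_le_mono_fn) auto
qed

lemma poly_deg_le_const [simp]: "poly_deg_le k (\<lambda>x. c)"
  using poly_deg_le_cmult[OF poly_deg_le_mono_fn[of "\<lambda>_. 0" k], of c] by (simp add: mono_fn_def)

lemma poly_deg_le_coord: "poly_deg_le 1 (\<lambda>x::real^'n. x $ i)"
proof -
  have "mono_fn (\<lambda>j. if j = i then 1 else 0) = (\<lambda>x::real^'n. x $ i)"
    by (auto simp: mono_fn_def fun_eq_iff if_distrib[of "\<lambda>a. _ ^ a"] cong: if_cong)
  moreover have "poly_deg_le 1 (mono_fn (\<lambda>j::'n. if j = i then 1 else 0))"
    by (rule poly_deg_le_mono_fn) auto
  ultimately show ?thesis by simp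
qed

lemma poly_deg_le_mult:
  assumes "poly_deg_le k p" "poly_deg_le m q"
  shows "poly_deg_le (k + m) (\<lambda>x. p x * q x)"
proof -
  obtain c e where pq: "p = (\<lambda>x. \<Sum>\<alpha>\<in>{\<alpha>. sum \<alpha> UNIV \<le> k}. c \<alpha> * mono_fn \<alpha> x)"
    "q = (\<lambda>x. \<Sum>\<alpha>\<in>{\<alpha>. sum \<alpha> UNIV \<le> m}. e \<alpha> * mono_fn \<alpha> x)"
    using assms by (auto simp: poly_deg_le_iff)
  have "(\<lambda>x. p x * q x) = (\<lambda>x. \<Sum>\<alpha>\<in>{\<alpha>. sum \<alpha> UNIV \<le> k}. \<Sum>\<beta>\<in>{\<alpha>. sum \<alpha> UNIV \<le> m}.
      (c \<alpha> * e \<beta>) * mono_fn (\<lambda>i. \<alpha> i + \<beta> i) x)"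
    unfolding pq sum_product
    by (auto simp: fun_eq_iff mono_fn_def power_add prod.distrib intro!: sum.cong)
  then show ?thesis
    by (auto intro!: poly_deg_le_sum poly_deg_le_cmult poly_deg_le_mono_fn simp: sum.distrib add_mono)
qed

lemma poly_deg_le_power:
  assumes "poly_deg_le m p" shows "poly_deg_le (n * m) (\<lambda>x. p x ^ n)"
proof (induction n)
  case (Suc n)
  then show ?case using poly_deg_le_mult[OF assms Suc] by (simp add: add.commute)
qed simp

lemma poly_deg_le_prod:
  assumes "finite I" "\<And>i. i \<in> I \<Longrightarrow> poly_deg_le (m i) (f i)"
  shows "poly_deg_le (\<Sum>i\<in>I. m i) (\<lambda>x. \<Prod>i\<in>I. f i x)"
  using assms
proof (induction I rule: finite_induct)
  case (insert a I)
  then show ?case using poly_deg_le_mult[of "m a" "f a" "\<Sum>i\<in>I. m i" "\<lambda>x. \<Prod>i\<in>I. f i x"] by simp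
qed simp

lemma poly_deg_le_compose:
  fixes p :: "real^'n \<Rightarrow> real" and L :: "real^'m \<Rightarrow> real^'n"
  assumes "poly_deg_le k p" "\<And>i. poly_deg_le 1 (\<lambda>x. L x $ i)"
  shows "poly_deg_le k (\<lambda>x. p (L x))"
proof -
  obtain c where p: "p = (\<lambda>x. \<Sum>\<alpha>\<in>{\<alpha>. sum \<alpha> UNIV \<le> k}. c \<alpha> * mono_fn \<alpha> x)"
    using assms by (auto simp: poly_deg_le_iff)
  have "poly_deg_le k (\<lambda>x. mono_fn \<alpha> (L x))" if "sum \<alpha> UNIV \<le> k" for \<alpha>
    unfolding mono_fn_def
  proof (rule poly_deg_le_trans[OF _ that], rule poly_deg_le_prod)
    show "poly_deg_le (\<alpha> i) (\<lambda>x. L x $ i ^ \<alpha> i)" for i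
      using poly_deg_le_power[OF assms(2), of "\<alpha> i"] by simp
  qed simp
  then show ?thesis unfolding p by (intro poly_deg_le_sum poly_deg_le_cmult) auto
qed

lemma poly_deg_le_affine:
  fixes p :: "real^'n \<Rightarrow> real"
  assumes "poly_deg_le k p" shows "poly_deg_le k (\<lambda>z. p (c + r *\<^sub>R z))"
proof (rule poly_deg_le_compose[OF assms])
  show "poly_deg_le 1 (\<lambda>x. (c + r *\<^sub>R x) $ i)" for i
    using poly_deg_le_add[OF poly_deg_le_const poly_deg_le_cmult[OF poly_deg_le_coord]] by simp
qed

text \<open>Splitting off one coordinate gives the induction on the degree, used for gradients of
  monomials and again for their expansion in Newton products.\<close>

lemma mono_fn_Suc:
  fixes \<alpha> :: "'n::finite \<Rightarrow> nat"
  assumes "sum \<alpha> UNIV = Suc m"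
  shows "\<exists>i \<beta>. sum \<beta> UNIV = m \<and> (\<forall>x. mono_fn \<alpha> x = x $ i * mono_fn \<beta> x)"
proof -
  have "\<exists>i. \<alpha> i \<noteq> 0" using assms by (metis nat.distinct(1) sum.neutral)
  then obtain i where i: "\<alpha> i \<noteq> 0" by blast
  define \<beta> where "\<beta> = \<alpha>(i := \<alpha> i - 1)"
  have "sum \<alpha> UNIV = \<alpha> i + sum \<alpha> (UNIV - {i})" by (rule sum.remove) auto
  moreover have "sum \<beta> UNIV = \<beta> i + sum \<beta> (UNIV - {i})" by (rule sum.remove) auto
  moreover have "\<beta> i = \<alpha> i - 1" by (simp add: \<beta>_def)
  moreover have "sum \<beta> (UNIV - {i}) = sum \<alpha> (UNIV - {i})" by (intro sum.cong) (auto simp: \<beta>_def)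
  ultimately have sb: "sum \<beta> UNIV = m" using i assms by linarith
  have e: "mono_fn \<alpha> x = x $ i * mono_fn \<beta> x" for x
  proof -
    have "mono_fn \<alpha> x = x $ i ^ \<alpha> i * (\<Prod>j\<in>UNIV - {i}. x $ j ^ \<alpha> j)"
      unfolding mono_fn_def by (rule prod.remove) auto
    moreover have "mono_fn \<beta> x = x $ i ^ (\<alpha> i - 1) * (\<Prod>j\<in>UNIV - {i}. x $ j ^ \<beta> j)"
      unfolding mono_fn_def by (subst prod.remove[of _ i]) (auto simp: \<beta>_def)
    moreover have "(\<Prod>j\<in>UNIV - {i}. x $ j ^ \<beta> j) = (\<Prod>j\<in>UNIV - {i}. x $ j ^ \<alpha> j)"
      by (intro prod.cong) (auto simp: \<beta>_def)
    moreover have "x $ i ^ \<alpha> i = x $ i * x $ i ^ (\<alpha> i - 1)"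
      using i by (metis not_gr_zero power_eq_if)
    ultimately show ?thesis by simp
  qed
  show ?thesis using sb e by blast
qed

text \<open>Keeping the degree of the monomial for its gradient, instead of one less, avoids
  truncated subtraction; later only membership in a polynomial space of fixed degree
  matters.\<close>

lemma mono_fn_has_derivative:
  fixes \<alpha> :: "'n::finite \<Rightarrow> nat"
  shows "\<exists>G. (\<forall>x. (mono_fn \<alpha> has_derivative (\<lambda>h. G x \<bullet> h)) (at x)) \<and>
           (\<forall>i. poly_deg_le (sum \<alpha> UNIV) (\<lambda>x. G x $ i))"
proof (induction "sum \<alpha> UNIV" arbitrary: \<alpha>)
  case 0
  then have "mono_fn \<alpha> = (\<lambda>x. 1)" by (auto simp: mono_fn_def)
  then show ?case by (intro exI[of _ "\<lambda>x. 0"]) auto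
next
  case (Suc m)
  then obtain i \<beta> where sb: "m = sum \<beta> UNIV" and e: "\<And>x. mono_fn \<alpha> x = x $ i * mono_fn \<beta> x"
    using mono_fn_Suc[of \<alpha> m] by metis
  obtain G where G: "\<And>x. (mono_fn \<beta> has_derivative (\<lambda>h. G x \<bullet> h)) (at x)"
    "\<And>i. poly_deg_le (sum \<beta> UNIV) (\<lambda>x. G x $ i)"
    using Suc(1)[OF sb] by blast
  define G' where "G' = (\<lambda>x. mono_fn \<beta> x *\<^sub>R axis i 1 + x $ i *\<^sub>R G x)"
  have "(mono_fn \<alpha> has_derivative (\<lambda>h. G' x \<bullet> h)) (at x)" for x
  proof -
    have c: "((\<lambda>x. x $ i) has_derivative (\<lambda>h. h $ i)) (at x)"
      by (simp add: bounded_linear_vec_nth bounded_linear_imp_has_derivative)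
    have "((\<lambda>x. x $ i * mono_fn \<beta> x) has_derivative (\<lambda>h. x $ i * (G x \<bullet> h) + h $ i * mono_fn \<beta> x)) (at x)"
      by (rule has_derivative_mult[OF c G(1)])
    moreover have "(\<lambda>h. x $ i * (G x \<bullet> h) + h $ i * mono_fn \<beta> x) = (\<lambda>h. G' x \<bullet> h)"
      by (auto simp: G'_def inner_add_left inner_axis' fun_eq_iff)
    moreover have "mono_fn \<alpha> = (\<lambda>x. x $ i * mono_fn \<beta> x)" using e by auto
    ultimately show ?thesis by simp
  qed
  moreover have "poly_deg_le (sum \<alpha> UNIV) (\<lambda>x. G' x $ j)" for j
  proof -
    have 1: "poly_deg_le (sum \<alpha> UNIV) (mono_fn \<beta>)"
      by (rule poly_deg_le_mono_fn) (use sb Suc(2) in linarith)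
    have "poly_deg_le (1 + sum \<beta> UNIV) (\<lambda>x. x $ i * G x $ j)"
      by (rule poly_deg_le_mult[OF poly_deg_le_coord G(2)])
    then have 2: "poly_deg_le (sum \<alpha> UNIV) (\<lambda>x. x $ i * G x $ j)" using sb Suc(2) by simp
    have "poly_deg_le (sum \<alpha> UNIV) (\<lambda>x. (axis i 1 :: real^'n) $ j * mono_fn \<beta> x + x $ i * G x $ j)"
      by (rule poly_deg_le_add[OF poly_deg_le_cmult[OF 1] 2])
    then show ?thesis by (simp add: G'_def mult.commute)
  qed
  ultimately show ?case by blast
qed

lemma poly_has_derivative_ex:
  fixes p :: "real^'n \<Rightarrow> real"
  assumes "poly_deg_le k p"
  shows "\<exists>G. (\<forall>x. (p has_derivative (\<lambda>h. G x \<bullet> h)) (at x)) \<and> (\<forall>i. poly_deg_le k (\<lambda>x. G x $ i))"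
proof -
  obtain c where p: "p = (\<lambda>x. \<Sum>\<alpha>\<in>{\<alpha>. sum \<alpha> UNIV \<le> k}. c \<alpha> * mono_fn \<alpha> x)"
    using assms by (auto simp: poly_deg_le_iff)
  obtain G where G: "\<And>\<alpha> x. (mono_fn \<alpha> has_derivative (\<lambda>h. G \<alpha> x \<bullet> h)) (at x)"
    "\<And>\<alpha> i. poly_deg_le (sum \<alpha> UNIV) (\<lambda>x::real^'n. G \<alpha> x $ i)"
    using mono_fn_has_derivative by metis
  define H where "H = (\<lambda>x. \<Sum>\<alpha>\<in>{\<alpha>. sum \<alpha> UNIV \<le> k}. c \<alpha> *\<^sub>R G \<alpha> x)"
  have "(p has_derivative (\<lambda>h. H x \<bullet> h)) (at x)" for x
    unfolding p H_def inner_sum_left inner_scaleR_left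
    by (intro has_derivative_sum has_derivative_mult_right G)
  moreover have "poly_deg_le k (\<lambda>x. H x $ i)" for i
    unfolding H_def sum_component vector_scaleR_component real_scaleR_def
    by (intro poly_deg_le_sum poly_deg_le_cmult) (auto intro: poly_deg_le_trans[OF G(2)])
  ultimately show ?thesis by blast
qed

text \<open>Uniqueness of the derivative frees \<open>grad\<close> from the choice operator inside
  \<open>frechet_derivative\<close>.\<close>

lemma grad_eqI:
  assumes "(p has_derivative (\<lambda>h. g \<bullet> h)) (at x)"
  shows "grad p x = g"
  using frechet_derivative_at[OF assms] unfolding grad_def
  by (simp add: vec_eq_iff inner_axis flip: fun_eq_iff)
    (metis inner_axis inner_real_def mult.right_neutral)

lemma poly_has_derivative_grad:
  assumes "poly_deg_le k p"
  shows "(p has_derivative (\<lambda>h. grad p x \<bullet> h)) (at x)"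
  using poly_has_derivative_ex[OF assms] grad_eqI by metis

lemma poly_grad_component:
  assumes "poly_deg_le k p"
  shows "poly_deg_le k (\<lambda>x. grad p x $ i)"
proof -
  obtain G where "\<And>x. (p has_derivative (\<lambda>h. G x \<bullet> h)) (at x)" "\<And>i. poly_deg_le k (\<lambda>x. G x $ i)"
    using poly_has_derivative_ex[OF assms] by blast
  moreover from this(1) have "grad p x = G x" for x by (rule grad_eqI)
  ultimately show ?thesis by presburger
qed

lemma poly_continuous:
  assumes "poly_deg_le k p" shows "continuous_on A p"
  by (meson assms continuous_at_imp_continuous_on has_derivative_continuous poly_has_derivative_grad)

lemma poly_grad_continuous:
  assumes "poly_deg_le k p" shows "continuous_on A (grad p)"
  using poly_continuous[OF poly_grad_component[OF assms]]
  by (subst continuous_on_componentwise) (auto simp: Basis_vec_def inner_axis)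

lemma grad_lincomb:
  assumes "poly_deg_le k p" "poly_deg_le k q"
  shows "grad (\<lambda>x. a * p x + b * q x) x = a *\<^sub>R grad p x + b *\<^sub>R grad q x"
proof (rule grad_eqI)
  have "((\<lambda>x. a * p x + b * q x) has_derivative (\<lambda>h. a * (grad p x \<bullet> h) + b * (grad q x \<bullet> h))) (at x)"
    by (intro has_derivative_add has_derivative_mult_right poly_has_derivative_grad[OF assms(1)]
        poly_has_derivative_grad[OF assms(2)])
  then show "((\<lambda>x. a * p x + b * q x) has_derivative (\<lambda>h. (a *\<^sub>R grad p x + b *\<^sub>R grad q x) \<bullet> h)) (at x)"
    by (simp add: inner_add_left)
qed


section \<open>Lagrange interpolation on a simplex\<close>

text \<open>The linear span of a set of functions, in inductive form so that statements linear in
  \<open>f\<close> reduce to generators by rule induction.\<close>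

inductive lincomb :: "('a \<Rightarrow> real) set \<Rightarrow> ('a \<Rightarrow> real) \<Rightarrow> bool" for F where
  zero: "lincomb F (\<lambda>_. 0)"
| step: "g \<in> F \<Longrightarrow> lincomb F f \<Longrightarrow> lincomb F (\<lambda>x. c * g x + f x)"

lemma lincomb_base: "g \<in> F \<Longrightarrow> lincomb F g"
  using lincomb.step[OF _ lincomb.zero, of g F 1] by simp

lemma lincomb_add: "lincomb F f \<Longrightarrow> lincomb F g \<Longrightarrow> lincomb F (\<lambda>x. f x + g x)"
proof (induction rule: lincomb.induct)
  case (step h f c)
  then show ?case using lincomb.step[of h F "\<lambda>x. f x + g x" c] by (simp add: add.assoc)
qed simp

lemma lincomb_cmult: "lincomb F f \<Longrightarrow> lincomb F (\<lambda>x. a * f x)"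
proof (induction rule: lincomb.induct)
  case (step h f c)
  then show ?case using lincomb.step[of h F "\<lambda>x. a * f x" "a * c"] by (simp add: algebra_simps)
qed (simp add: lincomb.zero)

lemma lincomb_sum: "(\<And>i. i \<in> I \<Longrightarrow> lincomb F (f i)) \<Longrightarrow> lincomb F (\<lambda>x. \<Sum>i\<in>I. f i x)"
  by (induction I rule: infinite_finite_induct) (auto intro: lincomb_add lincomb.zero)

text \<open>Used with a coordinate as multiplier to raise the degree, and with the constant 1 for
  transitivity.\<close>

lemma lincomb_multiplier:
  assumes "lincomb F f" "\<And>g. g \<in> F \<Longrightarrow> lincomb F' (\<lambda>x. h x * g x)"
  shows "lincomb F' (\<lambda>x. h x * f x)"
  using assms
proof (induction rule: lincomb.induct)
  case (step g f c)
  then have "lincomb F' (\<lambda>x. c * (h x * g x) + h x * f x)"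
    by (intro lincomb_add lincomb_cmult) auto
  then show ?case by (simp add: algebra_simps)
qed (simp add: lincomb.zero)

lemma lincomb_trans:
  assumes "lincomb F f" "\<And>g. g \<in> F \<Longrightarrow> lincomb F' g"
  shows "lincomb F' f"
  using lincomb_multiplier[of F f F' "\<lambda>_. 1"] assms by simp

text \<open>The last assumption is affine independence in usable form: weights of sum 1 can be read
  off from the point they represent.\<close>

locale barycentric =
  fixes S :: "(real^'n) set" and lam :: "real^'n \<Rightarrow> real^'n \<Rightarrow> real"
  assumes fin: "finite S" and cardS: "card S = CARD('n) + 1"
    and lam_affine: "p \<in> S \<Longrightarrow> poly_deg_le 1 (lam p)"
    and lam_sum: "(\<Sum>p\<in>S. lam p x) = 1"
    and lam_comb: "(\<Sum>p\<in>S. lam p x *\<^sub>R p) = x"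
    and lam_unique: "sum u S = 1 \<Longrightarrow> p \<in> S \<Longrightarrow> lam p (\<Sum>q\<in>S. u q *\<^sub>R q) = u p"

lemma barycentric_exists:
  fixes S :: "(real^'n) set"
  assumes "finite S" "card S = CARD('n) + 1" "\<not> affine_dependent S"
  shows "\<exists>lam. barycentric S lam"
proof -
  have "aff_dim S = int (CARD('n))"
    using aff_dim_affine_independent[OF assms(3)] assms(2) by simp
  then have "affine hull S = UNIV" using aff_dim_eq_full[of S] by simp
  moreover have "affine hull S = {y. \<exists>u. sum u S = 1 \<and> (\<Sum>v\<in>S. u v *\<^sub>R v) = y}"
    by (rule affine_hull_finite[OF assms(1)])
  ultimately have "\<forall>y. \<exists>u. sum u S = 1 \<and> (\<Sum>v\<in>S. u v *\<^sub>R v) = y" by auto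
  then obtain u where u: "\<And>y. sum (u y) S = 1" "\<And>y. (\<Sum>v\<in>S. u y v *\<^sub>R v) = y"
    by metis
  have uniq: "w p = u (\<Sum>q\<in>S. w q *\<^sub>R q) p" if "sum w S = 1" "p \<in> S" for w p
  proof (rule ccontr)
    let ?y = "\<Sum>q\<in>S. w q *\<^sub>R q"
    assume n: "w p \<noteq> u ?y p"
    have "sum (\<lambda>q. w q - u ?y q) S = 0" using that u by (simp add: sum_subtractf)
    moreover have "(\<Sum>q\<in>S. (w q - u ?y q) *\<^sub>R q) = 0"
      using u(2) by (simp add: scaleR_diff_left sum_subtractf)
    moreover have "\<exists>v\<in>S. w v - u ?y v \<noteq> 0" using n that by auto
    ultimately have "affine_dependent S"
      unfolding affine_dependent_explicit_finite[OF assms(1)] by (intro exI[of _ "\<lambda>q. w q - u ?y q"]) auto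
    then show False using assms by simp
  qed
  define b where "b = (\<lambda>i::'n. axis i (1::real))"
  \<comment> \<open>The affine candidate \<open>w\<close> takes the correct values at the origin and
    at the unit vectors. Its weights sum to 1 and represent \<open>x\<close>, so uniqueness
    identifies it with \<open>u x\<close>.\<close>
  have aff: "u x p = u 0 p + (\<Sum>i\<in>UNIV. (u (b i) p - u 0 p) * x $ i)" if "p \<in> S" for x p
  proof -
    define w where "w = (\<lambda>p. u 0 p + (\<Sum>i\<in>UNIV. (u (b i) p - u 0 p) * x $ i))"
    have "sum w S = sum (u 0) S + (\<Sum>i\<in>UNIV. (\<Sum>p\<in>S. u (b i) p - u 0 p) * x $ i)"
      unfolding w_def sum.distrib sum_distrib_right by (subst sum.swap) simp
    also have "\<dots> = 1" by (simp add: sum_subtractf u)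
    finally have 1: "sum w S = 1" .
    have "(\<Sum>q\<in>S. w q *\<^sub>R q) = (\<Sum>q\<in>S. u 0 q *\<^sub>R q) + (\<Sum>q\<in>S. \<Sum>i\<in>UNIV. (x $ i * (u (b i) q - u 0 q)) *\<^sub>R q)"
      unfolding w_def by (simp add: scaleR_add_left sum.distrib scaleR_sum_left mult.commute)
    also have "(\<Sum>q\<in>S. \<Sum>i\<in>UNIV. (x $ i * (u (b i) q - u 0 q)) *\<^sub>R q) =
       (\<Sum>i\<in>UNIV. x $ i *\<^sub>R ((\<Sum>q\<in>S. u (b i) q *\<^sub>R q) - (\<Sum>q\<in>S. u 0 q *\<^sub>R q)))"
      by (subst sum.swap) (simp add: scaleR_diff_left scaleR_diff_right sum_subtractf scaleR_sum_right right_diff_distrib)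
    also have "\<dots> = (\<Sum>i\<in>UNIV. x $ i *\<^sub>R b i)" by (simp add: u)
    also have "\<dots> = x" by (simp add: b_def vec_eq_iff axis_def if_distrib cong: if_cong)
    finally have 2: "(\<Sum>q\<in>S. w q *\<^sub>R q) = x" by (simp add: u)
    show ?thesis using uniq[OF 1 that] unfolding 2 by (simp add: w_def)
  qed
  have pd: "poly_deg_le 1 (\<lambda>x. u x p)" if "p \<in> S" for p
  proof -
    have "poly_deg_le 1 (\<lambda>x. u 0 p + (\<Sum>i\<in>UNIV. (u (b i) p - u 0 p) * x $ i))"
      by (rule poly_deg_le_add[OF poly_deg_le_const poly_deg_le_sum[OF poly_deg_le_cmult[OF poly_deg_le_coord]]])
    moreover have "(\<lambda>x. u x p) = (\<lambda>x. u 0 p + (\<Sum>i\<in>UNIV. (u (b i) p - u 0 p) * x $ i))"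
      by (rule ext) (rule aff[OF that])
    ultimately show ?thesis by (rule ssubst[rotated])
  qed
  show ?thesis
  proof (rule exI[of _ "\<lambda>p x. u x p"], unfold_locales)
    show "p \<in> S \<Longrightarrow> poly_deg_le 1 (\<lambda>x. u x p)" for p by (rule pd)
    show "sum w S = 1 \<Longrightarrow> p \<in> S \<Longrightarrow> u (\<Sum>q\<in>S. w q *\<^sub>R q) p = w p" for w p
      by (rule uniq[symmetric])
    show "(\<Sum>p\<in>S. u x p) = 1" "(\<Sum>p\<in>S. u x p *\<^sub>R p) = x" for x by (rule u)+
  qed (rule assms)+
qed

context barycentric
begin

text \<open>A product over the vertices of falling factorials of \<open>k * lam p x\<close>. At a
  lattice node the factor of a vertex vanishes as soon as the index of the node there is below
  \<open>\<alpha> p\<close>.\<close>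

definition newton :: "nat \<Rightarrow> (real^'n \<Rightarrow> nat) \<Rightarrow> real^'n \<Rightarrow> real" where
  "newton k \<alpha> x = (\<Prod>p\<in>S. \<Prod>j<\<alpha> p. (real k * lam p x - real j))"

definition node :: "nat \<Rightarrow> (real^'n \<Rightarrow> nat) \<Rightarrow> real^'n" where
  "node k \<alpha> = (\<Sum>p\<in>S. (real (\<alpha> p) / real k) *\<^sub>R p)"

lemma prod_fact_nonzero [simp]: "(\<Prod>p\<in>S. fact (f p)) \<noteq> (0::real)"
  using fin by simp

lemma lam_node:
  assumes "sum \<alpha> S = k" "k \<ge> 1" "p \<in> S"
  shows "lam p (node k \<alpha>) = real (\<alpha> p) / real k"
  unfolding node_def
proof (rule lam_unique)
  have "(\<Sum>q\<in>S. real (\<alpha> q) / real k) = real (sum \<alpha> S) / real k"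
    by (simp add: sum_divide_distrib)
  then show "(\<Sum>q\<in>S. real (\<alpha> q) / real k) = 1" using assms by simp
qed fact

lemma newton_Suc:
  assumes "p \<in> S"
  shows "newton k (\<alpha>(p := Suc (\<alpha> p))) x = (real k * lam p x - real (\<alpha> p)) * newton k \<alpha> x"
proof -
  have "(\<Prod>q\<in>S - {p}. \<Prod>j<(\<alpha>(p := Suc (\<alpha> p))) q. real k * lam q x - real j) =
     (\<Prod>q\<in>S - {p}. \<Prod>j<\<alpha> q. real k * lam q x - real j)"
    by (intro prod.cong) auto
  then show ?thesis
    unfolding newton_def by (subst (1 2) prod.remove[OF fin assms]) simp
qed

lemma sum_upd:
  fixes \<alpha> :: "real^'n \<Rightarrow> nat"
  assumes "p \<in> S" shows "sum (\<alpha>(p := Suc (\<alpha> p))) S = Suc (sum \<alpha> S)"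
proof -
  have "sum (\<alpha>(p := Suc (\<alpha> p))) (S - {p}) = sum \<alpha> (S - {p})" by (intro sum.cong) auto
  then show ?thesis by (subst (1 2) sum.remove[OF fin assms]) simp
qed

text \<open>The barycentric coordinates add up to one, so summing \<open>newton_Suc\<close> over the vertices
  multiplies by \<open>k - sum \<alpha> S\<close>: the degree can be raised until it is \<open>k\<close>.\<close>
lemma newton_raise:
  assumes "sum \<alpha> S < k"
  shows "newton k \<alpha> x = (\<Sum>p\<in>S. (1 / (real k - real (sum \<alpha> S))) * newton k (\<alpha>(p := Suc (\<alpha> p))) x)"
proof -
  have "(\<Sum>p\<in>S. newton k (\<alpha>(p := Suc (\<alpha> p))) x) = (\<Sum>p\<in>S. real k * lam p x - real (\<alpha> p)) * newton k \<alpha> x"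
    by (simp add: newton_Suc sum_distrib_right)
  also have "(\<Sum>p\<in>S. real k * lam p x - real (\<alpha> p)) = real k - real (sum \<alpha> S)"
    by (simp add: sum_subtractf lam_sum flip: sum_distrib_left)
  finally have "(\<Sum>p\<in>S. newton k (\<alpha>(p := Suc (\<alpha> p))) x) = (real k - real (sum \<alpha> S)) * newton k \<alpha> x" .
  moreover have "real k - real (sum \<alpha> S) \<noteq> 0" using assms by linarith
  ultimately show ?thesis unfolding sum_distrib_left[symmetric] by simp
qed

text \<open>Induction on the missing degree \<open>k - sum \<alpha> S\<close>, raised by one in each
  step.\<close>

lemma newton_lincomb:
  assumes "sum \<alpha> S \<le> k"
  shows "lincomb {newton k \<beta> | \<beta>. sum \<beta> S = k} (newton k \<alpha>)"
  using assms
proof (induction "k - sum \<alpha> S" arbitrary: \<alpha>)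
  case 0
  then show ?case by (intro lincomb_base) auto
next
  case (Suc m)
  have "lincomb {newton k \<beta> | \<beta>. sum \<beta> S = k} (newton k (\<alpha>(p := Suc (\<alpha> p))))" if "p \<in> S" for p
    by (rule Suc(1)) (use Suc(2) sum_upd[OF that] in auto)
  then have "lincomb {newton k \<beta> | \<beta>. sum \<beta> S = k}
     (\<lambda>x. \<Sum>p\<in>S. (1 / (real k - real (sum \<alpha> S))) * newton k (\<alpha>(p := Suc (\<alpha> p))) x)"
    by (intro lincomb_sum lincomb_cmult)
  moreover have "newton k \<alpha> = (\<lambda>x. \<Sum>p\<in>S. (1 / (real k - real (sum \<alpha> S))) * newton k (\<alpha>(p := Suc (\<alpha> p))) x)"
    using newton_raise Suc(2) by auto
  ultimately show ?case by simp
qed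

text \<open>Multiplication by a coordinate raises the Newton degree by at most one:
  \<open>x $ i\<close> is the combination of the \<open>p $ i\<close> with weights
  \<open>lam p x\<close>, and \<open>k * lam p x\<close> is the next Newton factor plus the number
  \<open>\<gamma> p\<close>.\<close>

lemma mono_fn_lincomb:
  assumes "k \<ge> 1"
  shows "lincomb {newton k \<beta> | \<beta>. sum \<beta> S \<le> sum \<alpha> UNIV} (mono_fn \<alpha>)"
proof (induction "sum \<alpha> UNIV" arbitrary: \<alpha>)
  case 0
  then have "mono_fn \<alpha> = newton k (\<lambda>_. 0)" by (auto simp: mono_fn_def newton_def)
  then show ?case by (intro lincomb_base) force
next
  case (Suc m)
  then obtain i \<beta> where sb: "m = sum \<beta> UNIV" and e: "\<And>x. mono_fn \<alpha> x = x $ i * mono_fn \<beta> x"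
    using mono_fn_Suc[of \<alpha> m] by metis
  let ?F = "{newton k \<beta> | \<beta>. sum \<beta> S \<le> Suc m}"
  have l: "lincomb ?F (\<lambda>x. x $ i * newton k \<gamma> x)" if g: "sum \<gamma> S \<le> m" for \<gamma>
  proof -
    have "x $ i * newton k \<gamma> x = (\<Sum>p\<in>S. (p $ i / real k) * newton k (\<gamma>(p := Suc (\<gamma> p))) x
       + (p $ i * real (\<gamma> p) / real k) * newton k \<gamma> x)" for x
    proof -
      have "(\<Sum>p\<in>S. (p $ i / real k) * newton k (\<gamma>(p := Suc (\<gamma> p))) x + (p $ i * real (\<gamma> p) / real k) * newton k \<gamma> x)
          = (\<Sum>p\<in>S. lam p x * p $ i * newton k \<gamma> x)"
        by (intro sum.cong) (use assms in \<open>auto simp: newton_Suc field_simps\<close>)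
      also have "\<dots> = ((\<Sum>p\<in>S. lam p x *\<^sub>R p) $ i) * newton k \<gamma> x"
        by (simp add: sum_distrib_right)
      finally show ?thesis by (simp add: lam_comb)
    qed
    moreover have "lincomb ?F (\<lambda>x. \<Sum>p\<in>S. (p $ i / real k) * newton k (\<gamma>(p := Suc (\<gamma> p))) x
       + (p $ i * real (\<gamma> p) / real k) * newton k \<gamma> x)"
    proof (intro lincomb_sum lincomb_add lincomb_cmult)
      fix p assume "p \<in> S"
      then show "lincomb ?F (newton k (\<gamma>(p := Suc (\<gamma> p))))"
        using sum_upd[of p \<gamma>] g by (intro lincomb_base) (force)
      show "lincomb ?F (newton k \<gamma>)" using g by (intro lincomb_base) force
    qed
    ultimately show ?thesis by presburger
  qed
  have "lincomb ?F (\<lambda>x. x $ i * mono_fn \<beta> x)"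
    by (rule lincomb_multiplier[OF Suc(1)[OF sb]]) (use l sb in auto)
  moreover have "mono_fn \<alpha> = (\<lambda>x. x $ i * mono_fn \<beta> x)" using e by auto
  ultimately show ?case using Suc(2) by simp
qed

lemma poly_lincomb:
  assumes "poly_deg_le k p" "k \<ge> 1"
  shows "lincomb {newton k \<beta> | \<beta>. sum \<beta> S = k} p"
proof -
  obtain c where p: "p = (\<lambda>x. \<Sum>\<alpha>\<in>{\<alpha>. sum \<alpha> UNIV \<le> k}. c \<alpha> * mono_fn \<alpha> x)"
    using assms by (auto simp: poly_deg_le_iff)
  show ?thesis unfolding p
  proof (intro lincomb_sum lincomb_cmult)
    fix \<alpha> :: "'n \<Rightarrow> nat" assume a: "\<alpha> \<in> {\<alpha>. sum \<alpha> UNIV \<le> k}"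
    show "lincomb {newton k \<beta> | \<beta>. sum \<beta> S = k} (mono_fn \<alpha>)"
      by (rule lincomb_trans[OF mono_fn_lincomb[OF assms(2), of \<alpha>]]) (use a newton_lincomb in auto)
  qed
qed

lemma newton_poly: "poly_deg_le (sum \<alpha> S) (newton k \<alpha>)"
  unfolding newton_def
proof (rule poly_deg_le_prod[OF fin])
  fix p assume p: "p \<in> S"
  have "poly_deg_le (\<Sum>j<\<alpha> p. 1) (\<lambda>x. \<Prod>j<\<alpha> p. real k * lam p x + (- real j))"
    by (intro poly_deg_le_prod poly_deg_le_add poly_deg_le_cmult lam_affine[OF p] poly_deg_le_const) simp
  then show "poly_deg_le (\<alpha> p) (\<lambda>x. \<Prod>j<\<alpha> p. real k * lam p x - real j)" by simp
qed

text \<open>Vanishing off \<open>S\<close> makes each multi-index a single function, so that the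
  indices can be counted and compared by equality.\<close>

definition lattice :: "nat \<Rightarrow> (real^'n \<Rightarrow> nat) set" where
  "lattice k = {\<alpha>. (\<forall>p. p \<notin> S \<longrightarrow> \<alpha> p = 0) \<and> sum \<alpha> S = k}"

text \<open>The product of factorials is the value of the Newton product at its own node.\<close>

definition lagr :: "nat \<Rightarrow> (real^'n \<Rightarrow> nat) \<Rightarrow> real^'n \<Rightarrow> real" where
  "lagr k \<alpha> x = newton k \<alpha> x / (\<Prod>p\<in>S. fact (\<alpha> p))"

lemma lattice_le: "\<alpha> \<in> lattice k \<Longrightarrow> \<alpha> p \<le> k"
  using member_le_sum[of p S \<alpha>] fin unfolding lattice_def by (cases "p \<in> S") auto

lemma finite_lattice: "finite (lattice k)" and card_lattice: "card (lattice k) \<le> (k + 1) ^ (CARD('n) + 1)"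
proof -
  let ?E = "PiE S (\<lambda>_. {..k})"
  have inj: "inj_on (\<lambda>\<alpha>. restrict \<alpha> S) (lattice k)"
  proof (rule inj_onI)
    fix a b assume "a \<in> lattice k" "b \<in> lattice k" and e: "restrict a S = restrict b S"
    show "a = b"
    proof
      fix p show "a p = b p"
        using \<open>a \<in> lattice k\<close> \<open>b \<in> lattice k\<close> fun_cong[OF e, of p] by (cases "p \<in> S") (auto simp: lattice_def)
    qed
  qed
  have sub: "(\<lambda>\<alpha>. restrict \<alpha> S) ` lattice k \<subseteq> ?E" using lattice_le by auto
  have f: "finite ?E" using fin by (intro finite_PiE) auto
  show "finite (lattice k)" using inj_on_finite[OF inj sub f] .
  have "card (lattice k) \<le> card ?E" using card_inj_on_le[OF inj sub f] .
  also have "card ?E = (k + 1) ^ (CARD('n) + 1)" using fin by (simp add: card_PiE cardS)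
  finally show "card (lattice k) \<le> (k + 1) ^ (CARD('n) + 1)" .
qed

text \<open>Two indices of equal sum that differ on \<open>S\<close> satisfy
  \<open>\<alpha> p < \<beta> p\<close> at some vertex, and there the factor with
  \<open>j = \<alpha> p\<close> is zero.\<close>

lemma newton_node:
  assumes "sum \<alpha> S = k" "sum \<beta> S = k" "k \<ge> 1"
  shows "newton k \<beta> (node k \<alpha>) = (if \<forall>p\<in>S. \<alpha> p = \<beta> p then (\<Prod>p\<in>S. fact (\<beta> p)) else 0)"
proof -
  have e: "newton k \<beta> (node k \<alpha>) = (\<Prod>p\<in>S. \<Prod>j<\<beta> p. (real (\<alpha> p) - real j))"
    unfolding newton_def using assms by (intro prod.cong refl) (simp add: lam_node)
  show ?thesis
  proof (cases "\<forall>p\<in>S. \<alpha> p = \<beta> p")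
    case True
    have f: "(\<Prod>j<n. (real n - real j)) = fact n" for n :: nat
    proof -
      have "(\<Prod>j<n. (real n - real j)) = real (\<Prod>j = 0..<n. n - j)"
        unfolding of_nat_prod by (intro prod.cong) (auto simp: of_nat_diff)
      then show ?thesis by (simp add: fact_prod_rev)
    qed
    have "(\<Prod>p\<in>S. \<Prod>j<\<beta> p. (real (\<alpha> p) - real j)) = (\<Prod>p\<in>S. fact (\<beta> p))"
      using True f by (intro prod.cong) auto
    then show ?thesis using True e by simp
  next
    case False
    have "\<exists>p\<in>S. \<alpha> p < \<beta> p"
    proof (rule ccontr)
      assume "\<not> ?thesis"
      then have le: "\<And>p. p \<in> S \<Longrightarrow> \<beta> p \<le> \<alpha> p" by force
      obtain p where "p \<in> S" "\<beta> p < \<alpha> p" using False le by force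
      then have "sum \<beta> S < sum \<alpha> S" using le fin by (intro sum_strict_mono_ex1) auto
      then show False using assms by simp
    qed
    then obtain p where p: "p \<in> S" "\<alpha> p < \<beta> p" by blast
    then have "(\<Prod>j<\<beta> p. (real (\<alpha> p) - real j)) = 0" by (intro prod_zero) auto
    then have "(\<Prod>p\<in>S. \<Prod>j<\<beta> p. (real (\<alpha> p) - real j)) = 0"
      using p fin by (intro prod_zero) auto
    then show ?thesis using False e by auto
  qed
qed

lemma lagr_node:
  assumes "\<alpha> \<in> lattice k" "\<beta> \<in> lattice k" "k \<ge> 1"
  shows "lagr k \<beta> (node k \<alpha>) = (if \<alpha> = \<beta> then 1 else 0)"
proof -
  have "\<alpha> = \<beta>" if "\<forall>p\<in>S. \<alpha> p = \<beta> p"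
  proof
    show "\<alpha> p = \<beta> p" for p using that assms by (cases "p \<in> S") (auto simp: lattice_def)
  qed
  then have "(\<forall>p\<in>S. \<alpha> p = \<beta> p) \<longleftrightarrow> \<alpha> = \<beta>" by auto
  then show ?thesis using newton_node[of \<alpha> k \<beta>] assms by (auto simp: lagr_def lattice_def)
qed

lemma lagr_poly: "\<alpha> \<in> lattice k \<Longrightarrow> poly_deg_le k (lagr k \<alpha>)"
  using poly_deg_le_cmult[OF newton_poly, of \<alpha> "1 / (\<Prod>p\<in>S. fact (\<alpha> p))" k]
  by (simp add: lagr_def[abs_def] lattice_def)

text \<open>Both sides are linear in \<open>f\<close>, so the expansion in Newton products of degree
  exactly \<open>k\<close> reduces the claim to a single product, where the nodal values decide.
  This replaces a dimension count.\<close>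

lemma lagrange_interpolation:
  assumes "poly_deg_le k f" "k \<ge> 1"
  shows "f x = (\<Sum>\<alpha>\<in>lattice k. f (node k \<alpha>) * lagr k \<alpha> x)"
proof -
  have "\<forall>x. f x = (\<Sum>\<alpha>\<in>lattice k. f (node k \<alpha>) * lagr k \<alpha> x)"
    using poly_lincomb[OF assms]
  proof (induction rule: lincomb.induct)
    case zero
    then show ?case by simp
  next
    case (step g f c)
    then obtain \<beta>' where b': "g = newton k \<beta>'" "sum \<beta>' S = k" by auto
    \<comment> \<open>The index of a Newton product is arbitrary off \<open>S\<close>; normalising
      it there gives a member of the lattice.\<close>
    define \<beta> where "\<beta> = (\<lambda>p. if p \<in> S then \<beta>' p else 0)"
    have b: "g = newton k \<beta>" "\<beta> \<in> lattice k"
      using b' by (auto simp: \<beta>_def newton_def lattice_def intro!: prod.cong)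
    have "g x = (\<Sum>\<alpha>\<in>lattice k. g (node k \<alpha>) * lagr k \<alpha> x)" for x
    proof -
      have "(\<Sum>\<alpha>\<in>lattice k. g (node k \<alpha>) * lagr k \<alpha> x) = (\<Sum>\<alpha>\<in>lattice k. if \<alpha> = \<beta> then g x else 0)"
      proof (intro sum.cong refl)
        fix \<alpha> assume a: "\<alpha> \<in> lattice k"
        have "g (node k \<alpha>) = (\<Prod>p\<in>S. fact (\<beta> p)) * lagr k \<beta> (node k \<alpha>)" using b by (simp add: lagr_def)
        also have "lagr k \<beta> (node k \<alpha>) = (if \<alpha> = \<beta> then 1 else 0)" by (rule lagr_node[OF a b(2) assms(2)])
        finally show "g (node k \<alpha>) * lagr k \<alpha> x = (if \<alpha> = \<beta> then g x else 0)"
          using b by (simp add: lagr_def)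
      qed
      then show ?thesis using b finite_lattice by simp
    qed
    then have 1: "c * g x = (\<Sum>\<alpha>\<in>lattice k. c * g (node k \<alpha>) * lagr k \<alpha> x)" for x
      by (metis (no_types, lifting) mult.assoc sum.cong sum_distrib_left)
    show ?case
    proof
      fix x
      show "c * g x + f x = (\<Sum>\<alpha>\<in>lattice k. (c * g (node k \<alpha>) + f (node k \<alpha>)) * lagr k \<alpha> x)"
        unfolding distrib_right sum.distrib using 1[of x] step.IH by metis
    qed
  qed
  then show ?thesis by blast
qed

lemma lam_bounds:
  assumes "x \<in> convex hull S" "p \<in> S" shows "0 \<le> lam p x" "lam p x \<le> 1"
proof -
  obtain u where u: "\<And>v. v \<in> S \<Longrightarrow> 0 \<le> u v" "sum u S = 1" "(\<Sum>v\<in>S. u v *\<^sub>R v) = x"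
    using assms(1) unfolding convex_hull_finite[OF fin] by auto
  have l: "lam p x = u p" using lam_unique[OF u(2) assms(2)] u by simp
  show "0 \<le> lam p x" using l u assms by simp
  show "lam p x \<le> 1" using l u member_le_sum[of p S u] assms fin by auto
qed

text \<open>The Newton product has \<open>k\<close> factors \<open>k * lam p x - j\<close> with both
  terms between 0 and \<open>k\<close>. The bound is therefore the same for all simplices, however
  they are shaped.\<close>

lemma lagr_bound:
  assumes "x \<in> convex hull S" "\<alpha> \<in> lattice k" "k \<ge> 1"
  shows "\<bar>lagr k \<alpha> x\<bar> \<le> real k ^ k"
proof -
  have "\<bar>newton k \<alpha> x\<bar> = (\<Prod>p\<in>S. \<Prod>j<\<alpha> p. \<bar>real k * lam p x - real j\<bar>)"
    by (simp add: newton_def abs_prod)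
  also have "\<dots> \<le> (\<Prod>p\<in>S. \<Prod>j<\<alpha> p. real k)"
  proof (intro prod_mono conjI prod_nonneg abs_ge_zero ballI)
    fix p j assume p: "p \<in> S" "j \<in> {..<\<alpha> p}"
    have "real k * lam p x \<le> real k * 1" "0 \<le> real k * lam p x"
      using lam_bounds[OF assms(1) p(1)] by (intro mult_left_mono mult_nonneg_nonneg; simp)+
    moreover have "real j \<le> real k" using p lattice_le[OF assms(2), of p] by simp
    ultimately show "\<bar>real k * lam p x - real j\<bar> \<le> real k" by linarith
  qed
  also have "\<dots> = real k ^ sum \<alpha> S" by (simp add: power_sum)
  also have "sum \<alpha> S = k" using assms by (simp add: lattice_def)
  finally have 1: "\<bar>newton k \<alpha> x\<bar> \<le> real k ^ k" .
  have 2: "(1::real) \<le> (\<Prod>p\<in>S. fact (\<alpha> p))" by (intro prod_ge_1) simp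
  have "\<bar>lagr k \<alpha> x\<bar> = \<bar>newton k \<alpha> x\<bar> / (\<Prod>p\<in>S. fact (\<alpha> p))"
    using 2 by (simp add: lagr_def abs_divide)
  also have "\<dots> \<le> \<bar>newton k \<alpha> x\<bar> / 1" using 2 by (intro divide_left_mono) auto
  finally show ?thesis using 1 by simp
qed

end

section \<open>The nodal basis of one simplex\<close>

lemma simplex_verts_convex_hull:
  assumes "\<not> affine_dependent S" shows "simplex_verts (convex hull S) = S"
  using extreme_point_of_convex_hull_affine_independent[OF assms] by (auto simp: simplex_verts_def)

lemma is_simplex_vertsD:
  fixes T :: "(real^'n) set"
  assumes "is_simplex T"
  shows "finite (simplex_verts T)" "card (simplex_verts T) = CARD('n) + 1"
    "\<not> affine_dependent (simplex_verts T)" "T = convex hull simplex_verts T"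
  using assms simplex_verts_convex_hull unfolding is_simplex_def by metis+

lemma simplex_lagrange_basis:
  fixes T :: "(real^'n) set"
  assumes "is_simplex T" "k \<ge> 1"
  shows "finite (lagrange_nodes k T)" "card (lagrange_nodes k T) \<le> (k + 1) ^ (CARD('n) + 1)"
    "lagrange_nodes k T \<subseteq> T"
    "z \<in> lagrange_nodes k T \<Longrightarrow> poly_deg_le k (local_basis k T z)"
    "z \<in> lagrange_nodes k T \<Longrightarrow> x \<in> T \<Longrightarrow> \<bar>local_basis k T z x\<bar> \<le> real k ^ k"
    "z \<in> lagrange_nodes k T \<Longrightarrow> y \<in> lagrange_nodes k T \<Longrightarrow> local_basis k T z y = (if y = z then 1 else 0)"
    "poly_deg_le k p \<Longrightarrow> p y = (\<Sum>z\<in>lagrange_nodes k T. p z * local_basis k T z y)"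
proof -
  let ?S = "simplex_verts T"
  note V = is_simplex_vertsD[OF assms(1)]
  obtain lam where "barycentric ?S lam" using barycentric_exists[OF V(1-3)] by blast
  then interpret barycentric ?S lam .
  have nodes: "lagrange_nodes k T = node k ` lattice k"
  proof (intro set_eqI iffI)
    fix z assume "z \<in> lagrange_nodes k T"
    then obtain \<alpha> where a: "z = node k \<alpha>" "sum \<alpha> ?S = k" by (auto simp: lagrange_nodes_def node_def)
    have "(\<lambda>p. if p \<in> ?S then \<alpha> p else 0) \<in> lattice k" using a by (auto simp: lattice_def)
    moreover have "node k (\<lambda>p. if p \<in> ?S then \<alpha> p else 0) = z"
      unfolding a node_def by (intro sum.cong) auto
    ultimately show "z \<in> node k ` lattice k" by blast
  next
    fix z assume "z \<in> node k ` lattice k"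
    then show "z \<in> lagrange_nodes k T" by (auto simp: lagrange_nodes_def node_def lattice_def)
  qed
  have inj: "inj_on (node k) (lattice k)"
  proof (rule inj_onI)
    fix a b assume "a \<in> lattice k" "b \<in> lattice k" "node k a = node k b"
    then show "a = b" using lagr_node[of a k b] lagr_node[of b k b] assms(2) by (metis zero_neq_one)
  qed
  show "finite (lagrange_nodes k T)" unfolding nodes using finite_lattice by simp
  show "card (lagrange_nodes k T) \<le> (k + 1) ^ (CARD('n) + 1)"
    unfolding nodes using card_image_le[OF finite_lattice, of "node k" k] card_lattice[of k] by simp
  show "lagrange_nodes k T \<subseteq> T"
  proof
    fix z assume "z \<in> lagrange_nodes k T"
    then obtain \<alpha> where a: "\<alpha> \<in> lattice k" "z = node k \<alpha>" unfolding nodes by auto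
    have "(\<Sum>q\<in>?S. real (\<alpha> q) / real k) = real (sum \<alpha> ?S) / real k"
      by (simp add: sum_divide_distrib)
    also have "\<dots> = 1" using a assms(2) by (simp add: lattice_def)
    finally have "z \<in> convex hull ?S"
      unfolding convex_hull_finite[OF V(1)] a node_def
      by (intro CollectI exI[of _ "\<lambda>q. real (\<alpha> q) / real k"]) auto
    then show "z \<in> T" using V by simp
  qed
  \<comment> \<open>Interpolation leaves only one polynomial with the prescribed nodal values, so
    the definite description is justified.\<close>
  have lb: "local_basis k T (node k \<alpha>) = lagr k \<alpha>" if a: "\<alpha> \<in> lattice k" for \<alpha>
    unfolding local_basis_def
  proof (rule the_equality)
    have "lagr k \<alpha> y = (if y = node k \<alpha> then 1 else 0)" if "y \<in> lagrange_nodes k T" for y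
      using that lagr_node[OF _ a assms(2)] inj a unfolding nodes by (auto simp: inj_on_def)
    then show "poly_deg_le k (lagr k \<alpha>) \<and> (\<forall>y\<in>lagrange_nodes k T. lagr k \<alpha> y = (if y = node k \<alpha> then 1 else 0))"
      using lagr_poly[OF a] by blast
  next
    fix p assume p: "poly_deg_le k p \<and> (\<forall>y\<in>lagrange_nodes k T. p y = (if y = node k \<alpha> then 1 else 0))"
    show "p = lagr k \<alpha>"
    proof
      fix x
      have "p x = (\<Sum>\<beta>\<in>lattice k. p (node k \<beta>) * lagr k \<beta> x)"
        using lagrange_interpolation[of k p x] p assms(2) by simp
      also have "\<dots> = (\<Sum>\<beta>\<in>lattice k. if \<beta> = \<alpha> then lagr k \<alpha> x else 0)"
        using p inj a by (intro sum.cong) (auto simp: nodes inj_on_def)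
      finally show "p x = lagr k \<alpha> x" using a finite_lattice by simp
    qed
  qed
  show "z \<in> lagrange_nodes k T \<Longrightarrow> poly_deg_le k (local_basis k T z)"
    unfolding nodes using lb lagr_poly by auto
  show "z \<in> lagrange_nodes k T \<Longrightarrow> x \<in> T \<Longrightarrow> \<bar>local_basis k T z x\<bar> \<le> real k ^ k"
    unfolding nodes using lb lagr_bound[OF _ _ assms(2)] V(4) by auto
  show "z \<in> lagrange_nodes k T \<Longrightarrow> y \<in> lagrange_nodes k T \<Longrightarrow> local_basis k T z y = (if y = z then 1 else 0)"
    unfolding nodes using lb lagr_node[OF _ _ assms(2)] inj by (auto simp: inj_on_def)
  show "poly_deg_le k p \<Longrightarrow> p y = (\<Sum>z\<in>lagrange_nodes k T. p z * local_basis k T z y)"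
    unfolding nodes using lagrange_interpolation[OF _ assms(2), of p y] lb
    by (simp add: sum.reindex[OF inj])
qed


section \<open>Inverse estimates\<close>

lemma grad_sum:
  assumes "\<And>i. i \<in> I \<Longrightarrow> poly_deg_le k (f i)"
  shows "grad (\<lambda>x. \<Sum>i\<in>I. c i * f i x) x = (\<Sum>i\<in>I. c i *\<^sub>R grad (f i) x)"
proof (rule grad_eqI)
  have "((\<lambda>x. \<Sum>i\<in>I. c i * f i x) has_derivative (\<lambda>h. \<Sum>i\<in>I. c i * (grad (f i) x \<bullet> h))) (at x)"
    by (intro has_derivative_sum has_derivative_mult_right poly_has_derivative_grad[OF assms])
  then show "((\<lambda>x. \<Sum>i\<in>I. c i * f i x) has_derivative (\<lambda>h. (\<Sum>i\<in>I. c i *\<^sub>R grad (f i) x) \<bullet> h)) (at x)"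
    by (simp add: inner_sum_left)
qed

lemma is_simplex_standard: "is_simplex (convex hull (insert 0 (Basis :: (real^'n) set)))"
proof -
  have "\<not> affine_dependent (insert 0 (Basis :: (real^'n) set))"
    using affine_dependent_iff_dependent2[of "0::real^'n" "insert 0 Basis"] independent_Basis
    by (simp add: image_def nonzero_Basis)
  moreover have "card (insert 0 (Basis :: (real^'n) set)) = CARD('n) + 1"
    by (subst card_insert_disjoint) (auto simp: nonzero_Basis)
  ultimately show ?thesis unfolding is_simplex_def
    by (intro exI[of _ "insert 0 Basis"]) auto
qed

text \<open>A polynomial is determined by its values at the nodes of one fixed simplex inside the
  unit ball. The basis functions and their gradients are bounded on the larger ball by compactness,
  which gives a constant common to all \<open>p\<close>.\<close>

lemma poly_extrapolation_unit:
  assumes "k \<ge> 1"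
  shows "\<exists>C\<ge>1. \<forall>p :: real^'n \<Rightarrow> real. \<forall>m. poly_deg_le k p \<longrightarrow> (\<forall>x\<in>cball 0 1. \<bar>p x\<bar> \<le> m) \<longrightarrow>
     (\<forall>x\<in>cball 0 \<rho>. \<bar>p x\<bar> \<le> C * m \<and> norm (grad p x) \<le> C * m)"
proof -
  define T where "T = convex hull (insert 0 (Basis :: (real^'n) set))"
  have T: "is_simplex T" unfolding T_def by (rule is_simplex_standard)
  define N where "N = lagrange_nodes k T"
  define \<phi> where "\<phi> = local_basis k T"
  note L = simplex_lagrange_basis[OF T assms, folded N_def \<phi>_def]
  have "T \<subseteq> cball 0 1" unfolding T_def by (rule hull_minimal) auto
  then have N1: "N \<subseteq> cball 0 1" using L(3) by blast
  define b where "b = (\<lambda>x. \<Sum>z\<in>N. \<bar>\<phi> z x\<bar> + norm (grad (\<phi> z) x))"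
  have "continuous_on (cball 0 \<rho>) b"
    unfolding b_def by (intro continuous_intros poly_continuous[OF L(4)] poly_grad_continuous[OF L(4)])
  then have "bounded (b ` cball 0 \<rho>)" by (intro compact_imp_bounded compact_continuous_image) auto
  then obtain B where "\<forall>y\<in>b ` cball 0 \<rho>. norm y \<le> B" unfolding bounded_iff by blast
  then have B: "\<bar>b x\<bar> \<le> B" if "x \<in> cball 0 \<rho>" for x :: "real^'n" using that by fastforce
  show ?thesis
  proof (intro exI[of _ "max B 1"] conjI allI impI ballI)
    fix p :: "real^'n \<Rightarrow> real" and m and x :: "real^'n"
    assume p: "poly_deg_le k p" and m: "\<forall>x\<in>cball 0 1. \<bar>p x\<bar> \<le> m" and x: "x \<in> cball 0 \<rho>"
    have m0: "0 \<le> m" using m by (metis abs_ge_zero centre_in_cball order_trans zero_le_one)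
    have pe: "p = (\<lambda>y. \<Sum>z\<in>N. p z * \<phi> z y)" using L(7)[OF p] by blast
    have bm: "m * b x \<le> max B 1 * m" using mult_left_mono[of "b x" "max B 1" m] B[OF x] m0 by (simp add: mult.commute)
    have "\<bar>p x\<bar> = \<bar>\<Sum>z\<in>N. p z * \<phi> z x\<bar>" by (rule arg_cong[OF L(7)[OF p]])
    also have "\<dots> \<le> (\<Sum>z\<in>N. \<bar>p z * \<phi> z x\<bar>)" by (rule sum_abs)
    also have "\<dots> \<le> (\<Sum>z\<in>N. m * (\<bar>\<phi> z x\<bar> + norm (grad (\<phi> z) x)))"
      unfolding abs_mult using m N1 m0 by (intro sum_mono mult_mono) auto
    finally show "\<bar>p x\<bar> \<le> max B 1 * m" using bm by (simp add: b_def sum_distrib_left)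
    have "grad p x = grad (\<lambda>y. \<Sum>z\<in>N. p z * \<phi> z y) x"
      by (rule arg_cong[OF pe, of "\<lambda>f. grad f x"])
    also have "\<dots> = (\<Sum>z\<in>N. p z *\<^sub>R grad (\<phi> z) x)"
      by (rule grad_sum) (rule L(4))
    finally have "grad p x = (\<Sum>z\<in>N. p z *\<^sub>R grad (\<phi> z) x)" .
    then have "norm (grad p x) \<le> (\<Sum>z\<in>N. norm (p z *\<^sub>R grad (\<phi> z) x))" by (simp only: norm_sum)
    also have "\<dots> \<le> (\<Sum>z\<in>N. m * (\<bar>\<phi> z x\<bar> + norm (grad (\<phi> z) x)))"
      unfolding norm_scaleR using m N1 m0 by (intro sum_mono mult_mono) auto
    finally show "norm (grad p x) \<le> max B 1 * m" using bm by (simp add: b_def sum_distrib_left)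
  qed auto
qed

lemma grad_affine:
  assumes "poly_deg_le k p"
  shows "grad (\<lambda>z. p (c + r *\<^sub>R z)) z = r *\<^sub>R grad p (c + r *\<^sub>R z)"
proof (rule grad_eqI)
  have "((\<lambda>z. p (c + r *\<^sub>R z)) has_derivative (\<lambda>h. grad p (c + r *\<^sub>R z) \<bullet> (0 + r *\<^sub>R h))) (at z)"
    by (rule has_derivative_compose[of "\<lambda>z. c + r *\<^sub>R z"])
      (auto intro!: derivative_eq_intros poly_has_derivative_grad[OF assms])
  then show "((\<lambda>z. p (c + r *\<^sub>R z)) has_derivative (\<lambda>h. (r *\<^sub>R grad p (c + r *\<^sub>R z)) \<bullet> h)) (at z)"
    by simp
qed

text \<open>Translation and dilation preserve the polynomial space, so the constant of the unit ball
  serves all balls; the gradient picks up the factor \<open>1 / r\<close>.\<close>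

lemma poly_extrapolation:
  assumes "k \<ge> 1"
  shows "\<exists>C\<ge>1. \<forall>(p :: real^'n \<Rightarrow> real) c r m. poly_deg_le k p \<longrightarrow> r > 0 \<longrightarrow> (\<forall>x\<in>cball c r. \<bar>p x\<bar> \<le> m) \<longrightarrow>
     (\<forall>x\<in>cball c (\<rho> * r). \<bar>p x\<bar> \<le> C * m \<and> norm (grad p x) \<le> C * m / r)"
proof -
  obtain C where C: "C \<ge> 1" "\<And>(p :: real^'n \<Rightarrow> real) m x. poly_deg_le k p \<Longrightarrow> (\<forall>x\<in>cball 0 1. \<bar>p x\<bar> \<le> m) \<Longrightarrow>
     x\<in>cball 0 \<rho> \<Longrightarrow> \<bar>p x\<bar> \<le> C * m \<and> norm (grad p x) \<le> C * m"
    using poly_extrapolation_unit[OF assms, where 'n='n and \<rho>=\<rho>] by metis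
  have "\<bar>p x\<bar> \<le> C * m \<and> norm (grad p x) \<le> C * m / r"
    if p: "poly_deg_le k p" and r: "r > 0" and m: "\<forall>x\<in>cball c r. \<bar>p x\<bar> \<le> m" and x: "x \<in> cball c (\<rho> * r)"
    for p :: "real^'n \<Rightarrow> real" and c r m x
  proof -
    define q where "q = (\<lambda>z. p (c + r *\<^sub>R z))"
    define z where "z = (1 / r) *\<^sub>R (x - c)"
    have xz: "x = c + r *\<^sub>R z" using r by (simp add: z_def)
    have "norm (x - c) \<le> \<rho> * r" using x by (simp add: dist_norm norm_minus_commute)
    then have "norm z \<le> \<rho>" using r by (simp add: z_def pos_divide_le_eq)
    moreover have "\<forall>y\<in>cball 0 1. \<bar>q y\<bar> \<le> m"
      using m r by (auto simp: q_def dist_norm mult_left_le)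
    ultimately have "\<bar>q z\<bar> \<le> C * m \<and> norm (grad q z) \<le> C * m"
      using C(2)[of q m z] poly_deg_le_affine[OF p, of c r] by (auto simp: q_def)
    then show ?thesis using r grad_affine[OF p, of c r z] xz by (simp add: q_def field_simps)
  qed
  then show ?thesis using C(1) by blast
qed

lemma measure_lebesgue_cball:
  fixes c :: "real^'n"
  assumes "r \<ge> 0"
  shows "measure lebesgue (cball c r) = unit_ball_vol (real CARD('n)) * r ^ CARD('n)"
  using content_cball[OF assms, of c] by simp

lemma poly_square_integrable_cball:
  fixes p :: "real^'n \<Rightarrow> real"
  assumes "poly_deg_le k p" shows "(\<lambda>x. (p x)\<^sup>2) integrable_on cball c r"
proof -
  have "continuous_on (cball c r) (\<lambda>x. (p x)\<^sup>2)"
    by (intro continuous_intros poly_continuous[OF assms])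
  then have "set_integrable lborel (cball c r) (\<lambda>x. (p x)\<^sup>2)"
    by (intro borel_integrable_compact[unfolded set_integrable_def[symmetric]]) (auto simp: set_integrable_def)
  then show ?thesis by (rule set_borel_integral_eq_integral)
qed

text \<open>The gradient bound keeps \<open>\<bar>p\<bar>\<close> above half of its maximum
  \<open>m\<close> on a ball of radius proportional to \<open>r\<close>, so the integral of the
  square is at least a multiple of \<open>m ^ 2 * r ^ CARD('n)\<close>. Extrapolation then carries
  \<open>m\<close> to the larger ball.\<close>

lemma poly_inverse_estimate:
  assumes "k \<ge> 1" "\<rho> \<ge> 1"
  shows "\<exists>C>0. \<forall>(p :: real^'n \<Rightarrow> real) c r. poly_deg_le k p \<longrightarrow> r > 0 \<longrightarrow>
     (\<forall>x\<in>cball c (\<rho> * r). (p x)\<^sup>2 \<le> C / r ^ CARD('n) * integral (cball c r) (\<lambda>x. (p x)\<^sup>2) \<and>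
        (norm (grad p x))\<^sup>2 \<le> C / r ^ (CARD('n) + 2) * integral (cball c r) (\<lambda>x. (p x)\<^sup>2))"
proof -
  obtain C where C: "C \<ge> 1" "\<And>(p :: real^'n \<Rightarrow> real) c r m x. poly_deg_le k p \<Longrightarrow> r > 0 \<Longrightarrow>
     (\<forall>x\<in>cball c r. \<bar>p x\<bar> \<le> m) \<Longrightarrow> x \<in> cball c (\<rho> * r) \<Longrightarrow>
     \<bar>p x\<bar> \<le> C * m \<and> norm (grad p x) \<le> C * m / r"
    using poly_extrapolation[OF assms(1), where 'n='n and \<rho>=\<rho>] by metis
  define d where "d = CARD('n)"
  \<comment> \<open>Over a distance \<open>\<delta> * r\<close> the gradient bound
    \<open>C * m / r\<close> allows a change of at most \<open>m / 2\<close>.\<close>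
  define \<delta> where "\<delta> = 1 / (2 * C)"
  have \<delta>: "0 < \<delta>" "\<delta> \<le> 1/2" using C by (auto simp: \<delta>_def field_simps)
  define K where "K = 4 * C\<^sup>2 / (unit_ball_vol (real d) * (\<delta> / 2) ^ d)"
  have K: "K > 0" unfolding K_def using C \<delta> by (auto intro!: divide_pos_pos mult_pos_pos)
  have "(p x)\<^sup>2 \<le> K / r ^ d * integral (cball c r) (\<lambda>x. (p x)\<^sup>2) \<and>
        (norm (grad p x))\<^sup>2 \<le> K / r ^ (d + 2) * integral (cball c r) (\<lambda>x. (p x)\<^sup>2)"
    if p: "poly_deg_le k p" and r: "r > 0" and x: "x \<in> cball c (\<rho> * r)"
    for p :: "real^'n \<Rightarrow> real" and c r x
  proof -
    have "continuous_on (cball c r) (\<lambda>x. \<bar>p x\<bar>)" by (intro continuous_intros poly_continuous[OF p])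
    then obtain x0 where x0: "x0 \<in> cball c r" "\<And>x. x \<in> cball c r \<Longrightarrow> \<bar>p x\<bar> \<le> \<bar>p x0\<bar>"
      using continuous_attains_sup[of "cball c r" "\<lambda>x. \<bar>p x\<bar>"] r by auto
    define m where "m = \<bar>p x0\<bar>"
    have m: "\<forall>x\<in>cball c r. \<bar>p x\<bar> \<le> m" using x0 by (simp add: m_def)
    have m0: "m \<ge> 0" by (simp add: m_def)
    have "r \<le> \<rho> * r" using assms r by simp
    then have gb: "norm (grad p y) \<le> C * m / r" if "y \<in> cball c r" for y
      using C(2)[OF p r m, of y] that by auto
    have lip: "\<bar>p y - p x0\<bar> \<le> C * m / r * norm (y - x0)" if "y \<in> cball c r" for y
    proof -
      have "norm (p y - p x0) \<le> C * m / r * norm (y - x0)"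
      proof (rule differentiable_bound[of "cball c r" p "\<lambda>x h. grad p x \<bullet> h"])
        show "(p has_derivative (\<lambda>h. grad p x \<bullet> h)) (at x within cball c r)" for x
          by (rule has_derivative_at_withinI[OF poly_has_derivative_grad[OF p]])
        show "onorm (\<lambda>h. grad p x \<bullet> h) \<le> C * m / r" if "x \<in> cball c r" for x
        proof (rule onorm_le)
          fix h
          have "\<bar>grad p x \<bullet> h\<bar> \<le> norm (grad p x) * norm h" by (rule Cauchy_Schwarz_ineq2)
          also have "\<dots> \<le> C * m / r * norm h" using gb[OF that] by (intro mult_right_mono) auto
          finally show "norm (grad p x \<bullet> h) \<le> C * m / r * norm h" by simp
        qed
      qed (use x0 that in auto)
      then show ?thesis by simp
    qed
    \<comment> \<open>The maximum may be attained on the sphere; pulling the point towards the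
      centre makes room for a small ball inside \<open>cball c r\<close>.\<close>
    define y0 where "y0 = c + (1 - \<delta>/2) *\<^sub>R (x0 - c)"
    have n0: "norm (x0 - c) \<le> r" using x0 by (simp add: dist_norm norm_minus_commute)
    have "norm (y0 - c) \<le> (1 - \<delta>/2) * r"
      using n0 \<delta> by (simp add: y0_def mult_left_mono)
    then have sub: "cball y0 (\<delta>/2 * r) \<subseteq> cball c r"
      unfolding cball_subset_cball_iff by (simp add: dist_norm algebra_simps)
    have "norm (y0 - x0) \<le> \<delta>/2 * r"
    proof -
      have "y0 - x0 = (-(\<delta>/2)) *\<^sub>R (x0 - c)" by (simp add: y0_def algebra_simps)
      then have "norm (y0 - x0) = \<delta>/2 * norm (x0 - c)" using \<delta> by simp
      then show ?thesis using n0 \<delta> by (simp add: mult_left_mono)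
    qed
    then have near: "norm (y - x0) \<le> \<delta> * r" if "y \<in> cball y0 (\<delta>/2 * r)" for y
      using that norm_triangle_ineq[of "y - y0" "y0 - x0"] by (simp add: dist_norm norm_minus_commute)
    have low: "(m / 2)\<^sup>2 \<le> (p y)\<^sup>2" if "y \<in> cball y0 (\<delta>/2 * r)" for y
    proof -
      have "\<bar>p y - p x0\<bar> \<le> C * m / r * (\<delta> * r)"
        using lip[of y] near[OF that] sub that C r m0
        by (meson divide_nonneg_pos mult_left_mono mult_nonneg_nonneg order_trans subsetD zero_le_one)
      also have "\<dots> = m / 2" using C r by (simp add: \<delta>_def field_simps)
      finally have "m / 2 \<le> \<bar>p y\<bar>" unfolding m_def by linarith
      then have "(m/2)\<^sup>2 \<le> \<bar>p y\<bar>\<^sup>2" using m0 by (intro power_mono) auto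
      then show ?thesis by simp
    qed
    define V where "V = unit_ball_vol (real d) * (\<delta>/2 * r) ^ d"
    have V: "measure lebesgue (cball y0 (\<delta>/2 * r)) = V"
      unfolding V_def d_def using \<delta> r by (intro measure_lebesgue_cball) auto
    have Vpos: "V > 0" unfolding V_def using \<delta> r by auto
    have "(m/2)\<^sup>2 * V = integral (cball y0 (\<delta>/2 * r)) (\<lambda>_. (m/2)\<^sup>2)"
      using lmeasure_integral[of "cball y0 (\<delta>/2 * r)"] integral_mult_right[of "cball y0 (\<delta>/2 * r)" "(m/2)\<^sup>2" "\<lambda>_. 1"] V
      by simp
    also have "\<dots> \<le> integral (cball y0 (\<delta>/2 * r)) (\<lambda>x. (p x)\<^sup>2)"
      by (rule integral_le) (use low poly_square_integrable_cball[OF p] poly_square_integrable_cball[OF poly_deg_le_const, of "m/2"] in auto)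
    also have "\<dots> \<le> integral (cball c r) (\<lambda>x. (p x)\<^sup>2)"
      by (rule integral_subset_le) (use sub poly_square_integrable_cball[OF p] in auto)
    finally have mI: "m\<^sup>2 * V \<le> 4 * integral (cball c r) (\<lambda>x. (p x)\<^sup>2)" by (simp add: power_divide)
    have KV: "K / r ^ d = 4 * C\<^sup>2 / V"
      unfolding K_def V_def by (simp add: power_mult_distrib field_simps)
    have "(C * m)\<^sup>2 = C\<^sup>2 / V * (m\<^sup>2 * V)" using Vpos by (simp add: power_mult_distrib)
    also have "\<dots> \<le> C\<^sup>2 / V * (4 * integral (cball c r) (\<lambda>x. (p x)\<^sup>2))"
      using mI Vpos by (intro mult_left_mono) auto
    finally have Cm: "(C * m)\<^sup>2 \<le> K / r ^ d * integral (cball c r) (\<lambda>x. (p x)\<^sup>2)" by (simp add: KV mult.commute mult.left_commute)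
    have b: "\<bar>p x\<bar> \<le> C * m" "norm (grad p x) \<le> C * m / r" using C(2)[OF p r m x] by auto
    have "\<bar>p x\<bar>\<^sup>2 \<le> (C * m)\<^sup>2" using b by (intro power_mono) auto
    moreover have "(norm (grad p x))\<^sup>2 \<le> (C * m / r)\<^sup>2" using b by (intro power_mono) auto
    moreover have "(C * m / r)\<^sup>2 \<le> K / r ^ (d + 2) * integral (cball c r) (\<lambda>x. (p x)\<^sup>2)"
      using divide_right_mono[OF Cm, of "r\<^sup>2"] by (simp add: power_divide power_add power2_eq_square mult.commute mult.left_commute)
    ultimately show ?thesis using Cm by auto
  qed
  then show ?thesis using K unfolding d_def by blast
qed


section \<open>Hausdorff measure\<close>

definition haus_term :: "real \<Rightarrow> 'a::metric_space set \<Rightarrow> ennreal" where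
  "haus_term s U = ennreal (hnorm s * (diameter U / 2) powr s)"

definition haus_pre :: "real \<Rightarrow> real \<Rightarrow> 'a::metric_space set \<Rightarrow> ennreal" where
  "haus_pre s \<delta> A = (INF C\<in>{C::nat \<Rightarrow> 'a set. A \<subseteq> (\<Union>i. C i) \<and>
              (\<forall>i. bounded (C i) \<and> diameter (C i) \<le> \<delta>)}. (\<Sum>i. haus_term s (C i)))"

lemma hausdorff_outer_eq: "hausdorff_outer s A = (SUP \<delta>\<in>{0<..}. haus_pre s \<delta> A)"
  by (simp add: hausdorff_outer_def haus_pre_def haus_term_def)

lemma haus_pre_le:
  assumes "A \<subseteq> (\<Union>i. C i)" "\<And>i. bounded (C i)" "\<And>i. diameter (C i) \<le> \<delta>"
  shows "haus_pre s \<delta> A \<le> (\<Sum>i. haus_term s (C i))"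
  unfolding haus_pre_def by (rule INF_lower) (use assms in auto)

lemma haus_term_empty [simp]: "haus_term s {} = 0"
  by (simp add: haus_term_def)

lemma haus_pre_le_outer: "\<delta> > 0 \<Longrightarrow> haus_pre s \<delta> A \<le> hausdorff_outer s A"
  unfolding hausdorff_outer_eq by (rule SUP_upper) auto

lemma haus_pre_mono: "A \<subseteq> B \<Longrightarrow> haus_pre s \<delta> A \<le> haus_pre s \<delta> B"
  unfolding haus_pre_def by (rule INF_superset_mono) auto

lemma haus_pre_antimono: "\<delta> \<le> \<epsilon> \<Longrightarrow> haus_pre s \<epsilon> A \<le> haus_pre s \<delta> A"
  unfolding haus_pre_def by (rule INF_superset_mono) (auto intro: order_trans)

lemma hausdorff_outer_empty: "hausdorff_outer s {} = 0"
proof -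
  have "haus_pre s \<delta> ({} :: 'a set) = 0" if "\<delta> > 0" for \<delta>
    using haus_pre_le[of "{}" "\<lambda>_. {}" \<delta> s] that by simp
  then show ?thesis by (simp add: hausdorff_outer_eq)
qed

lemma hausdorff_outer_mono: "A \<subseteq> B \<Longrightarrow> hausdorff_outer s A \<le> hausdorff_outer s B"
  unfolding hausdorff_outer_eq by (intro SUP_mono) (auto intro: haus_pre_mono)

lemma haus_pre_countably_subadditive: "haus_pre s \<delta> (\<Union>i. A i) \<le> (\<Sum>n. haus_pre s \<delta> (A n))"
proof (rule ennreal_le_epsilon)
  fix e :: real assume e: "0 < e" "(\<Sum>n. haus_pre s \<delta> (A n)) < top"
  then have *: "haus_pre s \<delta> (A n) < haus_pre s \<delta> (A n) + e * (1/2)^Suc n" for n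
    by (auto simp add: less_top dest!: ennreal_suminf_lessD)
  have "\<exists>B. A n \<subseteq> (\<Union>i. B i) \<and> (\<forall>i. bounded (B i) \<and> diameter (B i) \<le> \<delta>) \<and>
      (\<Sum>i. haus_term s (B i)) \<le> haus_pre s \<delta> (A n) + e * (1/2)^Suc n" for n
    using *[of n] unfolding haus_pre_def[of s \<delta> "A n"] INF_less_iff
    by (metis (mono_tags, lifting) less_imp_le mem_Collect_eq)
  then obtain B where B: "\<And>n. A n \<subseteq> (\<Union>i. B n i)" "\<And>n i. bounded (B n i)" "\<And>n i. diameter (B n i) \<le> \<delta>"
      "\<And>n. (\<Sum>i. haus_term s (B n i)) \<le> haus_pre s \<delta> (A n) + e * (1/2)^Suc n"
    by metis
  define C where "C = case_prod B o prod_decode"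
  have "(\<Union>i. A i) \<subseteq> (\<Union>i. C i)"
    using B(1) by (auto simp add: C_def subset_eq) (metis prod.case prod_encode_inverse)
  then have "haus_pre s \<delta> (\<Union>i. A i) \<le> (\<Sum>i. haus_term s (C i))"
    by (rule haus_pre_le) (auto simp: C_def split_def B)
  also have "\<dots> = (\<Sum>n. \<Sum>i. haus_term s (B n i))"
    unfolding C_def comp_def
    by (subst suminf_ennreal_2dimen[of "\<lambda>n. \<Sum>i. haus_term s (B n i)" "\<lambda>p. haus_term s (case_prod B p)"]) auto
  also have "\<dots> \<le> (\<Sum>n. haus_pre s \<delta> (A n) + e * (1/2) ^ Suc n)"
    by (intro suminf_le B) auto
  also have "\<dots> = (\<Sum>n. haus_pre s \<delta> (A n)) + (\<Sum>n. ennreal e * ennreal ((1/2) ^ Suc n))"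
    using \<open>0 < e\<close> by (subst suminf_add[symmetric])
      (auto simp del: ennreal_suminf_cmult simp add: ennreal_mult[symmetric])
  also have "\<dots> = (\<Sum>n. haus_pre s \<delta> (A n)) + e"
    unfolding ennreal_suminf_cmult
    by (subst suminf_ennreal_eq[OF zero_le_power power_half_series]) auto
  finally show "haus_pre s \<delta> (\<Union>i. A i) \<le> (\<Sum>n. haus_pre s \<delta> (A n)) + e" .
qed

lemma hausdorff_outer_countably_subadditive: "hausdorff_outer s (\<Union>i. A i) \<le> (\<Sum>n. hausdorff_outer s (A n))"
  unfolding hausdorff_outer_eq[of s "\<Union>i. A i"]
proof (rule SUP_least)
  fix \<delta> :: real assume "\<delta> \<in> {0<..}"
  then have "(\<Sum>n. haus_pre s \<delta> (A n)) \<le> (\<Sum>n. hausdorff_outer s (A n))"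
    by (intro suminf_le haus_pre_le_outer) auto
  then show "haus_pre s \<delta> (\<Union>i. A i) \<le> (\<Sum>n. hausdorff_outer s (A n))"
    using haus_pre_countably_subadditive order_trans by blast
qed

lemma outer_measure_space_hausdorff: "outer_measure_space (Pow UNIV) (hausdorff_outer s)"
  unfolding outer_measure_space_def positive_def increasing_def countably_subadditive_def
  using hausdorff_outer_empty hausdorff_outer_mono hausdorff_outer_countably_subadditive by auto

lemma hausdorff_outer_Un_le: "hausdorff_outer s (A \<union> B) \<le> hausdorff_outer s A + hausdorff_outer s B"
proof -
  have "hausdorff_outer s (\<Union>i. binaryset A B i) \<le> (\<Sum>n. hausdorff_outer s (binaryset A B n))"
    by (rule hausdorff_outer_countably_subadditive)
  then show ?thesis using suminf_binaryset_eq[of "hausdorff_outer s" A B]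
    by (simp add: UN_binaryset_eq hausdorff_outer_empty)
qed

text \<open>A countable monotone sequence is needed because suprema and sums commute only along such
  a family. The offset 2 keeps every mesh of the cover strictly below \<open>r\<close>.\<close>

lemma hausdorff_outer_SUP_seq:
  assumes "r > 0"
  shows "hausdorff_outer s A = (SUP n. haus_pre s (r / (real n + 2)) A)"
  unfolding hausdorff_outer_eq
proof (rule SUP_eq)
  fix \<delta> :: real assume d: "\<delta> \<in> {0<..}"
  obtain n where "r / \<delta> < real n" using reals_Archimedean2 by blast
  then have "r / (real n + 2) \<le> \<delta>"
    using d by (simp add: field_simps)
  then show "\<exists>n\<in>UNIV. haus_pre s \<delta> A \<le> haus_pre s (r / (real n + 2)) A"
    using haus_pre_antimono by blast
next
  fix n :: nat
  show "\<exists>\<delta>\<in>{0<..}. haus_pre s (r / (real n + 2)) A \<le> haus_pre s \<delta> A"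
    using assms by (intro bexI[of _ "r / (real n + 2)"]) auto
qed

text \<open>A set of diameter at most \<open>\<delta>\<close> cannot meet both parts, so each cover
  of the union splits into two disjoint subfamilies.\<close>

lemma haus_pre_separated:
  assumes "\<And>x y. x \<in> A \<Longrightarrow> y \<in> B \<Longrightarrow> \<delta> < dist x y" "0 \<le> \<delta>"
  shows "haus_pre s \<delta> A + haus_pre s \<delta> B \<le> haus_pre s \<delta> (A \<union> B)"
  unfolding haus_pre_def[of s \<delta> "A \<union> B"]
proof (rule INF_greatest)
  fix C :: "nat \<Rightarrow> 'a set" assume "C \<in> {C. A \<union> B \<subseteq> (\<Union>i. C i) \<and> (\<forall>i. bounded (C i) \<and> diameter (C i) \<le> \<delta>)}"
  then have C: "A \<union> B \<subseteq> (\<Union>i. C i)" "\<And>i. bounded (C i)" "\<And>i. diameter (C i) \<le> \<delta>" by auto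
  define CA where "CA = (\<lambda>i. if C i \<inter> A = {} then {} else C i)"
  define CB where "CB = (\<lambda>i. if C i \<inter> B = {} then {} else C i)"
  have "haus_pre s \<delta> A \<le> (\<Sum>i. haus_term s (CA i))"
  proof (rule haus_pre_le)
    show "A \<subseteq> (\<Union>i. CA i)"
    proof
      fix x assume "x \<in> A"
      moreover from this obtain i where "x \<in> C i" using C(1) by auto
      ultimately show "x \<in> (\<Union>i. CA i)" by (intro UN_I[of i]) (auto simp: CA_def)
    qed
  qed (use C(2,3) assms(2) in \<open>simp_all add: CA_def\<close>)
  moreover have "haus_pre s \<delta> B \<le> (\<Sum>i. haus_term s (CB i))"
  proof (rule haus_pre_le)
    show "B \<subseteq> (\<Union>i. CB i)"
    proof
      fix x assume "x \<in> B"
      moreover from this obtain i where "x \<in> C i" using C(1) by auto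
      ultimately show "x \<in> (\<Union>i. CB i)" by (intro UN_I[of i]) (auto simp: CB_def)
    qed
  qed (use C(2,3) assms(2) in \<open>simp_all add: CB_def\<close>)
  moreover have "(\<Sum>i. haus_term s (CA i)) + (\<Sum>i. haus_term s (CB i)) = (\<Sum>i. haus_term s (CA i) + haus_term s (CB i))"
    by (rule suminf_add) auto
  moreover have "\<dots> \<le> (\<Sum>i. haus_term s (C i))"
  proof (intro suminf_le)
    fix i
    have "C i \<inter> A = {} \<or> C i \<inter> B = {}"
    proof (rule ccontr)
      assume "\<not> ?thesis"
      then obtain x y where "x \<in> C i" "x \<in> A" "y \<in> C i" "y \<in> B" by auto
      then show False using assms(1)[of x y] diameter_bounded_bound[OF C(2), of x i y] C(3)[of i] by auto
    qed
    then show "haus_term s (CA i) + haus_term s (CB i) \<le> haus_term s (C i)"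
      by (auto simp: CA_def CB_def)
  qed auto
  ultimately show "haus_pre s \<delta> A + haus_pre s \<delta> B \<le> (\<Sum>i. haus_term s (C i))"
    by (metis (no_types, lifting) add_mono order_trans)
qed

lemma hausdorff_outer_separated:
  assumes "\<And>x y. x \<in> A \<Longrightarrow> y \<in> B \<Longrightarrow> r \<le> dist x y" "0 < r"
  shows "hausdorff_outer s A + hausdorff_outer s B \<le> hausdorff_outer s (A \<union> B)"
proof -
  let ?d = "\<lambda>n. r / (real n + 2)"
  have inc: "incseq (\<lambda>n. haus_pre s (?d n) X)" for X :: "'a set"
    by (intro incseq_SucI haus_pre_antimono) (use assms in \<open>auto intro!: divide_left_mono mult_pos_pos\<close>)
  have "hausdorff_outer s A + hausdorff_outer s B = (SUP n. haus_pre s (?d n) A + haus_pre s (?d n) B)"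
    unfolding hausdorff_outer_SUP_seq[OF assms(2)] using ennreal_SUP_add[OF inc inc] by simp
  also have "\<dots> \<le> (SUP n. haus_pre s (?d n) (A \<union> B))"
  proof (rule SUP_mono)
    fix n :: nat
    have "?d n < r / 1" using assms(2) by (intro divide_strict_left_mono) auto
    then have "haus_pre s (?d n) A + haus_pre s (?d n) B \<le> haus_pre s (?d n) (A \<union> B)"
      using assms by (intro haus_pre_separated) (auto intro: less_le_trans)
    then show "\<exists>m\<in>UNIV. haus_pre s (?d n) A + haus_pre s (?d n) B \<le> haus_pre s (?d m) (A \<union> B)" by blast
  qed
  finally show ?thesis unfolding hausdorff_outer_SUP_seq[OF assms(2)] .
qed

text \<open>The standard argument for metric outer measures: the shells between consecutive distances
  \<open>1 / (n + 1)\<close> from the closed set are, two apart, positively separated, so their measures are summable.\<close>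
lemma hausdorff_outer_closed:
  assumes "closed C" "C \<noteq> {}"
  shows "hausdorff_outer s (E \<inter> C) + hausdorff_outer s (E - C) \<le> hausdorff_outer s E"
proof (cases "hausdorff_outer s E = \<infinity>")
  case False
  let ?H = "hausdorff_outer s"
  define D where "D = (\<lambda>n::nat. {x \<in> E. infdist x C \<ge> 1 / (real n + 1)})"
  define R where "R = (\<lambda>n. D (Suc n) - D n)"
  have Dmono: "D m \<subseteq> D n" if "m \<le> n" for m n
    using that unfolding D_def by (auto elim!: order_trans[rotated] intro!: divide_left_mono)
  have DE: "D n \<subseteq> E" "D n \<inter> C = {}" for n
    unfolding D_def using infdist_zero by (auto simp: field_simps)
  have sepC: "?H (E \<inter> C) + ?H (D n) \<le> ?H E" for n
  proof -
    have "?H (E \<inter> C) + ?H (D n) \<le> ?H (E \<inter> C \<union> D n)"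
    proof (rule hausdorff_outer_separated[of _ _ "1 / (real n + 1)"])
      fix x y assume "x \<in> E \<inter> C" "y \<in> D n"
      then show "1 / (real n + 1) \<le> dist x y"
        using infdist_le[of x C y] by (auto simp: D_def dist_commute)
    qed auto
    also have "\<dots> \<le> ?H E" using DE by (intro hausdorff_outer_mono) auto
    finally show ?thesis .
  qed
  have Rsep: "?H X + ?H (R (Suc n)) \<le> ?H (X \<union> R (Suc n))" if "X \<subseteq> D n" for X n
  proof (rule hausdorff_outer_separated[of _ _ "1 / (real n + 1) - 1 / (real n + 2)"])
    fix x y assume "x \<in> X" "y \<in> R (Suc n)"
    then have "1 / (real n + 1) \<le> infdist x C" "infdist y C < 1 / (real n + 2)"
      using that by (auto simp: D_def R_def add_ac)
    then show "1 / (real n + 1) - 1 / (real n + 2) \<le> dist x y"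
      using infdist_triangle[of x C y] by linarith
  next
    show "0 < 1 / (real n + 1) - 1 / (real n + 2)" by (simp add: divide_strict_left_mono)
  qed
  \<comment> \<open>For a fixed offset \<open>q\<close> the shells already collected lie in
    \<open>D (2 * m + q)\<close>, which has positive distance from the next one; additivity on
    separated sets applies in each step.\<close>
  have par: "(\<Sum>k<m. ?H (R (Suc (2 * k + q)))) \<le> ?H E" for m q
  proof -
    have "(\<Sum>k<m. ?H (R (Suc (2 * k + q)))) \<le> ?H (\<Union>k<m. R (Suc (2 * k + q)))"
    proof (induction m)
      case (Suc m)
      have "(\<Union>k<m. R (Suc (2 * k + q))) \<subseteq> D (2 * m + q)"
      proof (rule UN_least)
        fix k assume "k \<in> {..<m}"
        then show "R (Suc (2 * k + q)) \<subseteq> D (2 * m + q)"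
          using Dmono[of "Suc (Suc (2 * k + q))" "2 * m + q"] by (auto simp: R_def)
      qed
      from Rsep[OF this] Suc show ?case
        by (simp add: lessThan_Suc Un_commute add.commute) (meson add_left_mono order_trans)
    qed simp
    also have "\<dots> \<le> ?H E" using DE by (intro hausdorff_outer_mono) (auto simp: R_def)
    finally show ?thesis .
  qed
  define f where "f = (\<lambda>k. ?H (R (Suc k)))"
  have "(\<Sum>k<2 * m. f k) \<le> ?H E + ?H E" for m
  proof -
    have "(\<Sum>k<2 * m. f k) = (\<Sum>k<m. f (2 * k)) + (\<Sum>k<m. f (2 * k + 1))"
      by (induction m) (simp_all add: add_ac)
    also have "\<dots> \<le> ?H E + ?H E" using par[of 0 m] par[of 1 m] unfolding f_def by (intro add_mono) auto
    finally show ?thesis .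
  qed
  moreover have "(\<Sum>k<m. f k) \<le> (\<Sum>k<2 * m. f k)" for m
    by (rule sum_mono2) auto
  ultimately have "(\<Sum>k<m. f k) \<le> ?H E + ?H E" for m using order_trans by blast
  then have "suminf f \<le> ?H E + ?H E" unfolding suminf_eq_SUP by (intro SUP_least)
  moreover have "?H E + ?H E < top" using False by (simp add: less_top)
  ultimately have fin: "suminf f < top" by (rule le_less_trans)
  show ?thesis
  proof (rule ennreal_le_epsilon)
    fix e :: real assume e: "0 < e"
    \<comment> \<open>The shell measures have a finite sum, so all but finitely many of them
      together measure at most \<open>e\<close>.\<close>
    have "\<exists>n. suminf f \<le> (\<Sum>k<n. f k) + e"
    proof (rule ccontr)
      assume "\<not> ?thesis"
      then have n: "\<And>n. (\<Sum>k<n. f k) + e \<le> suminf f" by (meson less_imp_le not_le)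
      have "suminf f + e = (SUP n. (\<Sum>k<n. f k) + e)"
        unfolding suminf_eq_SUP by (subst ennreal_SUP_add_left[symmetric]) auto
      also have "\<dots> \<le> suminf f" using n by (intro SUP_least)
      finally show False using e fin
        by (cases "suminf f" rule: ennreal_cases) (auto simp flip: ennreal_plus)
    qed
    then obtain n where n: "suminf f \<le> (\<Sum>k<n. f k) + e" by blast
    have "suminf f = (\<Sum>k<n. f k) + (\<Sum>k. f (k + n))"
      by (subst suminf_offset[of f n]) (auto simp: add.commute)
    moreover have "(\<Sum>k<n. f k) < top" using le_less_trans[OF sum_le_suminf[of f "{..<n}"] fin] by simp
    ultimately have tail: "(\<Sum>k. f (k + n)) \<le> e"
      using n by (metis ennreal_add_left_cancel_le infinity_ennreal_def less_irrefl)
    \<comment> \<open>A point off the closed set has positive distance to it; the first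
      \<open>D m\<close> containing it decides whether it is in \<open>D (Suc n)\<close> or in a
      later shell.\<close>
    have "E - C \<subseteq> D (Suc n) \<union> (\<Union>k. R (Suc (k + n)))"
    proof
      fix x assume x: "x \<in> E - C"
      then have "infdist x C > 0" using assms
        by (metis DiffE in_closed_iff_infdist_zero infdist_nonneg less_eq_real_def)
      then obtain m where "inverse (real (Suc m)) < infdist x C" using reals_Archimedean by blast
      then have "x \<in> D m" using x by (auto simp: D_def inverse_eq_divide add.commute)
      define m0 where "m0 = (LEAST m. x \<in> D m)"
      have m0: "x \<in> D m0" unfolding m0_def using \<open>x \<in> D m\<close> by (rule LeastI)
      show "x \<in> D (Suc n) \<union> (\<Union>k. R (Suc (k + n)))"
      proof (cases "m0 \<le> Suc n")
        case True then show ?thesis using Dmono m0 by blast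
      next
        case False
        then obtain k where k: "m0 = Suc (Suc (k + n))"
          by (metis add.commute add_Suc less_eq_Suc_le less_iff_Suc_add not_less_eq_eq not_less)
        have "x \<notin> D (Suc (k + n))" using not_less_Least[of "Suc (k + n)" "\<lambda>m. x \<in> D m"] k unfolding m0_def by auto
        then have "x \<in> R (Suc (k + n))" using m0 k by (auto simp: R_def)
        then show ?thesis by blast
      qed
    qed
    then have "?H (E - C) \<le> ?H (D (Suc n) \<union> (\<Union>k. R (Suc (k + n))))" by (rule hausdorff_outer_mono)
    also have "\<dots> \<le> ?H (D (Suc n)) + ?H (\<Union>k. R (Suc (k + n)))" by (rule hausdorff_outer_Un_le)
    also have "\<dots> \<le> ?H (D (Suc n)) + (\<Sum>k. f (k + n))"
      unfolding f_def by (intro add_left_mono hausdorff_outer_countably_subadditive)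
    also have "\<dots> \<le> ?H (D (Suc n)) + e" using tail by (intro add_left_mono)
    finally have "?H (E \<inter> C) + ?H (E - C) \<le> ?H (E \<inter> C) + (?H (D (Suc n)) + e)" by (intro add_left_mono)
    also have "\<dots> \<le> ?H E + e" using sepC[of "Suc n"] by (simp add: add.assoc[symmetric] add_right_mono)
    finally show "?H (E \<inter> C) + ?H (E - C) \<le> ?H E + e" .
  qed
qed simp

text \<open>\<open>measure_of\<close> falls back to the zero measure unless its set function is a
  measure, so this is what gives \<open>haus\<close> its meaning. The Caratheodory sets form a
  sigma-algebra that contains the closed sets.\<close>

lemma measure_space_hausdorff:
  "measure_space UNIV (sets (borel :: 'a::metric_space measure)) (hausdorff_outer s)"
proof -
  let ?L = "lambda_system UNIV (Pow UNIV) (hausdorff_outer s) :: 'a set set"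
  interpret sigma_algebra UNIV "Pow UNIV :: 'a set set" by (rule sigma_algebra_Pow)
  have ms: "measure_space UNIV ?L (hausdorff_outer s)"
    by (rule caratheodory_lemma[OF outer_measure_space_hausdorff])
  then interpret L: sigma_algebra UNIV ?L by (simp add: measure_space_def)
  have "C \<in> ?L" if "closed C" for C :: "'a set"
  proof (cases "C = {}")
    case False
    have "hausdorff_outer s (x \<inter> C) + hausdorff_outer s (x - C) = hausdorff_outer s x" for x
      using hausdorff_outer_closed[OF that False, of s x] hausdorff_outer_Un_le[of s "x \<inter> C" "x - C"]
      by (simp add: Int_Diff_Un)
    then show ?thesis unfolding lambda_system_eq by simp
  next
    case True
    then show ?thesis by (simp only: L.empty_sets)
  qed
  then have cl: "UNIV - S \<in> ?L" if "open S" for S :: "'a set"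
    using that by (simp only: closed_Diff[OF closed_UNIV])
  have "S \<in> ?L" if "open S" for S :: "'a set"
  proof -
    have "UNIV - (UNIV - S) \<in> ?L" by (rule L.compl_sets[OF cl[OF that]])
    moreover have "UNIV - (UNIV - S) = S" by auto
    ultimately show ?thesis by (simp only:)
  qed
  then have "sigma_sets UNIV {S. open S} \<subseteq> ?L" by (intro L.sigma_sets_subset) auto
  then have "sets borel \<subseteq> ?L" by (simp add: borel_def)
  then show ?thesis using measure_down[OF ms, of "sets borel"]
    by (metis sets.sigma_algebra_axioms space_borel)
qed

lemma sets_haus [simp, measurable_cong]: "sets (haus s :: 'a::metric_space measure) = sets borel"
  unfolding haus_def using sets.sigma_sets_eq[of "borel :: 'a measure"] by simp

lemma emeasure_haus:
  assumes "A \<in> sets borel"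
  shows "emeasure (haus s) A = hausdorff_outer s A"
  unfolding haus_def
  by (rule emeasure_measure_of_sigma)
    (use measure_space_hausdorff[of s] assms in \<open>auto simp: measure_space_def\<close>)


section \<open>Covering estimates for the Hausdorff measure\<close>

lemma hnorm_pos: "s > 0 \<Longrightarrow> hnorm s > 0"
  unfolding hnorm_def by (intro divide_pos_pos Gamma_real_pos) auto

text \<open>The family is padded with empty sets to a sequence; these contribute nothing because
  \<open>0 powr s = 0\<close>.\<close>

lemma haus_pre_finite_cover:
  assumes "finite F" "A \<subseteq> \<Union>F" "\<And>U. U \<in> F \<Longrightarrow> bounded U" "\<And>U. U \<in> F \<Longrightarrow> diameter U \<le> D"
    "D \<le> \<delta>" "0 \<le> \<delta>" "0 < s"
  shows "haus_pre s \<delta> A \<le> ennreal (real (card F) * (hnorm s * (D / 2) powr s))"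
proof -
  obtain e where e: "bij_betw e {0..<card F} F" using ex_bij_betw_nat_finite[OF assms(1)] by blast
  define C where "C = (\<lambda>i. if i < card F then e i else {})"
  have eF: "e i \<in> F" if "i < card F" for i using e that by (auto simp: bij_betw_def)
  have "A \<subseteq> (\<Union>i. C i)"
  proof
    fix x assume "x \<in> A"
    then obtain U where "U \<in> F" "x \<in> U" using assms by auto
    moreover from this have "U \<in> e ` {0..<card F}" using e by (simp add: bij_betw_def)
    then obtain i where "i < card F" "e i = U" by auto
    ultimately show "x \<in> (\<Union>i. C i)" by (intro UN_I[of i]) (auto simp: C_def)
  qed
  then have "haus_pre s \<delta> A \<le> (\<Sum>i. haus_term s (C i))"
  proof (rule haus_pre_le)
    show "bounded (C i)" for i using assms(3) eF by (simp add: C_def)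
    show "diameter (C i) \<le> \<delta>" for i
      using assms(4)[OF eF, of i] assms(5,6) by (auto simp: C_def)
  qed
  also have "\<dots> = (\<Sum>i<card F. haus_term s (C i))"
    by (rule suminf_finite) (auto simp: C_def)
  also have "\<dots> \<le> (\<Sum>i<card F. ennreal (hnorm s * (D / 2) powr s))"
  proof (rule sum_mono)
    fix i assume "i \<in> {..<card F}"
    then have "diameter (C i) \<le> D" "bounded (C i)" using assms(3,4) eF by (auto simp: C_def)
    then have "(diameter (C i) / 2) powr s \<le> (D / 2) powr s"
      using assms(7) diameter_ge_0 by (intro powr_mono2) auto
    then show "haus_term s (C i) \<le> ennreal (hnorm s * (D / 2) powr s)"
      unfolding haus_term_def using hnorm_pos[OF assms(7)] by (intro ennreal_leI mult_left_mono) auto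
  qed
  also have "\<dots> = ennreal (real (card F) * (hnorm s * (D / 2) powr s))"
    using hnorm_pos[OF assms(7)] by (simp add: ennreal_mult'' flip: ennreal_of_nat_eq_real_of_nat)
  finally show ?thesis .
qed

text \<open>Cover by the parts of \<open>A\<close> over the cells of a grid of \<open>n ^ (d - 1)\<close> cells in the remaining coordinates.\<close>
lemma hausdorff_outer_lipschitz_graph:
  fixes A :: "(real^'n) set" and i0 :: 'n
  assumes A: "A \<subseteq> cball c h" and h: "h > 0" and K: "K > 0" and d: "CARD('n) \<ge> 2"
    and lip: "\<And>x y. x \<in> A \<Longrightarrow> y \<in> A \<Longrightarrow> norm (x - y) \<le> K * (\<Sum>j\<in>UNIV - {i0}. \<bar>x $ j - y $ j\<bar>)"
  defines "s \<equiv> real CARD('n) - 1"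
  shows "hausdorff_outer s A \<le> ennreal (hnorm s * (K * s * h) ^ (CARD('n) - 1))"
  unfolding hausdorff_outer_eq
proof (rule SUP_least)
  fix \<delta> :: real assume "\<delta> \<in> {0<..}"
  then have \<delta>: "\<delta> > 0" by simp
  have s: "s > 0" "s = real (CARD('n) - 1)" using d by (auto simp: s_def)
  \<comment> \<open>A cell of side \<open>2 * h / n\<close> carries a piece of \<open>A\<close> of
    diameter at most \<open>D\<close>; \<open>n\<close> is chosen to make
    \<open>D \<le> \<delta>\<close>.\<close>
  obtain n0 where n0: "2 * K * s * h / \<delta> < real n0" using reals_Archimedean2 by blast
  define n where "n = Suc n0"
  have n: "real n > 0" "2 * K * s * h / \<delta> < real n" using n0 by (auto simp: n_def)
  define D where "D = 2 * K * s * h / real n"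
  have "2 * K * s * h < real n * \<delta>" using n(2) \<delta> by (simp add: pos_divide_less_eq)
  then have D: "D \<le> \<delta>" "D > 0" using n(1) K s(1) h by (auto simp: D_def pos_divide_le_eq mult.commute)
  let ?J = "UNIV - {i0}"
  define P where "P = (PiE ?J (\<lambda>_. {..<n}))"
  define cell where "cell = (\<lambda>m::'n \<Rightarrow> nat. {x\<in>A. \<forall>j\<in>?J. c $ j - h + 2 * h * real (m j) / real n \<le> x $ j \<and>
     x $ j \<le> c $ j - h + 2 * h * (real (m j) + 1) / real n})"
  have finP: "finite P" "card P = n ^ (CARD('n) - 1)"
    unfolding P_def by (auto intro: finite_PiE simp: card_PiE card_Diff_subset)
  have bd: "bounded (cell m)" for m
    by (rule bounded_subset[of "cball c h"]) (use A in \<open>auto simp: cell_def\<close>)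
  have diam: "diameter (cell m) \<le> D" for m
  proof (rule diameter_le)
    fix x y assume xy: "x \<in> cell m" "y \<in> cell m"
    have "\<bar>x $ j - y $ j\<bar> \<le> 2 * h / real n" if "j \<in> ?J" for j
    proof -
      have "2 * h * (real (m j) + 1) / real n = 2 * h * real (m j) / real n + 2 * h / real n"
        by (simp add: distrib_left add_divide_distrib)
      moreover have "\<forall>z\<in>{x, y}. c $ j - h + 2 * h * real (m j) / real n \<le> z $ j \<and>
          z $ j \<le> c $ j - h + 2 * h * (real (m j) + 1) / real n"
        using xy that unfolding cell_def by blast
      ultimately show ?thesis by auto
    qed
    then have "(\<Sum>j\<in>?J. \<bar>x $ j - y $ j\<bar>) \<le> (\<Sum>j\<in>?J. 2 * h / real n)" by (rule sum_mono)
    also have "\<dots> = s * (2 * h / real n)" by (simp add: s(2) card_Diff_subset)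
    finally have "K * (\<Sum>j\<in>?J. \<bar>x $ j - y $ j\<bar>) \<le> K * (s * (2 * h / real n))"
      using K by (intro mult_left_mono) auto
    also have "\<dots> = D" by (simp add: D_def)
    finally show "norm (x - y) \<le> D" using lip[of x y] xy by (auto simp: cell_def)
  qed (use D in auto)
  have cov: "A \<subseteq> \<Union>(cell ` P)"
  proof
    fix x assume x: "x \<in> A"
    define t where "t = (\<lambda>j. (x $ j - c $ j + h) * real n / (2 * h))"
    \<comment> \<open>The minimum treats the right end \<open>t j = n\<close>, where the floor would
      point to a cell that does not exist.\<close>
    define m where "m = (\<lambda>j. if j \<in> ?J then min (n - 1) (nat \<lfloor>t j\<rfloor>) else undefined)"
    have t: "0 \<le> t j" "t j \<le> real n" for j
    proof -
      have "\<bar>(x - c) $ j\<bar> \<le> norm (x - c)" by (rule component_le_norm_cart)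
      also have "\<dots> \<le> h" using x A by (auto simp: dist_norm norm_minus_commute)
      finally have b: "\<bar>x $ j - c $ j\<bar> \<le> h" by simp
      then show "0 \<le> t j" unfolding t_def using h n by (intro divide_nonneg_pos mult_nonneg_nonneg) auto
      have "(x $ j - c $ j + h) * real n \<le> 2 * h * real n" using b n by (intro mult_right_mono) auto
      then show "t j \<le> real n" using h by (simp add: t_def pos_divide_le_eq mult.commute)
    qed
    have "real (m j) \<le> t j \<and> t j \<le> real (m j) + 1" if "j \<in> ?J" for j
    proof -
      have fl: "real (nat \<lfloor>t j\<rfloor>) \<le> t j" "t j < real (nat \<lfloor>t j\<rfloor>) + 1" using t(1)[of j] by linarith+
      show ?thesis
      proof (cases "nat \<lfloor>t j\<rfloor> \<le> n - 1")
        case True then show ?thesis using fl that by (simp add: m_def)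
      next
        case False
        then have "m j = n - 1" using that by (simp add: m_def)
        then show ?thesis using False fl t(2)[of j] n(1) by (auto simp: n_def)
      qed
    qed
    then have "c $ j - h + 2 * h * real (m j) / real n \<le> x $ j \<and>
     x $ j \<le> c $ j - h + 2 * h * (real (m j) + 1) / real n" if "j \<in> ?J" for j
    proof -
      have xt: "x $ j = c $ j - h + 2 * h * t j / real n" using h n(1) by (simp add: t_def field_simps)
      have "2 * h * real (m j) / real n \<le> 2 * h * t j / real n" "2 * h * t j / real n \<le> 2 * h * (real (m j) + 1) / real n"
        using h \<open>\<And>j. j \<in> ?J \<Longrightarrow> _\<close>[OF that] by (intro divide_right_mono mult_left_mono; simp)+
      then show ?thesis unfolding xt by simp
    qed
    then have "x \<in> cell m" using x by (auto simp: cell_def)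
    moreover have "m \<in> P" unfolding P_def m_def n_def by (auto simp: PiE_iff extensional_def less_Suc_eq_le)
    ultimately show "x \<in> \<Union>(cell ` P)" by blast
  qed
  have "haus_pre s \<delta> A \<le> ennreal (real (card (cell ` P)) * (hnorm s * (D / 2) powr s))"
    by (rule haus_pre_finite_cover) (use finP cov bd diam D \<delta> s in auto)
  also have "\<dots> \<le> ennreal (real (n ^ (CARD('n) - 1)) * (hnorm s * (D / 2) powr s))"
    using card_image_le[OF finP(1), of cell] finP(2) hnorm_pos[OF s(1)]
    by (intro ennreal_leI mult_right_mono) auto
  \<comment> \<open>The number of cells cancels against the power of \<open>D\<close>, so the bound
    is independent of \<open>n\<close> and hence of \<open>\<delta>\<close>.\<close>
  also have "real (n ^ (CARD('n) - 1)) * (hnorm s * (D / 2) powr s) = hnorm s * (K * s * h) ^ (CARD('n) - 1)"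
  proof -
    have "(D / 2) powr s = (D / 2) ^ (CARD('n) - 1)" using powr_realpow[of "D / 2" "CARD('n) - 1"] D(2) unfolding s(2) by (simp only: half_gt_zero)
    moreover have "real n * (D / 2) = K * s * h" using n by (simp add: D_def)
    ultimately show ?thesis by (metis (no_types, lifting) mult.left_commute of_nat_power power_mult_distrib)
  qed
  finally show "haus_pre s \<delta> A \<le> ennreal (hnorm s * (K * s * h) ^ (CARD('n) - 1))" .
qed

lemma emeasure_lborel_slab_box:
  fixes c :: "real^'n" and i0 :: 'n
  assumes "0 \<le> r" "0 \<le> R"
  shows "emeasure lborel {y. (\<forall>j. j \<noteq> i0 \<longrightarrow> \<bar>y $ j - c $ j\<bar> \<le> r) \<and> \<bar>y $ i0\<bar> \<le> R}
     = ennreal (2 * R * (2 * r) ^ (CARD('n) - 1))"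
    and borel_slab_box: "{y. (\<forall>j. j \<noteq> i0 \<longrightarrow> \<bar>y $ j - c $ j\<bar> \<le> r) \<and> \<bar>y $ i0\<bar> \<le> R} \<in> sets borel"
proof -
  define a where "a = (\<chi> j. if j = i0 then -R else c $ j - r)"
  define b where "b = (\<chi> j. if j = i0 then R else c $ j + r)"
  have e: "{y. (\<forall>j. j \<noteq> i0 \<longrightarrow> \<bar>y $ j - c $ j\<bar> \<le> r) \<and> \<bar>y $ i0\<bar> \<le> R} = cbox a b"
  proof (intro set_eqI iffI)
    fix y assume y: "y \<in> {y. (\<forall>j. j \<noteq> i0 \<longrightarrow> \<bar>y $ j - c $ j\<bar> \<le> r) \<and> \<bar>y $ i0\<bar> \<le> R}"
    have "a $ j \<le> y $ j \<and> y $ j \<le> b $ j" for j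
      using y by (cases "j = i0") (auto simp: a_def b_def abs_le_iff dest!: spec[of _ j])
    then show "y \<in> cbox a b" by (simp add: mem_box_cart)
  next
    fix y assume "y \<in> cbox a b"
    then have y: "a $ j \<le> y $ j \<and> y $ j \<le> b $ j" for j by (simp add: mem_box_cart)
    have "\<bar>y $ j - c $ j\<bar> \<le> r" if "j \<noteq> i0" for j using y[of j] that by (auto simp: a_def b_def)
    moreover have "\<bar>y $ i0\<bar> \<le> R" using y[of i0] by (auto simp: a_def b_def)
    ultimately show "y \<in> {y. (\<forall>j. j \<noteq> i0 \<longrightarrow> \<bar>y $ j - c $ j\<bar> \<le> r) \<and> \<bar>y $ i0\<bar> \<le> R}" by auto
  qed
  have ab: "\<forall>i. a $ i \<le> b $ i" using assms by (simp add: a_def b_def)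
  then have "cbox a b \<noteq> {}" by (simp add: interval_ne_empty_cart)
  then have "measure lborel (cbox a b) = (\<Prod>i\<in>UNIV. b $ i - a $ i)"
    by (rule content_cbox_cart)
  also have "\<dots> = (b $ i0 - a $ i0) * (\<Prod>i\<in>UNIV - {i0}. b $ i - a $ i)" by (rule prod.remove) auto
  also have "(\<Prod>i\<in>UNIV - {i0}. b $ i - a $ i) = (\<Prod>i\<in>UNIV - {i0}. 2 * r)"
    by (intro prod.cong) (auto simp: a_def b_def)
  also have "\<dots> = (2 * r) ^ (CARD('n) - 1)" by (simp add: card_Diff_subset)
  finally have "measure lborel (cbox a b) = 2 * R * (2 * r) ^ (CARD('n) - 1)" by (simp add: a_def b_def)
  then show "emeasure lborel {y. (\<forall>j. j \<noteq> i0 \<longrightarrow> \<bar>y $ j - c $ j\<bar> \<le> r) \<and> \<bar>y $ i0\<bar> \<le> R}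
     = ennreal (2 * R * (2 * r) ^ (CARD('n) - 1))"
    unfolding e by (metis emeasure_eq_ennreal_measure emeasure_lborel_cbox_finite infinity_ennreal_def less_irrefl)
  show "{y. (\<forall>j. j \<noteq> i0 \<longrightarrow> \<bar>y $ j - c $ j\<bar> \<le> r) \<and> \<bar>y $ i0\<bar> \<le> R} \<in> sets borel"
    unfolding e by simp
qed

text \<open>Ratio of the volume of a box of length \<open>2 * R\<close> and width twice a diameter
  to the Hausdorff term of that diameter, divided by \<open>R\<close>. The 4 arises because that
  term uses half the diameter.\<close>

definition tube_const :: "'n::finite itself \<Rightarrow> real" where
  "tube_const _ = 2 * 4 ^ (CARD('n) - 1) / hnorm (real CARD('n) - 1)"

text \<open>A cover of \<open>B\<close> by sets of diameter \<open>d\<^sub>i\<close> yields a cover of the points carried into \<open>B\<close> by boxes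
  of transverse width \<open>2 d\<^sub>i\<close>; so moving along a coordinate direction costs only a constant.\<close>
lemma emeasure_tube_le:
  fixes D :: "(real^'n) set" and q :: "real^'n \<Rightarrow> real^'n" and i0 :: 'n
  assumes D: "D \<subseteq> cball 0 R" and R: "R > 0" and d: "CARD('n) \<ge> 2"
    and q: "\<And>x j. x \<in> D \<Longrightarrow> j \<noteq> i0 \<Longrightarrow> q x $ j = x $ j"
    and meas: "{x\<in>D. q x \<in> B} \<in> sets borel"
  defines "s \<equiv> real CARD('n) - 1"
  shows "emeasure lborel {x\<in>D. q x \<in> B} \<le> ennreal (tube_const TYPE('n) * R) * hausdorff_outer s B"
proof -
  let ?K = "ennreal (tube_const TYPE('n) * R)"
  have s: "s > 0" "s = real (CARD('n) - 1)" using d by (auto simp: s_def)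
  have K0: "tube_const TYPE('n) * R > 0"
    unfolding tube_const_def using R hnorm_pos[OF s(1)] by (auto simp: s_def)
  then have K1: "?K \<noteq> 0" by (metis ennreal_eq_0_iff not_le)
  \<comment> \<open>After division by the constant the left side can be compared with each cover
    sum, so it is a lower bound of the infimum. The bound 1 on the diameters is arbitrary:
    \<open>haus_pre\<close> for any positive value is below \<open>hausdorff_outer\<close>.\<close>
  have "emeasure lborel {x\<in>D. q x \<in> B} / ?K \<le> haus_pre s 1 B"
    unfolding haus_pre_def
  proof (rule INF_greatest)
    fix C :: "nat \<Rightarrow> (real^'n) set"
    assume "C \<in> {C. B \<subseteq> (\<Union>i. C i) \<and> (\<forall>i. bounded (C i) \<and> diameter (C i) \<le> 1)}"
    then have C: "B \<subseteq> (\<Union>i. C i)" "\<And>i. bounded (C i)" by auto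
    \<comment> \<open>For an empty \<open>C i\<close> the point is arbitrary, which is harmless
      because the box then has width 0.\<close>
    define p where "p = (\<lambda>i. SOME x. x \<in> C i)"
    define Q where "Q = (\<lambda>i. {y. (\<forall>j. j \<noteq> i0 \<longrightarrow> \<bar>y $ j - p i $ j\<bar> \<le> diameter (C i)) \<and> \<bar>y $ i0\<bar> \<le> R})"
    have "{x\<in>D. q x \<in> B} \<subseteq> (\<Union>i. Q i)"
    proof
      fix x assume x: "x \<in> {x\<in>D. q x \<in> B}"
      then obtain i where i: "q x \<in> C i" using C by auto
      then have pi: "p i \<in> C i" unfolding p_def by (rule someI)
      have "\<bar>x $ j - p i $ j\<bar> \<le> diameter (C i)" if "j \<noteq> i0" for j
      proof -
        have "\<bar>(q x - p i) $ j\<bar> \<le> norm (q x - p i)" by (rule component_le_norm_cart)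
        also have "\<dots> \<le> diameter (C i)" using diameter_bounded_bound[OF C(2) i pi] by (simp add: dist_norm)
        finally show ?thesis using q[of x j] x that by simp
      qed
      moreover have "\<bar>x $ i0\<bar> \<le> R"
        using component_le_norm_cart[of x i0] x D by (auto intro: order_trans)
      ultimately show "x \<in> (\<Union>i. Q i)" by (auto simp: Q_def)
    qed
    then have "emeasure lborel {x\<in>D. q x \<in> B} \<le> emeasure lborel (\<Union>i. Q i)"
      using R diameter_ge_0[OF C(2)]
      by (intro emeasure_mono) (auto simp: Q_def intro!: sets.countable_UN borel_slab_box)
    also have "\<dots> \<le> (\<Sum>i. emeasure lborel (Q i))"
      using R diameter_ge_0[OF C(2)]
      by (intro emeasure_subadditive_countably) (auto simp: Q_def intro!: borel_slab_box)
    also have "\<dots> = (\<Sum>i. ?K * haus_term s (C i))"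
    proof (rule suminf_cong)
      fix i
      have dg: "0 \<le> diameter (C i)" using C(2) by (rule diameter_ge_0)
      \<comment> \<open>At diameter 0 both sides vanish only because the exponent
        \<open>CARD('n) - 1\<close> is positive.\<close>
      have pw: "(diameter (C i) / 2) powr s = (diameter (C i) / 2) ^ (CARD('n) - 1)"
      proof (cases "diameter (C i) = 0")
        case True
        then show ?thesis using d by simp
      next
        case False
        then have "0 < diameter (C i) / 2" using dg by simp
        from powr_realpow[OF this, of "CARD('n) - 1"] show ?thesis unfolding s(2) .
      qed
      have "emeasure lborel (Q i) = ennreal (2 * R * (2 * diameter (C i)) ^ (CARD('n) - 1))"
        unfolding Q_def using R dg by (intro emeasure_lborel_slab_box) auto
      also have "2 * R * (2 * diameter (C i)) ^ (CARD('n) - 1) =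
         (tube_const TYPE('n) * R) * (hnorm s * (diameter (C i) / 2) powr s)"
      proof -
        have "(2 * diameter (C i)) = 4 * (diameter (C i) / 2)" by simp
        then have "(2 * diameter (C i)) ^ (CARD('n) - 1) = 4 ^ (CARD('n) - 1) * (diameter (C i) / 2) ^ (CARD('n) - 1)"
          by (metis power_mult_distrib)
        then show ?thesis unfolding pw tube_const_def using hnorm_pos[OF s(1)] by (simp add: s_def)
      qed
      also have "ennreal \<dots> = ?K * haus_term s (C i)"
        unfolding haus_term_def using K0 hnorm_pos[OF s(1)] by (intro ennreal_mult) auto
      finally show "emeasure lborel (Q i) = ?K * haus_term s (C i)" .
    qed
    also have "\<dots> = ?K * (\<Sum>i. haus_term s (C i))" by (rule ennreal_suminf_cmult)
    finally have "emeasure lborel {x\<in>D. q x \<in> B} / ?K \<le> (?K * (\<Sum>i. haus_term s (C i))) / ?K"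
      by (rule divide_right_mono_ennreal)
    also have "\<dots> = (\<Sum>i. haus_term s (C i))"
      unfolding mult.commute[of ?K] by (rule mult_divide_eq_ennreal[OF K1 ennreal_neq_top])
    finally show "emeasure lborel {x\<in>D. q x \<in> B} / ?K \<le> (\<Sum>i. haus_term s (C i))" .
  qed
  also have "\<dots> \<le> hausdorff_outer s B" by (rule haus_pre_le_outer) simp
  finally have "emeasure lborel {x\<in>D. q x \<in> B} / ?K * ?K \<le> hausdorff_outer s B * ?K"
    by (rule mult_right_mono) simp
  moreover have "emeasure lborel {x\<in>D. q x \<in> B} / ?K * ?K = emeasure lborel {x\<in>D. q x \<in> B}"
    using mult_divide_eq_ennreal[OF K1 ennreal_neq_top, of 1] by (simp add: ennreal_divide_times)
  ultimately show ?thesis by (simp add: mult.commute)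
qed

text \<open>The set estimate says that the image under \<open>q\<close> of Lebesgue measure on
  \<open>D\<close> is dominated by a multiple of the Hausdorff measure; domination of measures
  passes to integrals.\<close>

lemma nn_integral_tube_le:
  fixes D :: "(real^'n) set" and q :: "real^'n \<Rightarrow> real^'n" and i0 :: 'n
  assumes D: "D \<subseteq> cball 0 R" "D \<in> sets borel" and R: "R > 0" and d: "CARD('n) \<ge> 2"
    and q: "\<And>x j. x \<in> D \<Longrightarrow> j \<noteq> i0 \<Longrightarrow> q x $ j = x $ j" "q \<in> borel_measurable borel"
    and f: "f \<in> borel_measurable borel"
  shows "(\<integral>\<^sup>+x. f (q x) * indicator D x \<partial>lborel) \<le>
     ennreal (tube_const TYPE('n) * R) * (\<integral>\<^sup>+x. f x \<partial>haus (real CARD('n) - 1))"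
proof -
  let ?s = "real CARD('n) - 1"
  let ?K = "ennreal (tube_const TYPE('n) * R)"
  define \<mu> where "\<mu> = distr (density lborel (indicator D)) borel q"
  have qm: "q \<in> measurable (density lborel (indicator D)) borel" using q by simp
  have "\<mu> \<le> scale_measure ?K (haus ?s)"
  proof (rule le_measure[THEN iffD2, rule_format])
    fix B assume "B \<in> sets \<mu>"
    then have B: "B \<in> sets borel" by (simp add: \<mu>_def)
    have m: "q -` B \<in> sets borel" using measurable_sets[OF q(2) B] by simp
    have e: "{x\<in>D. q x \<in> B} = D \<inter> q -` B" by auto
    have "emeasure \<mu> B = emeasure lborel (D \<inter> q -` B)"
      unfolding \<mu>_def using emeasure_distr[OF qm B] D m
      by (simp add: emeasure_density indicator_inter_arith[symmetric] emeasure_restricted)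
    also have "\<dots> \<le> ?K * hausdorff_outer ?s B"
      using emeasure_tube_le[OF D(1) R d q(1), where B=B] D m unfolding e by auto
    finally show "emeasure \<mu> B \<le> emeasure (scale_measure ?K (haus ?s)) B"
      by (simp add: emeasure_haus[OF B])
  qed (simp add: \<mu>_def)
  then have "(\<integral>\<^sup>+x. f x \<partial>\<mu>) \<le> (\<integral>\<^sup>+x. f x \<partial>scale_measure ?K (haus ?s))"
    by (intro nn_integral_mono_measure) (simp add: \<mu>_def)
  also have "\<dots> = ?K * (\<integral>\<^sup>+x. f x \<partial>haus ?s)"
    using f by (intro nn_integral_scale_measure) simp
  also have "(\<integral>\<^sup>+x. f x \<partial>\<mu>) = (\<integral>\<^sup>+x. f (q x) * indicator D x \<partial>lborel)"
    unfolding \<mu>_def using D f q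
    by (subst nn_integral_distr[OF qm]) (auto simp: nn_integral_density mult.commute)
  finally show ?thesis .
qed


section \<open>The boundary of the domain\<close>

text \<open>A negative value would put \<open>p\<close> into the open set \<open>\<Omega>\<close>; a
  positive one would give \<open>p\<close> a neighbourhood that misses
  \<open>\<Omega>\<close>.\<close>

lemma local_defining_fn_frontier_zero:
  assumes "local_defining_fn \<Omega> U \<phi> G" "p \<in> U" "p \<in> frontier \<Omega>" "open \<Omega>"
  shows "\<phi> p = 0"
proof (rule ccontr)
  assume n: "\<phi> p \<noteq> 0"
  have L: "open U" "\<And>x. x \<in> U \<Longrightarrow> (\<phi> has_derivative (\<lambda>h. G x \<bullet> h)) (at x)" "\<Omega> \<inter> U = {x\<in>U. \<phi> x < 0}"
    using assms(1) by (auto simp: local_defining_fn_def)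
  have "p \<notin> \<Omega>" using assms(3,4) by (simp add: frontier_def interior_open)
  then have pos: "\<phi> p > 0" using n L(3) assms(2) by fastforce
  have cont: "continuous_on U \<phi>"
    using L(2) by (meson continuous_at_imp_continuous_on has_derivative_continuous)
  have "open {x\<in>U. \<phi> x > 0}"
    using continuous_open_preimage[OF cont L(1) open_greaterThan[of 0]] by (simp add: vimage_def Int_def)
  moreover have "p \<in> closure \<Omega>" using assms(3) by (simp add: frontier_def)
  ultimately have "{x\<in>U. \<phi> x > 0} \<inter> \<Omega> \<noteq> {}"
    using pos assms(2) open_Int_closure_eq_empty[of "{x\<in>U. \<phi> x > 0}" \<Omega>] by blast
  then obtain y where "y \<in> U" "\<phi> y > 0" "y \<in> \<Omega>" by blast
  moreover from this have "y \<in> {x\<in>U. \<phi> x < 0}" unfolding L(3)[symmetric] by blast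
  ultimately show False by simp
qed

lemma has_derivative_sign_along:
  fixes \<phi> :: "'a::real_inner \<Rightarrow> real"
  assumes "(\<phi> has_derivative (\<lambda>h. g \<bullet> h)) (at p)" "\<phi> p = 0" "g \<bullet> v > 0"
  shows "\<forall>\<^sub>F t in at_right 0. \<phi> (p + t *\<^sub>R v) > 0"
proof -
  have "((\<lambda>t. \<phi> (p + t *\<^sub>R v)) has_derivative (\<lambda>t. g \<bullet> (0 + t *\<^sub>R v))) (at 0)"
    by (rule has_derivative_compose[of "\<lambda>t. p + t *\<^sub>R v"]) (use assms(1) in \<open>auto intro!: derivative_eq_intros\<close>)
  then have "((\<lambda>t. \<phi> (p + t *\<^sub>R v)) has_real_derivative (g \<bullet> v)) (at 0)"
    by (simp add: has_field_derivative_def mult_commute_abs)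
  then obtain d where "d > 0" "\<And>h. h > 0 \<Longrightarrow> h < d \<Longrightarrow> \<phi> (p + 0 *\<^sub>R v) < \<phi> (p + (0 + h) *\<^sub>R v)"
    using DERIV_pos_inc_right assms(3) by blast
  then show ?thesis using assms(2) by (auto simp: eventually_at_right_field intro!: exI[of _ d])
qed

text \<open>If the unit normals \<open>\<nu>\<close> and \<open>\<nu>'\<close> differ, the direction
  \<open>\<nu>' - \<nu>\<close> decreases \<open>\<phi>\<close> and increases
  \<open>\<phi>'\<close>. A short step along it would be inside \<open>\<Omega>\<close> by the first
  function and outside by the second.\<close>

lemma local_defining_fn_normal_unique:
  assumes "local_defining_fn \<Omega> U \<phi> G" "p \<in> U" "local_defining_fn \<Omega> U' \<phi>' G'" "p \<in> U'"
    "p \<in> frontier \<Omega>" "open \<Omega>"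
  shows "G p /\<^sub>R norm (G p) = G' p /\<^sub>R norm (G' p)"
proof (rule ccontr)
  define \<nu> where "\<nu> = G p /\<^sub>R norm (G p)"
  define \<nu>' where "\<nu>' = G' p /\<^sub>R norm (G' p)"
  assume "G p /\<^sub>R norm (G p) \<noteq> G' p /\<^sub>R norm (G' p)"
  then have ne: "\<nu> \<noteq> \<nu>'" by (simp add: \<nu>_def \<nu>'_def)
  have L: "open U" "(\<phi> has_derivative (\<lambda>h. G p \<bullet> h)) (at p)" "\<Omega> \<inter> U = {x\<in>U. \<phi> x < 0}" "G p \<noteq> 0"
    using assms by (auto simp: local_defining_fn_def)
  have L': "open U'" "(\<phi>' has_derivative (\<lambda>h. G' p \<bullet> h)) (at p)" "\<Omega> \<inter> U' = {x\<in>U'. \<phi>' x < 0}" "G' p \<noteq> 0"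
    using assms by (auto simp: local_defining_fn_def)
  have n: "\<nu> \<bullet> \<nu> = 1" "\<nu>' \<bullet> \<nu>' = 1"
    using L(4) L'(4) by (auto simp: \<nu>_def \<nu>'_def dot_square_norm power2_eq_square)
  have "0 < (\<nu> - \<nu>') \<bullet> (\<nu> - \<nu>')" using ne by simp
  then have lt: "\<nu> \<bullet> \<nu>' < 1" using n by (simp add: inner_diff inner_commute)
  define v where "v = \<nu>' - \<nu>"
  have "\<nu> \<bullet> v < 0" "\<nu>' \<bullet> v > 0" using lt n by (auto simp: v_def inner_diff inner_commute)
  moreover have "G p = norm (G p) *\<^sub>R \<nu>" "G' p = norm (G' p) *\<^sub>R \<nu>'" using L(4) L'(4) by (auto simp: \<nu>_def \<nu>'_def)
  ultimately have s: "(- G p) \<bullet> v > 0" "G' p \<bullet> v > 0"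
    using L(4) L'(4) by (metis inner_minus_left inner_scaleR_left mult_pos_neg neg_0_less_iff_less zero_less_norm_iff)
      (metis L'(4) \<open>G' p = norm (G' p) *\<^sub>R \<nu>'\<close> \<open>0 < \<nu>' \<bullet> v\<close> inner_scaleR_left mult_pos_pos zero_less_norm_iff)
  have z: "\<phi> p = 0" "\<phi>' p = 0"
    using local_defining_fn_frontier_zero[OF assms(1,2,5,6)] local_defining_fn_frontier_zero[OF assms(3,4,5,6)] by auto
  have "((\<lambda>x. - \<phi> x) has_derivative (\<lambda>h. (- G p) \<bullet> h)) (at p)"
    using has_derivative_minus[OF L(2)] by simp
  then have e1: "\<forall>\<^sub>F t in at_right 0. - \<phi> (p + t *\<^sub>R v) > 0"
    by (rule has_derivative_sign_along) (use z s in auto)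
  have e2: "\<forall>\<^sub>F t in at_right 0. \<phi>' (p + t *\<^sub>R v) > 0"
    by (rule has_derivative_sign_along[OF L'(2) z(2) s(2)])
  have "((\<lambda>t. p + t *\<^sub>R v) \<longlongrightarrow> p + 0 *\<^sub>R v) (at_right 0)" by (intro tendsto_intros)
  then have e3: "\<forall>\<^sub>F t in at_right 0. p + t *\<^sub>R v \<in> U \<inter> U'"
    by (rule topological_tendstoD) (use L(1) L'(1) assms in auto)
  have "\<forall>\<^sub>F t in at_right (0::real). False"
    using e1 e2 e3
  proof eventually_elim
    case (elim t)
    then have "p + t *\<^sub>R v \<in> \<Omega>" using L(3) by auto
    then have "p + t *\<^sub>R v \<in> {x\<in>U'. \<phi>' x < 0}" using elim unfolding L'(3)[symmetric] by blast
    then show False using elim by simp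
  qed
  then show False by simp
qed

lemma outward_normal_eq:
  assumes "local_defining_fn \<Omega> U \<phi> G" "p \<in> U" "p \<in> frontier \<Omega>" "open \<Omega>"
  shows "outward_normal \<Omega> p = G p /\<^sub>R norm (G p)"
  unfolding outward_normal_def
proof (rule some_equality)
  show "\<exists>U \<phi> G'. p \<in> U \<and> local_defining_fn \<Omega> U \<phi> G' \<and> G p /\<^sub>R norm (G p) = G' p /\<^sub>R norm (G' p)"
    using assms by blast
qed (use local_defining_fn_normal_unique[OF _ _ assms] in auto)

lemma norm_outward_normal:
  assumes "C2_domain \<Omega>" "open \<Omega>" "p \<in> frontier \<Omega>"
  shows "norm (outward_normal \<Omega> p) = 1"
proof -
  obtain U \<phi> G where L: "p \<in> U" "local_defining_fn \<Omega> U \<phi> G"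
    using assms by (auto simp: C2_domain_def)
  then have "G p \<noteq> 0" by (auto simp: local_defining_fn_def)
  then show ?thesis using outward_normal_eq[OF L(2,1) assms(3,2)] by simp
qed

text \<open>Makes the flux integrands integrable, without which the Bochner integral would not be
  additive in them.\<close>

lemma continuous_on_outward_normal:
  assumes "C2_domain \<Omega>" "open \<Omega>"
  shows "continuous_on (frontier \<Omega>) (outward_normal \<Omega>)"
  unfolding continuous_on_eq_continuous_within
proof
  fix p assume p: "p \<in> frontier \<Omega>"
  obtain U \<phi> G where L: "p \<in> U" "local_defining_fn \<Omega> U \<phi> G"
    using assms p by (auto simp: C2_domain_def)
  then have U: "open U" "G p \<noteq> 0" and "\<exists>H. (G has_derivative H) (at p)"
    by (auto simp: local_defining_fn_def)
  then have "continuous (at p) G" using has_derivative_continuous by blast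
  then have "continuous (at p) (\<lambda>x. G x /\<^sub>R norm (G x))"
    using U by (intro continuous_intros) auto
  then have c: "continuous (at p within frontier \<Omega>) (\<lambda>x. G x /\<^sub>R norm (G x))"
    by (rule continuous_at_imp_continuous_at_within)
  obtain r where r: "r > 0" "ball p r \<subseteq> U" using U(1) L(1) open_contains_ball by blast
  show "continuous (at p within frontier \<Omega>) (outward_normal \<Omega>)"
    by (rule continuous_transform_within[OF c r(1) p])
      (use r outward_normal_eq[OF L(2) _ _ assms(2)] in \<open>auto simp: subset_iff dist_commute\<close>)
qed

text \<open>A Lipschitz form of the implicit function theorem: \<open>\<phi>\<close> vanishes on the
  boundary and its gradient stays close to \<open>G p\<close>, so the coordinate with
  \<open>G p $ i0 \<noteq> 0\<close> is controlled by the others.\<close>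

lemma frontier_local_graph:
  fixes \<Omega> :: "(real^'n) set"
  assumes "C2_domain \<Omega>" "open \<Omega>" "p \<in> frontier \<Omega>"
  shows "\<exists>\<rho>>0. \<exists>i0. \<exists>K>0. \<forall>x\<in>frontier \<Omega> \<inter> ball p \<rho>. \<forall>y\<in>frontier \<Omega> \<inter> ball p \<rho>.
     norm (x - y) \<le> K * (\<Sum>j\<in>UNIV - {i0}. \<bar>x $ j - y $ j\<bar>)"
proof -
  obtain U \<phi> G where L: "p \<in> U" "local_defining_fn \<Omega> U \<phi> G"
    using assms by (auto simp: C2_domain_def)
  then have U: "open U" "G p \<noteq> 0" "\<And>x. x \<in> U \<Longrightarrow> (\<phi> has_derivative (\<lambda>h. G x \<bullet> h)) (at x)"
    and "\<exists>H. (G has_derivative H) (at p)"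
    by (auto simp: local_defining_fn_def)
  then have cG: "continuous (at p) G" using has_derivative_continuous by blast
  obtain i0 where i0: "G p $ i0 \<noteq> 0" using U(2) by (auto simp: vec_eq_iff)
  define m where "m = \<bar>G p $ i0\<bar>"
  have m: "m > 0" using i0 by (simp add: m_def)
  obtain r1 where r1: "r1 > 0" "ball p r1 \<subseteq> U" using U(1) L(1) open_contains_ball by blast
  obtain r2 where r2: "r2 > 0" "\<And>x. dist x p < r2 \<Longrightarrow> dist (G x) (G p) < m / 2"
    using cG m unfolding continuous_at_eps_delta by (metis half_gt_zero)
  define \<rho> where "\<rho> = min r1 r2"
  \<comment> \<open>\<open>1 + 2 * norm (G p) / m\<close> bounds the difference in coordinate
    \<open>i0\<close> by those in the others; one more unit passes to the norm.\<close>
  define K where "K = 2 + 2 * norm (G p) / m"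
  have "norm (x - y) \<le> K * (\<Sum>j\<in>UNIV - {i0}. \<bar>x $ j - y $ j\<bar>)"
    if x: "x \<in> frontier \<Omega> \<inter> ball p \<rho>" and y: "y \<in> frontier \<Omega> \<inter> ball p \<rho>" for x y
  proof -
    define S where "S = (\<Sum>j\<in>UNIV - {i0}. \<bar>x $ j - y $ j\<bar>)"
    have xyU: "x \<in> U" "y \<in> U" using x y r1 by (auto simp: \<rho>_def)
    have z: "\<phi> x = 0" "\<phi> y = 0"
      using local_defining_fn_frontier_zero[OF L(2) xyU(1)] local_defining_fn_frontier_zero[OF L(2) xyU(2)] x y assms by auto
    \<comment> \<open>Without its linear part at \<open>p\<close> the function has Lipschitz
      constant \<open>m / 2\<close>, small enough to be absorbed by the term in coordinate
      \<open>i0\<close>.\<close>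
    have "norm ((\<phi> x - G p \<bullet> x) - (\<phi> y - G p \<bullet> y)) \<le> m / 2 * norm (x - y)"
    proof (rule differentiable_bound[of "ball p \<rho>" "\<lambda>x. \<phi> x - G p \<bullet> x" "\<lambda>x h. G x \<bullet> h - G p \<bullet> h"])
      fix w assume w: "w \<in> ball p \<rho>"
      then have "w \<in> U" using r1 by (auto simp: \<rho>_def)
      show "((\<lambda>x. \<phi> x - G p \<bullet> x) has_derivative (\<lambda>h. G w \<bullet> h - G p \<bullet> h)) (at w within ball p \<rho>)"
        by (rule has_derivative_at_withinI) (use U(3)[OF \<open>w \<in> U\<close>] in \<open>auto intro!: derivative_eq_intros\<close>)
      have "dist w p < r2" using w by (simp add: \<rho>_def dist_commute)
      then have nw: "norm (G w - G p) \<le> m / 2" using r2(2)[of w] by (simp add: dist_norm)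
      show "onorm (\<lambda>h. G w \<bullet> h - G p \<bullet> h) \<le> m / 2"
      proof (rule onorm_le)
        fix h
        have "\<bar>(G w - G p) \<bullet> h\<bar> \<le> norm (G w - G p) * norm h" by (rule Cauchy_Schwarz_ineq2)
        also have "\<dots> \<le> m / 2 * norm h" using nw by (intro mult_right_mono) auto
        finally show "norm (G w \<bullet> h - G p \<bullet> h) \<le> m / 2 * norm h" by (simp add: inner_diff_left)
      qed
    qed (use x y in auto)
    then have "\<bar>G p \<bullet> (x - y)\<bar> \<le> m / 2 * norm (x - y)" using z by (simp add: inner_diff_right abs_minus_commute)
    moreover have nl: "norm (x - y) \<le> \<bar>x $ i0 - y $ i0\<bar> + S"
    proof -
      have "norm (x - y) \<le> (\<Sum>j\<in>UNIV. \<bar>(x - y) $ j\<bar>)" by (rule norm_le_l1_cart)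
      also have "\<dots> = \<bar>(x - y) $ i0\<bar> + (\<Sum>j\<in>UNIV - {i0}. \<bar>(x - y) $ j\<bar>)" by (rule sum.remove) auto
      finally show ?thesis by (simp add: S_def)
    qed
    moreover have "\<bar>G p \<bullet> (x - y)\<bar> \<ge> m * \<bar>x $ i0 - y $ i0\<bar> - norm (G p) * S"
    proof -
      have "G p \<bullet> (x - y) = (\<Sum>j\<in>UNIV. G p $ j * (x $ j - y $ j))" by (simp add: inner_vec_def)
      also have "\<dots> = G p $ i0 * (x $ i0 - y $ i0) + (\<Sum>j\<in>UNIV - {i0}. G p $ j * (x $ j - y $ j))"
        by (rule sum.remove) auto
      finally have e: "G p \<bullet> (x - y) = \<dots>" .
      have "\<bar>\<Sum>j\<in>UNIV - {i0}. G p $ j * (x $ j - y $ j)\<bar> \<le> (\<Sum>j\<in>UNIV - {i0}. \<bar>G p $ j * (x $ j - y $ j)\<bar>)"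
        by (rule sum_abs)
      also have "\<dots> \<le> (\<Sum>j\<in>UNIV - {i0}. norm (G p) * \<bar>x $ j - y $ j\<bar>)"
        unfolding abs_mult by (intro sum_mono mult_right_mono component_le_norm_cart) auto
      finally have "\<bar>\<Sum>j\<in>UNIV - {i0}. G p $ j * (x $ j - y $ j)\<bar> \<le> norm (G p) * S"
        by (simp add: S_def sum_distrib_left)
      moreover have "\<bar>G p $ i0 * (x $ i0 - y $ i0)\<bar> = m * \<bar>x $ i0 - y $ i0\<bar>" by (simp add: m_def abs_mult)
      ultimately show ?thesis unfolding e by linarith
    qed
    ultimately have "m * \<bar>x $ i0 - y $ i0\<bar> \<le> m / 2 * (\<bar>x $ i0 - y $ i0\<bar> + S) + norm (G p) * S"
      using m mult_left_mono[OF nl, of "m / 2"] by linarith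
    then have "m * \<bar>x $ i0 - y $ i0\<bar> \<le> (m + 2 * norm (G p)) * S" by (simp add: algebra_simps)
    then have "\<bar>x $ i0 - y $ i0\<bar> \<le> (m + 2 * norm (G p)) * S / m"
      using m by (simp add: pos_le_divide_eq mult.commute)
    also have "\<dots> = (1 + 2 * norm (G p) / m) * S" using m by (simp add: field_simps)
    finally show ?thesis using nl unfolding S_def[symmetric] K_def by (simp add: distrib_right)
  qed
  moreover have "\<rho> > 0" using r1 r2 by (simp add: \<rho>_def)
  moreover have "K > 0" unfolding K_def using m by (intro add_pos_nonneg divide_nonneg_pos) auto
  ultimately show ?thesis by blast
qed

section \<open>Surface measure of boundary pieces and of plane pieces\<close>

lemma hausdorff_outer_finite_UN_le:
  "finite I \<Longrightarrow> hausdorff_outer s (\<Union>i\<in>I. A i) \<le> (\<Sum>i\<in>I. hausdorff_outer s (A i))"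
proof (induction I rule: finite_induct)
  case (insert a I)
  have "hausdorff_outer s (\<Union>i\<in>insert a I. A i) \<le> hausdorff_outer s (A a) + hausdorff_outer s (\<Union>i\<in>I. A i)"
    using hausdorff_outer_Un_le[of s "A a"] by simp
  also have "\<dots> \<le> hausdorff_outer s (A a) + (\<Sum>i\<in>I. hausdorff_outer s (A i))"
    by (intro add_left_mono insert)
  finally show ?case using insert by simp
qed (simp add: hausdorff_outer_empty)

text \<open>Compactness leaves finitely many Lipschitz patches, and in each of them the grid
  estimate scales like \<open>h ^ (CARD('n) - 1)\<close> for every ball. The constant depends on
  \<open>\<Omega>\<close> only; the added 1 keeps it positive.\<close>

lemma hausdorff_outer_frontier_le:
  fixes \<Omega> :: "(real^'n) set"
  assumes "C2_domain \<Omega>" "open \<Omega>" "bounded \<Omega>" "CARD('n) \<ge> 2"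
  shows "\<exists>C>0. \<forall>c h. h > 0 \<longrightarrow>
    hausdorff_outer (real CARD('n) - 1) (frontier \<Omega> \<inter> cball c h) \<le> ennreal (C * h ^ (CARD('n) - 1))"
proof -
  let ?s = "real CARD('n) - 1"
  let ?\<Gamma> = "frontier \<Omega>"
  define gr where "gr = (\<lambda>p \<rho> i0 K. \<forall>x\<in>?\<Gamma> \<inter> ball p \<rho>. \<forall>y\<in>?\<Gamma> \<inter> ball p \<rho>.
     norm (x - y) \<le> K * (\<Sum>j\<in>UNIV - {i0}. \<bar>x $ j - y $ j\<bar>))"
  have "\<forall>p\<in>?\<Gamma>. \<exists>\<rho> i0 K. \<rho> > 0 \<and> K > 0 \<and> gr p \<rho> i0 K"
    using frontier_local_graph[OF assms(1,2)] unfolding gr_def by meson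
  then obtain \<rho> i0 K where g: "\<And>p. p \<in> ?\<Gamma> \<Longrightarrow> \<rho> p > 0 \<and> K p > 0 \<and> gr p (\<rho> p) (i0 p) (K p)"
    by metis
  have cp: "compact ?\<Gamma>" using assms(3) by (rule compact_frontier_bounded)
  have cv: "?\<Gamma> \<subseteq> (\<Union>p\<in>?\<Gamma>. ball p (\<rho> p))"
  proof
    fix p assume "p \<in> ?\<Gamma>"
    moreover from this have "p \<in> ball p (\<rho> p)" using g[of p] by simp
    ultimately show "p \<in> (\<Union>p\<in>?\<Gamma>. ball p (\<rho> p))" by (rule UN_I)
  qed
  obtain P where P: "P \<subseteq> ?\<Gamma>" "finite P" "?\<Gamma> \<subseteq> (\<Union>p\<in>P. ball p (\<rho> p))"
    by (rule compactE_image[OF cp _ cv]) (rule open_ball)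
  have s: "?s > 0" using assms(4) by simp
  define B where "B = (\<lambda>p. hnorm ?s * (K p * ?s) ^ (CARD('n) - 1))"
  have B0: "B p \<ge> 0" if "p \<in> P" for p
    unfolding B_def using g[of p] that P s hnorm_pos[OF s] by (intro mult_nonneg_nonneg zero_le_power) auto
  show ?thesis
  proof (intro exI[of _ "1 + (\<Sum>p\<in>P. B p)"] conjI allI impI)
    show "0 < 1 + (\<Sum>p\<in>P. B p)" using B0 by (intro add_pos_nonneg sum_nonneg) auto
    fix c :: "real^'n" and h :: real assume h: "h > 0"
    have "hausdorff_outer ?s (?\<Gamma> \<inter> cball c h) \<le> hausdorff_outer ?s (\<Union>p\<in>P. ?\<Gamma> \<inter> cball c h \<inter> ball p (\<rho> p))"
      using P by (intro hausdorff_outer_mono) auto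
    also have "\<dots> \<le> (\<Sum>p\<in>P. hausdorff_outer ?s (?\<Gamma> \<inter> cball c h \<inter> ball p (\<rho> p)))"
      by (rule hausdorff_outer_finite_UN_le[OF P(2)])
    also have "\<dots> \<le> (\<Sum>p\<in>P. ennreal (B p * h ^ (CARD('n) - 1)))"
    proof (rule sum_mono)
      fix p assume p: "p \<in> P"
      then have gp: "K p > 0" "\<And>x y. x \<in> ?\<Gamma> \<inter> ball p (\<rho> p) \<Longrightarrow> y \<in> ?\<Gamma> \<inter> ball p (\<rho> p) \<Longrightarrow>
         norm (x - y) \<le> K p * (\<Sum>j\<in>UNIV - {i0 p}. \<bar>x $ j - y $ j\<bar>)" using g[of p] P unfolding gr_def by blast+
      have "hausdorff_outer ?s (?\<Gamma> \<inter> cball c h \<inter> ball p (\<rho> p)) \<le> ennreal (hnorm ?s * (K p * ?s * h) ^ (CARD('n) - 1))"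
        by (rule hausdorff_outer_lipschitz_graph[OF _ h gp(1) assms(4), of _ c "i0 p"]) (use gp(2) in auto)
      then show "hausdorff_outer ?s (?\<Gamma> \<inter> cball c h \<inter> ball p (\<rho> p)) \<le> ennreal (B p * h ^ (CARD('n) - 1))"
        by (simp only: B_def power_mult_distrib mult.assoc)
    qed
    also have "\<dots> = ennreal ((\<Sum>p\<in>P. B p) * h ^ (CARD('n) - 1))"
      using B0 h by (subst sum_ennreal) (auto simp: sum_distrib_right)
    also have "\<dots> \<le> ennreal ((1 + (\<Sum>p\<in>P. B p)) * h ^ (CARD('n) - 1))"
      using h by (intro ennreal_leI mult_right_mono) auto
    finally show "hausdorff_outer ?s (?\<Gamma> \<inter> cball c h) \<le> ennreal ((1 + (\<Sum>p\<in>P. B p)) * h ^ (CARD('n) - 1))" .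
  qed
qed

text \<open>Solving for the coordinate with the largest coefficient gives the Lipschitz constant 2
  whatever the orientation of the hyperplane; facets of all meshes thus share one constant.\<close>

lemma hausdorff_outer_hyperplane_le:
  fixes A :: "(real^'n) set"
  assumes "A \<subseteq> cball c h" "h > 0" "a \<noteq> 0" "\<And>x. x \<in> A \<Longrightarrow> a \<bullet> x = b" "CARD('n) \<ge> 2"
  shows "hausdorff_outer (real CARD('n) - 1) A
    \<le> ennreal (hnorm (real CARD('n) - 1) * (2 * (real CARD('n) - 1) * h) ^ (CARD('n) - 1))"
proof -
  have "Max (range (\<lambda>i. \<bar>a $ i\<bar>)) \<in> range (\<lambda>i. \<bar>a $ i\<bar>)" by (intro Max_in) auto
  then obtain i0 where mx: "Max (range (\<lambda>i. \<bar>a $ i\<bar>)) = \<bar>a $ i0\<bar>" by (rule imageE)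
  have i0: "\<bar>a $ i\<bar> \<le> \<bar>a $ i0\<bar>" for i unfolding mx[symmetric] by (rule Max_ge) auto
  have a0: "\<bar>a $ i0\<bar> > 0"
  proof (rule ccontr)
    assume "\<not> ?thesis"
    then have "a = 0" using i0 by (auto simp: vec_eq_iff)
    then show False using assms by simp
  qed
  show ?thesis
  proof (rule hausdorff_outer_lipschitz_graph[OF assms(1,2) _ assms(5), of 2 i0])
    fix x y assume xy: "x \<in> A" "y \<in> A"
    define S where "S = (\<Sum>j\<in>UNIV - {i0}. \<bar>x $ j - y $ j\<bar>)"
    have "0 = a \<bullet> (x - y)" using assms(4) xy by (simp add: inner_diff_right)
    also have "\<dots> = (\<Sum>j\<in>UNIV. a $ j * (x $ j - y $ j))" by (simp add: inner_vec_def)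
    also have "\<dots> = a $ i0 * (x $ i0 - y $ i0) + (\<Sum>j\<in>UNIV - {i0}. a $ j * (x $ j - y $ j))"
      by (rule sum.remove) auto
    finally have "\<bar>a $ i0\<bar> * \<bar>x $ i0 - y $ i0\<bar> = \<bar>\<Sum>j\<in>UNIV - {i0}. a $ j * (x $ j - y $ j)\<bar>"
      by (simp flip: abs_mult)
    also have "\<dots> \<le> (\<Sum>j\<in>UNIV - {i0}. \<bar>a $ j * (x $ j - y $ j)\<bar>)" by (rule sum_abs)
    also have "\<dots> \<le> (\<Sum>j\<in>UNIV - {i0}. \<bar>a $ i0\<bar> * \<bar>x $ j - y $ j\<bar>)"
      unfolding abs_mult by (intro sum_mono mult_right_mono i0) auto
    also have "\<dots> = \<bar>a $ i0\<bar> * S" by (simp add: S_def sum_distrib_left)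
    finally have i: "\<bar>x $ i0 - y $ i0\<bar> \<le> S" using a0 by simp
    have "norm (x - y) \<le> (\<Sum>j\<in>UNIV. \<bar>(x - y) $ j\<bar>)" by (rule norm_le_l1_cart)
    also have "\<dots> = \<bar>(x - y) $ i0\<bar> + (\<Sum>j\<in>UNIV - {i0}. \<bar>(x - y) $ j\<bar>)" by (rule sum.remove) auto
    also have "\<dots> \<le> 2 * S" using i by (simp add: S_def)
    finally show "norm (x - y) \<le> 2 * (\<Sum>j\<in>UNIV - {i0}. \<bar>x $ j - y $ j\<bar>)" by (simp add: S_def)
  qed simp
qed

text \<open>If every active element were cut, the closest point projection would retract the closure of
  the domain onto its boundary.\<close>
lemma uncut_element_exists:
  fixes \<Omega> :: "(real^'n) set"
  assumes "background_mesh M \<Omega> \<sigma>" "cpp_defined M \<Omega>" "open \<Omega>" "bounded \<Omega>" "\<Omega> \<noteq> {}"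
  shows "\<exists>T\<in>active M \<Omega>. T \<subseteq> \<Omega>"
proof (rule ccontr)
  assume c: "\<not> ?thesis"
  let ?\<Gamma> = "frontier \<Omega>"
  have M: "closure \<Omega> \<subseteq> \<Union>M" "\<And>T. T \<in> M \<Longrightarrow> is_simplex T" using assms(1) by (auto simp: background_mesh_def)
  have cut: "T \<inter> ?\<Gamma> \<noteq> {}" if "T \<in> active M \<Omega>" for T
  proof -
    have "T \<in> M" "T \<inter> \<Omega> \<noteq> {}" using that by (auto simp: active_def)
    moreover have "connected T" using M(2)[OF \<open>T \<in> M\<close>] by (auto simp: is_simplex_def intro!: convex_connected)
    moreover have "T - \<Omega> \<noteq> {}" using c that by auto
    ultimately show ?thesis using connected_Int_frontier by blast
  qed
  have cov: "closure \<Omega> \<subseteq> \<Union>(cut_cells M \<Omega>)"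
  proof
    fix x assume x: "x \<in> closure \<Omega>"
    then obtain T where T: "T \<in> M" "x \<in> T" using M by auto
    have "T \<in> cut_cells M \<Omega>"
    proof (cases "x \<in> \<Omega>")
      case True then show ?thesis using T cut[of T] by (auto simp: cut_cells_def active_def)
    next
      case False
      then have "x \<in> ?\<Gamma>" using x assms(3) by (simp add: frontier_def interior_open)
      then show ?thesis using T by (auto simp: cut_cells_def)
    qed
    then show "x \<in> \<Union>(cut_cells M \<Omega>)" using T by blast
  qed
  define f where "f = (\<lambda>x. THE p. p \<in> ?\<Gamma> \<and> dist x p = infdist x ?\<Gamma>)"
  have ex1: "\<exists>!p. p \<in> ?\<Gamma> \<and> dist x p = infdist x ?\<Gamma>" if "x \<in> closure \<Omega>" for x
    using assms(2) cov that unfolding cpp_defined_def by blast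
  have f: "f x \<in> ?\<Gamma> \<and> dist x (f x) = infdist x ?\<Gamma>" if "x \<in> closure \<Omega>" for x
    unfolding f_def by (rule theI'[OF ex1[OF that]])
  \<comment> \<open>Uniqueness of the closest point describes the graph by a closed condition; a
    closed graph with compact range gives continuity.\<close>
  have gr: "(\<lambda>x. (x, f x)) ` closure \<Omega> = {z. dist (fst z) (snd z) = infdist (fst z) ?\<Gamma>} \<inter> (closure \<Omega> \<times> ?\<Gamma>)"
    using f ex1 by force
  have "continuous_on (closure \<Omega>) f"
  proof (rule continuous_from_closed_graph[of ?\<Gamma>])
    show "compact ?\<Gamma>" by (rule compact_frontier_bounded[OF assms(4)])
    show "f \<in> closure \<Omega> \<rightarrow> ?\<Gamma>" using f by auto
    show "closed ((\<lambda>x. (x, f x)) ` closure \<Omega>)"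
      unfolding gr
      by (intro closed_Int closed_Times closed_closure frontier_closed closed_Collect_eq continuous_intros)
  qed
  \<comment> \<open>The no-retraction principle: a map of the closure into the boundary that fixes
    the boundary would force the open set into its own boundary.\<close>
  then have "\<Omega> \<subseteq> ?\<Gamma>"
  proof (rule frontier_subset_retraction[OF assms(4) order_refl])
    show "f \<in> \<Omega> \<rightarrow> ?\<Gamma>" using f closure_subset by blast
    fix x assume x: "x \<in> ?\<Gamma>"
    then have "x \<in> closure \<Omega>" by (simp add: frontier_def)
    then show "f x = x" using ex1[of x] f[of x] x infdist_zero[OF x] by auto
  qed
  then show False using assms(3,5) by (auto simp: frontier_def interior_open)
qed


section \<open>Mesh geometry\<close>

text \<open>The bound \<open>hR\<close> bounds slabs of half-length \<open>R + h\<close>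
  independently of the mesh; it is later obtained from an element inside
  \<open>\<Omega>\<close>.\<close>

locale mesh =
  fixes M :: "(real^'n) set set" and \<Omega> :: "(real^'n) set" and \<sigma> R :: real
  assumes bm: "background_mesh M \<Omega> \<sigma>" and \<sigma>: "\<sigma> > 0" and \<Omega>: "open \<Omega>" "\<Omega> \<subseteq> cball 0 R" "\<Omega> \<noteq> {}"
    and R: "R > 0" and hR: "meshsize M \<le> \<sigma> * R" and d: "CARD('n) \<ge> 2"
begin

abbreviation "h \<equiv> meshsize M"
abbreviation "\<T> \<equiv> active M \<Omega>"
abbreviation "\<F> \<equiv> facet_pairs M \<Omega>"

lemma finite_M [simp]: "finite M" and M_nonempty: "M \<noteq> {}" and M_simplex: "T \<in> M \<Longrightarrow> is_simplex T"
  and M_cover: "closure \<Omega> \<subseteq> \<Union>M"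
  and M_conform: "T \<in> M \<Longrightarrow> T' \<in> M \<Longrightarrow> T \<noteq> T' \<Longrightarrow> T \<inter> T' = convex hull (simplex_verts T \<inter> simplex_verts T')"
  and M_inradius: "T \<in> M \<Longrightarrow> h \<le> \<sigma> * inradius T"
  using bm by (auto simp: background_mesh_def)

lemma active_M: "T \<in> \<T> \<Longrightarrow> T \<in> M" and finite_active [simp]: "finite \<T>"
  by (auto simp: active_def)

lemma finite_facet_pairs [simp]: "finite \<F>"
  by (rule finite_subset[of _ "\<T> \<times> \<T>"]) (auto simp: facet_pairs_def)

lemma \<Omega>_cover: "x \<in> \<Omega> \<Longrightarrow> \<exists>T\<in>\<T>. x \<in> T"
  using M_cover closure_subset[of \<Omega>] by (fastforce simp: active_def)

lemma M_compact: "T \<in> M \<Longrightarrow> compact T" and M_convex: "T \<in> M \<Longrightarrow> convex T"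
  using is_simplex_vertsD[OF M_simplex, of T]
  by (metis compact_convex_hull finite_imp_compact, metis convex_convex_hull)

lemma M_closed: "T \<in> M \<Longrightarrow> closed T" and M_bounded: "T \<in> M \<Longrightarrow> bounded T"
  using M_compact compact_imp_closed compact_imp_bounded by auto

lemma M_borel: "T \<in> M \<Longrightarrow> T \<in> sets borel" and \<Omega>_borel: "\<Omega> \<in> sets borel"
  using M_closed \<Omega> by auto

lemma M_dist: "T \<in> M \<Longrightarrow> x \<in> T \<Longrightarrow> y \<in> T \<Longrightarrow> dist x y \<le> h"
proof -
  assume T: "T \<in> M" "x \<in> T" "y \<in> T"
  have "dist x y \<le> diameter T" using T M_bounded diameter_bounded_bound by blast
  also have "\<dots> \<le> h" unfolding meshsize_def using T by (intro Max_ge) auto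
  finally show ?thesis .
qed

lemma h_pos: "h > 0"
proof -
  obtain T where T: "T \<in> M" using M_nonempty by auto
  note V = is_simplex_vertsD[OF M_simplex[OF T]]
  have "simplex_verts T \<noteq> {}" using V(2) by auto
  then obtain x where x: "x \<in> simplex_verts T" by blast
  have "simplex_verts T \<noteq> {x}" using V(2) d by auto
  then obtain y where "y \<in> simplex_verts T" "x \<noteq> y" using x by blast
  moreover have "simplex_verts T \<subseteq> T" using V(4) hull_subset by metis
  ultimately show ?thesis using M_dist[OF T, of x y] x by (meson less_le_trans subsetD zero_less_dist_iff)
qed

text \<open>Half of the inradius bound \<open>h / \<sigma>\<close>: strictly below the supremum
  \<open>inradius T\<close>, hence realised by an actual ball, even a closed one.\<close>

definition r :: real where "r = h / (2 * \<sigma>)"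

lemma r_pos: "r > 0" and h_eq_r: "h = 2 * \<sigma> * r"
  using h_pos \<sigma> by (auto simp: r_def)

lemma inscribed_ball: "T \<in> M \<Longrightarrow> \<exists>c. cball c r \<subseteq> T \<and> T \<subseteq> cball c h"
proof -
  assume T: "T \<in> M"
  have "h / \<sigma> \<le> inradius T" using M_inradius[OF T] \<sigma> by (simp add: divide_le_eq mult.commute)
  moreover have "r < h / \<sigma>" using r_pos \<sigma> by (simp add: h_eq_r)
  ultimately have lt: "r < Sup {r. \<exists>c. ball c r \<subseteq> T}" by (simp add: inradius_def)
  have "0 \<in> {r. \<exists>c. ball c r \<subseteq> T}" by simp
  then have ne: "{r. \<exists>c. ball c r \<subseteq> T} \<noteq> {}" by blast
  from less_cSupD[OF ne lt] obtain r' where r': "r' \<in> {r. \<exists>c. ball c r \<subseteq> T}" "r < r'" by (rule bexE)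
  then obtain c where c: "ball c r' \<subseteq> T" by auto
  have sub: "cball c r \<subseteq> T" using c r' by auto
  then have "c \<in> T" using r_pos by auto
  then have "T \<subseteq> cball c h" using M_dist[OF T] by auto
  with sub show ?thesis by blast
qed

definition ctr :: "(real^'n) set \<Rightarrow> real^'n" where
  "ctr T = (SOME c. cball c r \<subseteq> T \<and> T \<subseteq> cball c h)"

lemma ctr_inner: "T \<in> M \<Longrightarrow> cball (ctr T) r \<subseteq> T" and ctr_outer: "T \<in> M \<Longrightarrow> T \<subseteq> cball (ctr T) h"
  unfolding ctr_def using someI_ex[OF inscribed_ball] by blast+

text \<open>Distinct simplices have distinct vertex sets of \<open>CARD('n) + 1\<close> points, so
  by conformity their intersection is spanned by at most \<open>CARD('n)\<close> of them.\<close>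

lemma Int_aff_dim_less:
  assumes "T \<in> M" "T' \<in> M" "T \<noteq> T'" shows "aff_dim (T \<inter> T') < int CARD('n)"
proof -
  let ?S = "simplex_verts T \<inter> simplex_verts T'"
  note V = is_simplex_vertsD[OF M_simplex[OF assms(1)]] and V' = is_simplex_vertsD[OF M_simplex[OF assms(2)]]
  have "simplex_verts T \<noteq> simplex_verts T'" using V(4) V'(4) assms(3) by metis
  then have "?S \<noteq> simplex_verts T"
    using V(1,2) V'(1,2) by (metis card_subset_eq inf.cobounded2)
  then have "card ?S < CARD('n) + 1"
    using V(1,2) by (metis inf_le1 psubsetI psubset_card_mono)
  moreover have "aff_dim (convex hull ?S) \<le> int (card ?S) - 1"
    unfolding aff_dim_convex_hull using V(1) by (intro aff_dim_le_card) auto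
  ultimately show ?thesis unfolding M_conform[OF assms] by simp
qed

lemma Int_hyperplane:
  assumes "T \<in> M" "T' \<in> M" "T \<noteq> T'" shows "\<exists>a b. a \<noteq> 0 \<and> T \<inter> T' \<subseteq> {x. a \<bullet> x = b}"
  using aff_lowdim_subset_hyperplane[of "T \<inter> T'"] Int_aff_dim_less[OF assms] by (metis DIM_cart DIM_real mult.right_neutral)

lemma Int_negligible:
  assumes "T \<in> M" "T' \<in> M" "T \<noteq> T'" shows "negligible (T \<inter> T')"
  using Int_hyperplane[OF assms] negligible_hyperplane negligible_subset by metis

text \<open>A packing argument: the elements overlap only in null sets and each contains a ball of
  radius \<open>r\<close>.\<close>

lemma card_mult_volume_le:
  assumes "F \<subseteq> M" "\<And>T. T \<in> F \<Longrightarrow> T \<subseteq> B" "B \<in> lmeasurable"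
  shows "real (card F) * (unit_ball_vol (real CARD('n)) * r ^ CARD('n)) \<le> measure lebesgue B"
proof -
  have fin: "finite F" using assms(1) finite_subset finite_M by blast
  have "real (card F) * (unit_ball_vol (real CARD('n)) * r ^ CARD('n)) = (\<Sum>T\<in>F. measure lebesgue (cball (ctr T) r))"
    using r_pos by (simp only: measure_lebesgue_cball[OF less_imp_le] sum_constant)
  also have "\<dots> \<le> (\<Sum>T\<in>F. measure lebesgue T)"
    using assms(1) ctr_inner M_compact by (intro sum_mono measure_mono_fmeasurable) (auto intro!: lmeasurable_compact)
  also have "\<dots> = measure lebesgue (\<Union>F)"
  proof (rule measure_negligible_finite_Union[OF fin, symmetric])
    show "S \<in> lmeasurable" if "S \<in> F" for S
      using assms(1) that M_compact by (intro lmeasurable_compact) auto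
    show "pairwise (\<lambda>S T. negligible (S \<inter> T)) F"
      using assms(1) by (intro pairwiseI Int_negligible) auto
  qed
  also have "\<dots> \<le> measure lebesgue B"
  proof (rule measure_mono_fmeasurable)
    have "compact (\<Union>F)" using fin assms(1) M_compact by (intro compact_Union) auto
    then show "\<Union>F \<in> sets lebesgue" by (intro fmeasurableD lmeasurable_compact)
  qed (use assms in auto)
  finally show ?thesis .
qed

text \<open>Packing in a ball of radius \<open>2 * h\<close>, where
  \<open>2 * h / r = 4 * \<sigma>\<close>.\<close>

lemma card_neighbours_le:
  assumes "T \<in> M" shows "real (card {T'\<in>M. T \<inter> T' \<noteq> {}}) \<le> (4 * \<sigma>) ^ CARD('n)"
proof -
  have "T' \<subseteq> cball (ctr T) (2 * h)" if T': "T' \<in> M" "T \<inter> T' \<noteq> {}" for T'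
  proof
    fix y assume y: "y \<in> T'"
    obtain z where "z \<in> T" "z \<in> T'" using T' by auto
    then have "dist (ctr T) z \<le> h" "dist z y \<le> h" using ctr_outer[OF assms] M_dist[OF T'(1)] y by auto
    then show "y \<in> cball (ctr T) (2 * h)" using dist_triangle[of "ctr T" y z] by simp
  qed
  then have "real (card {T'\<in>M. T \<inter> T' \<noteq> {}}) * (unit_ball_vol (real CARD('n)) * r ^ CARD('n))
     \<le> measure lebesgue (cball (ctr T) (2 * h))"
    by (intro card_mult_volume_le) auto
  also have "\<dots> = unit_ball_vol (real CARD('n)) * (2 * h) ^ CARD('n)"
    using h_pos by (intro measure_lebesgue_cball) auto
  also have "2 * h = 4 * \<sigma> * r" by (simp add: h_eq_r)
  also have "unit_ball_vol (real CARD('n)) * (4 * \<sigma> * r) ^ CARD('n) = (4 * \<sigma>) ^ CARD('n) * (unit_ball_vol (real CARD('n)) * r ^ CARD('n))"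
    by (simp add: power_mult_distrib)
  finally show ?thesis using r_pos by (simp add: mult_le_cancel_right)
qed

definition line_const :: real where
  "line_const = 2 * (R + \<sigma> * R) * 2 ^ (CARD('n) - 1) * (2 * \<sigma>) ^ CARD('n) / unit_ball_vol (real CARD('n))"

text \<open>The elements met by the line lie in a slab of volume of order
  \<open>h ^ (CARD('n) - 1)\<close> while each has volume of order \<open>h ^ CARD('n)\<close>; the
  quotient is of order \<open>1 / h\<close>.\<close>

lemma card_line_le:
  "real (card {T\<in>\<T>. \<exists>t. x + t *\<^sub>R axis i0 1 \<in> T}) \<le> line_const / h"
proof -
  define B where "B = {y. (\<forall>j. j \<noteq> i0 \<longrightarrow> \<bar>y $ j - x $ j\<bar> \<le> h) \<and> \<bar>y $ i0\<bar> \<le> R + h}"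
  let ?F = "{T\<in>\<T>. \<exists>t. x + t *\<^sub>R axis i0 1 \<in> T}"
  have "T \<subseteq> B" if T: "T \<in> \<T>" "x + t *\<^sub>R axis i0 1 \<in> T" for T t
  proof
    fix y assume y: "y \<in> T"
    have "\<bar>y $ j - x $ j\<bar> \<le> h" if "j \<noteq> i0" for j
    proof -
      have "\<bar>(y - (x + t *\<^sub>R axis i0 1)) $ j\<bar> \<le> norm (y - (x + t *\<^sub>R axis i0 1))" by (rule component_le_norm_cart)
      also have "\<dots> \<le> h" using M_dist[OF active_M[OF T(1)] y T(2)] by (simp add: dist_norm)
      finally show ?thesis using that by (simp add: axis_def)
    qed
    moreover obtain z where z: "z \<in> T" "z \<in> \<Omega>" using T by (auto simp: active_def)
    have "\<bar>y $ i0\<bar> \<le> norm y" by (rule component_le_norm_cart)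
    moreover have "norm y \<le> norm z + dist y z" using norm_triangle_ineq[of z "y - z"] by (simp add: dist_norm)
    moreover have "norm z \<le> R" using z \<Omega> by auto
    moreover have "dist y z \<le> h" using M_dist[OF active_M[OF T(1)] y z(1)] .
    ultimately show "y \<in> B" unfolding B_def by auto
  qed
  moreover have "B \<in> sets borel" "emeasure lborel B = ennreal (2 * (R + h) * (2 * h) ^ (CARD('n) - 1))"
    unfolding B_def using h_pos R by (intro borel_slab_box emeasure_lborel_slab_box; simp)+
  moreover from this have "B \<in> lmeasurable" by (intro fmeasurableI) auto
  ultimately have "real (card ?F) * (unit_ball_vol (real CARD('n)) * r ^ CARD('n)) \<le> measure lebesgue B"
    by (intro card_mult_volume_le) (auto simp: active_M)
  also have "\<dots> = 2 * (R + h) * (2 * h) ^ (CARD('n) - 1)"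
    using \<open>B \<in> sets borel\<close> \<open>emeasure lborel B = _\<close> h_pos R by (simp add: measure_def)
  also have "\<dots> \<le> 2 * (R + \<sigma> * R) * (2 * h) ^ (CARD('n) - 1)"
    using hR h_pos by (intro mult_right_mono mult_left_mono) auto
  finally have "real (card ?F) * (unit_ball_vol (real CARD('n)) * r ^ CARD('n)) * h \<le> 2 * (R + \<sigma> * R) * (2 * h) ^ (CARD('n) - 1) * h"
    using h_pos by (intro mult_right_mono) auto
  also have "\<dots> = 2 * (R + \<sigma> * R) * 2 ^ (CARD('n) - 1) * (h ^ (CARD('n) - 1) * h)"
    by (simp add: power_mult_distrib)
  also have "h ^ (CARD('n) - 1) * h = h ^ CARD('n)" using d by (metis One_nat_def Suc_diff_le Suc_le_lessD diff_Suc_Suc diff_zero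
        le_add2 less_or_eq_imp_le one_add_one order_trans plus_1_eq_Suc power_Suc2)
  also have "h ^ CARD('n) = (2 * \<sigma>) ^ CARD('n) * r ^ CARD('n)" by (simp add: h_eq_r power_mult_distrib)
  finally have "real (card ?F) * h * (unit_ball_vol (real CARD('n)) * r ^ CARD('n))
     \<le> line_const * (unit_ball_vol (real CARD('n)) * r ^ CARD('n))"
    by (simp add: line_const_def mult_ac)
  then have "real (card ?F) * h \<le> line_const" using r_pos by (simp add: mult_le_cancel_right)
  then show ?thesis using h_pos by (simp add: pos_le_divide_eq)
qed

lemma line_const_pos: "line_const > 0"
  unfolding line_const_def using R \<sigma> by (auto intro!: divide_pos_pos mult_pos_pos add_pos_pos)

definition facet_const :: real where
  "facet_const = hnorm (real CARD('n) - 1) * (2 * (real CARD('n) - 1)) ^ (CARD('n) - 1)"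

lemma facet_pairsD:
  assumes "(T, T') \<in> \<F>"
  shows "T \<in> M" "T' \<in> M" "T \<noteq> T'" "T \<in> \<T>" "T' \<in> \<T>" "T \<inter> T' \<noteq> {}"
  using assms active_M d by (auto simp: facet_pairs_def)

lemma hausdorff_facet_le:
  assumes "(T, T') \<in> \<F>"
  shows "emeasure (haus (real CARD('n) - 1)) (T \<inter> T' \<inter> \<Omega>) \<le> ennreal (facet_const * h ^ (CARD('n) - 1))"
proof -
  note T = facet_pairsD[OF assms]
  obtain a b where ab: "a \<noteq> 0" "T \<inter> T' \<subseteq> {x. a \<bullet> x = b}" using Int_hyperplane[OF T(1-3)] by blast
  have "hausdorff_outer (real CARD('n) - 1) (T \<inter> T' \<inter> \<Omega>)
    \<le> ennreal (hnorm (real CARD('n) - 1) * (2 * (real CARD('n) - 1) * h) ^ (CARD('n) - 1))"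
    by (rule hausdorff_outer_hyperplane_le[of _ "ctr T" h a b]) (use ab ctr_outer[OF T(1)] h_pos d in auto)
  then show ?thesis using M_borel T \<Omega>_borel
    by (simp add: emeasure_haus facet_const_def power_mult_distrib mult.assoc)
qed

section \<open>Generic lines in a coordinate direction\<close>

definition sweep :: "'n \<Rightarrow> (real^'n) set \<Rightarrow> (real^'n) set" where
  "sweep i0 A = {p + t *\<^sub>R axis i0 1 | p t. p \<in> A}"

text \<open>Collecting exactly the intersections with negligible sweep makes this a null set at
  once; the geometric content, that every other intersection is a transversal facet, moves to
  \<open>generic_crossing\<close>.\<close>

definition bad_lines :: "'n \<Rightarrow> (real^'n) set" where
  "bad_lines i0 = (\<Union>{sweep i0 (T \<inter> T') | T T'. T \<in> M \<and> T' \<in> M \<and> T \<noteq> T' \<and> negligible (sweep i0 (T \<inter> T'))})"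

lemma negligible_bad_lines: "negligible (bad_lines i0)"
  unfolding bad_lines_def
proof (rule negligible_Union)
  have "{sweep i0 (T \<inter> T') | T T'. T \<in> M \<and> T' \<in> M \<and> T \<noteq> T' \<and> negligible (sweep i0 (T \<inter> T'))}
    \<subseteq> (\<lambda>(T, T'). sweep i0 (T \<inter> T')) ` (M \<times> M)" by auto
  then show "finite {sweep i0 (T \<inter> T') | T T'. T \<in> M \<and> T' \<in> M \<and> T \<noteq> T' \<and> negligible (sweep i0 (T \<inter> T'))}"
    by (rule finite_subset) auto
qed auto

text \<open>Sweeping adds at most one dimension, so a set of dimension below
  \<open>CARD('n) - 1\<close> stays inside a proper affine subspace.\<close>

lemma negligible_sweep:
  assumes "aff_dim A < int CARD('n) - 1" shows "negligible (sweep i0 A)"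
proof (cases "A = {}")
  case False
  then obtain p0 where p0: "p0 \<in> A" by auto
  let ?D = "(\<lambda>x. - p0 + x) ` A" and ?e = "axis i0 (1::real)"
  have "aff_dim A = int (dim ?D)" using p0 by (intro aff_dim_eq_dim hull_inc)
  then have "dim (insert ?e ?D) < CARD('n)" using assms dim_insert[of ?e ?D] by (auto split: if_splits)
  then have "dim (span (insert ?e ?D)) < DIM(real^'n)" by simp
  then have "negligible (span (insert ?e ?D))" by (rule negligible_lowdim)
  then have "negligible ((+) p0 ` span (insert ?e ?D))" by (rule negligible_translation)
  moreover have "sweep i0 A \<subseteq> (+) p0 ` span (insert ?e ?D)"
  proof
    fix y assume "y \<in> sweep i0 A"
    then obtain p t where y: "y = p + t *\<^sub>R ?e" "p \<in> A" by (auto simp: sweep_def)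
    have "(- p0 + p) + t *\<^sub>R ?e \<in> span (insert ?e ?D)"
      using y(2) by (intro span_add span_scale span_base) auto
    moreover have "y = p0 + ((- p0 + p) + t *\<^sub>R ?e)" using y by simp
    ultimately show "y \<in> (+) p0 ` span (insert ?e ?D)" by blast
  qed
  ultimately show ?thesis by (rule negligible_subset)
qed (simp add: sweep_def)

text \<open>Off \<open>bad_lines\<close> the sweep of the intersection is not negligible.
  Lower-dimensional faces are then excluded, and so are facets parallel to the axis, whose sweep
  stays in their own hyperplane.\<close>

lemma generic_crossing:
  assumes "x \<notin> bad_lines i0" "x + t *\<^sub>R axis i0 1 \<in> T \<inter> T'" "T \<in> \<T>" "T' \<in> \<T>" "T \<noteq> T'"
  shows "(T, T') \<in> \<F>" "T \<inter> T' \<subseteq> {x. a \<bullet> x = b} \<Longrightarrow> a \<noteq> 0 \<Longrightarrow> a $ i0 \<noteq> 0"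
proof -
  have "x = (x + t *\<^sub>R axis i0 1) + (- t) *\<^sub>R axis i0 1" by simp
  then have "x \<in> sweep i0 (T \<inter> T')" using assms(2) unfolding sweep_def by blast
  then have n: "\<not> negligible (sweep i0 (T \<inter> T'))"
    using assms active_M unfolding bad_lines_def by blast
  then have "\<not> aff_dim (T \<inter> T') < int CARD('n) - 1" using negligible_sweep by blast
  then have "aff_dim (T \<inter> T') = int CARD('n) - 1"
    using Int_aff_dim_less[of T T'] assms active_M by force
  then show "(T, T') \<in> \<F>" using assms by (simp add: facet_pairs_def)
  assume ab: "T \<inter> T' \<subseteq> {x. a \<bullet> x = b}" "a \<noteq> 0"
  show "a $ i0 \<noteq> 0"
  proof
    assume "a $ i0 = 0"
    then have "sweep i0 (T \<inter> T') \<subseteq> {x. a \<bullet> x = b}"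
      using ab(1) by (auto simp: sweep_def inner_add_right inner_axis)
    then show False using n negligible_hyperplane[of a b] ab(2) negligible_subset by blast
  qed
qed

text \<open>Points of the line just after \<open>z\<close> lie in finitely many elements, so one
  element contains infinitely many of them and, being closed, also \<open>z\<close>.\<close>

lemma next_element:
  assumes "z \<in> \<Omega>"
  shows "\<exists>T'\<in>\<T>. z \<in> T' \<and> (\<exists>s>0. z + s *\<^sub>R axis i0 1 \<in> T')"
proof -
  let ?e = "axis i0 (1::real)"
  obtain \<delta> where \<delta>: "\<delta> > 0" "ball z \<delta> \<subseteq> \<Omega>" using \<Omega>(1) assms open_contains_ball by blast
  define s where "s = (\<lambda>n::nat. \<delta> / (real n + 2))"
  have s: "s n > 0" "s n < \<delta>" for n
  proof -
    show "s n > 0" using \<delta> by (simp add: s_def)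
    have "\<delta> / (real n + 2) < \<delta> / 1" using \<delta> by (intro divide_strict_left_mono) auto
    then show "s n < \<delta>" by (simp add: s_def)
  qed
  have "z + s n *\<^sub>R ?e \<in> \<Omega>" for n
    using \<delta>(2) s[of n] by (intro subsetD[OF \<delta>(2)]) (simp add: dist_norm)
  then have "\<forall>n. \<exists>T. T \<in> \<T> \<and> z + s n *\<^sub>R ?e \<in> T" using \<Omega>_cover by blast
  then obtain T where T: "\<And>n. T n \<in> \<T> \<and> z + s n *\<^sub>R ?e \<in> T n" by metis
  have "\<exists>n0\<in>UNIV. infinite {n\<in>UNIV. T n = T n0}"
    by (rule pigeonhole_infinite) (auto intro: finite_subset[of _ \<T>] simp: T)
  then obtain n0 where inf: "infinite {n. T n = T n0}" by auto
  have "z \<in> T n0"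
  proof (rule ccontr)
    assume "z \<notin> T n0"
    moreover have "open (- T n0)" using M_closed T active_M by (simp add: open_Compl)
    ultimately obtain \<epsilon> where \<epsilon>: "\<epsilon> > 0" "ball z \<epsilon> \<subseteq> - T n0" using open_contains_ball by blast
    obtain m :: nat where m: "\<delta> / \<epsilon> < real m" using reals_Archimedean2 by blast
    obtain n where n: "n > m" "T n = T n0" using inf unfolding infinite_nat_iff_unbounded by auto
    have "\<delta> < \<epsilon> * real n" using m n(1) \<epsilon> by (simp add: pos_divide_less_eq mult.commute)
      (smt (verit) mult_strict_left_mono of_nat_less_iff)
    then have "s n < \<epsilon>" using \<epsilon> unfolding s_def by (simp add: pos_divide_less_eq distrib_left)
    then have "z + s n *\<^sub>R ?e \<in> ball z \<epsilon>" using s[of n] by (simp add: dist_norm)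
    then show False using \<epsilon>(2) T[of n] n(2) by auto
  qed
  then show ?thesis using T[of n0] s[of n0] by blast
qed

text \<open>Follow the line from element to element. The induction is on the number of elements that the line leaves later.\<close>
lemma walk_bound:
  fixes v :: "(real^'n) set \<Rightarrow> real^'n \<Rightarrow> real" and x :: "real^'n" and i0 :: 'n
  defines "e \<equiv> axis i0 (1::real)"
  assumes x: "x \<notin> bad_lines i0"
    and \<tau>: "\<And>t. 0 \<le> t \<Longrightarrow> t < \<tau> \<Longrightarrow> x + t *\<^sub>R e \<in> \<Omega>"
    and osc: "\<And>T y z. T \<in> \<T> \<Longrightarrow> y \<in> T \<Longrightarrow> z \<in> T \<Longrightarrow> \<bar>v T y - v T z\<bar> \<le> osc T"
    and jmp: "\<And>T T' t. (T, T') \<in> \<F> \<Longrightarrow> 0 \<le> t \<Longrightarrow> t < \<tau> \<Longrightarrow> x + t *\<^sub>R e \<in> T \<inter> T' \<inter> \<Omega> \<Longrightarrow>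
       \<bar>v T (x + t *\<^sub>R e) - v T' (x + t *\<^sub>R e)\<bar> \<le> jmp (T, T')"
    and ext: "\<And>T. T \<in> \<T> \<Longrightarrow> x + \<tau> *\<^sub>R e \<in> T \<Longrightarrow> \<bar>v T (x + \<tau> *\<^sub>R e)\<bar> \<le> ext T"
    and nonneg: "\<And>T. osc T \<ge> 0" "\<And>F. jmp F \<ge> 0" "\<And>T. ext T \<ge> 0"
    and T: "T \<in> \<T>" "x + t *\<^sub>R e \<in> T" "0 \<le> t" "t \<le> \<tau>"
  shows "\<bar>v T (x + t *\<^sub>R e)\<bar> \<le> (\<Sum>T\<in>{T\<in>\<T>. \<exists>t. x + t *\<^sub>R e \<in> T}. osc T + (\<Sum>T'\<in>{T'. (T, T') \<in> \<F>}. jmp (T, T')) + ext T)"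
proof -
  define A where "A = {T\<in>\<T>. \<exists>t. x + t *\<^sub>R e \<in> T}"
  define K where "K = (\<lambda>T. osc T + (\<Sum>T'\<in>{T'. (T, T') \<in> \<F>}. jmp (T, T')) + ext T)"
  have K0: "K T \<ge> 0" for T unfolding K_def using nonneg by (intro add_nonneg_nonneg sum_nonneg) auto
  have finA: "finite A" unfolding A_def by simp
  have finF: "finite {T'. (T, T') \<in> \<F>}" for T
    by (rule finite_subset[of _ \<T>]) (auto dest: facet_pairsD)
  \<comment> \<open>The last parameter at which the line is in \<open>T\<close> exists because
    \<open>T\<close> is closed and bounded; it orders the elements along the line.\<close>
  have "\<exists>b. x + b *\<^sub>R e \<in> T \<and> (\<forall>t. x + t *\<^sub>R e \<in> T \<longrightarrow> t \<le> b)" if TA: "T \<in> A" for T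
  proof -
    have TM: "T \<in> M" using TA active_M by (auto simp: A_def)
    have "closed {t. x + t *\<^sub>R e \<in> T}"
      using continuous_closed_vimage[OF M_closed[OF TM], of "\<lambda>t. x + t *\<^sub>R e"] by (simp add: vimage_def)
    moreover obtain t0 where t0: "x + t0 *\<^sub>R e \<in> T" using TA by (auto simp: A_def)
    moreover have "t \<le> t0 + h" if "x + t *\<^sub>R e \<in> T" for t
    proof -
      have "\<bar>t - t0\<bar> = dist (x + t *\<^sub>R e) (x + t0 *\<^sub>R e)"
        by (simp add: dist_norm e_def flip: scaleR_diff_left)
      then show ?thesis using M_dist[OF TM that t0] by linarith
    qed
    then have "bdd_above {t. x + t *\<^sub>R e \<in> T}" by (intro bdd_aboveI[of _ "t0 + h"]) auto
    ultimately have "Sup {t. x + t *\<^sub>R e \<in> T} \<in> {t. x + t *\<^sub>R e \<in> T}"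
      by (intro closed_contains_Sup) auto
    then show ?thesis using \<open>bdd_above _\<close> by (intro exI[of _ "Sup {t. x + t *\<^sub>R e \<in> T}"]) (auto intro: cSup_upper)
  qed
  then obtain b where b: "\<And>T. T \<in> A \<Longrightarrow> x + b T *\<^sub>R e \<in> T" "\<And>T t. T \<in> A \<Longrightarrow> x + t *\<^sub>R e \<in> T \<Longrightarrow> t \<le> b T"
    by metis
  \<comment> \<open>Only elements left no earlier than \<open>T\<close> occur on the right; this
    makes room for \<open>K T\<close> when the hypothesis is applied to the next element.\<close>
  have main: "\<bar>v T (x + t *\<^sub>R e)\<bar> \<le> (\<Sum>S\<in>{S\<in>A. b T \<le> b S}. K S)"
    if "T \<in> A" "x + t *\<^sub>R e \<in> T" "0 \<le> t" "t \<le> \<tau>" for T t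
    using that
  proof (induction "card {S\<in>A. b T < b S}" arbitrary: T t rule: less_induct)
    case less
    have TT: "T \<in> \<T>" "T \<in> M" using less.prems active_M by (auto simp: A_def)
    have tb: "t \<le> b T" using b(2) less.prems by blast
    have KT: "K T + (\<Sum>S\<in>X. K S) \<le> (\<Sum>S\<in>{S\<in>A. b T \<le> b S}. K S)"
      if "X \<subseteq> {S\<in>A. b T \<le> b S}" "T \<notin> X" for X
    proof -
      have "K T + (\<Sum>S\<in>X. K S) = (\<Sum>S\<in>insert T X. K S)"
        using that finA finite_subset[of X A] by (subst sum.insert) auto
      also have "\<dots> \<le> (\<Sum>S\<in>{S\<in>A. b T \<le> b S}. K S)"
        using that less.prems finA K0 by (intro sum_mono2) auto
      finally show ?thesis .
    qed
    show ?case
    proof (cases "\<tau> \<le> b T")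
      case True
      \<comment> \<open>The exit parameter lies between \<open>t\<close> and \<open>b T\<close>, so
        convexity puts the exit point into \<open>T\<close>.\<close>
      have "x + \<tau> *\<^sub>R e \<in> T"
      proof (cases "t = b T")
        case False
        define u where "u = (\<tau> - t) / (b T - t)"
        have u: "0 \<le> u" "u \<le> 1" using True False tb less.prems by (auto simp: u_def divide_le_eq_1)
        have "u * (b T - t) = \<tau> - t" using False tb by (simp add: u_def)
        then have "(1 - u) *\<^sub>R (x + t *\<^sub>R e) + u *\<^sub>R (x + b T *\<^sub>R e) = x + \<tau> *\<^sub>R e"
          by (simp add: algebra_simps flip: scaleR_add_left)
        then show ?thesis using convexD_alt[OF M_convex[OF TT(2)] less.prems(2) b(1)[OF less.prems(1)] u] by simp
      qed (use True less.prems tb in auto)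
      then have "\<bar>v T (x + t *\<^sub>R e)\<bar> \<le> osc T + ext T"
        using osc[OF TT(1) less.prems(2), of "x + \<tau> *\<^sub>R e"] ext[OF TT(1)] by linarith
      also have "\<dots> \<le> K T" unfolding K_def using nonneg by (simp add: sum_nonneg)
      finally show ?thesis using KT[of "{}"] by simp
    next
      case False
      \<comment> \<open>The line leaves \<open>T\<close> at a point inside \<open>\<Omega>\<close>.
        An element that contains a further piece of the line is left strictly later, hence differs
        from \<open>T\<close> and is closer to the end of the induction.\<close>
      define z where "z = x + b T *\<^sub>R e"
      have zT: "z \<in> T" using b less.prems by (simp add: z_def)
      have bt: "0 \<le> b T" "b T < \<tau>" using False tb less.prems by auto
      have z\<Omega>: "z \<in> \<Omega>" using \<tau>[OF bt] by (simp add: z_def)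
      obtain T' s where T': "T' \<in> \<T>" "z \<in> T'" "s > 0" "z + s *\<^sub>R e \<in> T'"
        using next_element[OF z\<Omega>, of i0] unfolding e_def by blast
      have zs: "z + s *\<^sub>R e = x + (b T + s) *\<^sub>R e" by (simp add: z_def scaleR_add_left)
      have T'A: "T' \<in> A" unfolding A_def using T' zs by auto
      have "b T + s \<le> b T'" using b(2)[OF T'A, of "b T + s"] T'(4) zs by simp
      then have bb: "b T < b T'" using T' by simp
      then have ne: "T \<noteq> T'" by auto
      have F: "(T, T') \<in> \<F>"
        using generic_crossing(1)[OF x, of "b T" T T'] zT T' TT ne by (simp add: z_def e_def)
      have "card {S\<in>A. b T' < b S} < card {S\<in>A. b T < b S}"
        using finA bb T'A by (intro psubset_card_mono) auto
      from less.hyps[OF this T'A, of "b T"] have IH: "\<bar>v T' z\<bar> \<le> (\<Sum>S\<in>{S\<in>A. b T' \<le> b S}. K S)"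
        using T' bt by (simp add: z_def)
      have "\<bar>v T z - v T' z\<bar> \<le> jmp (T, T')"
        using jmp[OF F bt] zT T' z\<Omega> by (simp add: z_def)
      also have "\<dots> \<le> (\<Sum>T'\<in>{T'. (T, T') \<in> \<F>}. jmp (T, T'))"
        by (rule member_le_sum) (use F nonneg finF in auto)
      finally have "\<bar>v T (x + t *\<^sub>R e)\<bar> \<le> osc T + (\<Sum>T'\<in>{T'. (T, T') \<in> \<F>}. jmp (T, T')) + \<bar>v T' z\<bar>"
        using osc[OF TT(1) less.prems(2) zT] by linarith
      also have "\<dots> \<le> K T + (\<Sum>S\<in>{S\<in>A. b T' \<le> b S}. K S)"
        using IH nonneg(3)[of T] by (simp add: K_def)
      also have "\<dots> \<le> (\<Sum>S\<in>{S\<in>A. b T \<le> b S}. K S)"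
        by (rule KT) (use bb in auto)
      finally show ?thesis .
    qed
  qed
  have "T \<in> A" using T by (auto simp: A_def)
  from main[OF this T(2-4)] have "\<bar>v T (x + t *\<^sub>R e)\<bar> \<le> (\<Sum>S\<in>{S\<in>A. b T \<le> b S}. K S)" .
  also have "\<dots> \<le> (\<Sum>S\<in>A. K S)" by (rule sum_mono2) (use finA K0 in auto)
  finally show ?thesis unfolding A_def K_def .
qed

end


section \<open>The bilinear form\<close>

lemma continuous_integrable_lborel:
  fixes f :: "real^'n \<Rightarrow> real"
  assumes "continuous_on UNIV f" "S \<in> sets borel" "bounded S"
  shows "set_integrable lborel S f" "f integrable_on S" "integral S f = set_lebesgue_integral lborel S f"
proof -
  obtain a where a: "S \<subseteq> cbox (- a) a" using assms(3) bounded_subset_cbox_symmetric by blast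
  have "integrable lborel (\<lambda>x. indicator (cbox (- a) a) x *\<^sub>R f x)"
    by (rule borel_integrable_compact) (use assms(1) continuous_on_subset in auto)
  then have "set_integrable lborel (cbox (- a) a) f" by (simp add: set_integrable_def)
  then show s: "set_integrable lborel S f"
    by (rule set_integrable_subset) (use a assms in auto)
  from set_borel_integral_eq_integral[OF s]
  show "f integrable_on S" "integral S f = set_lebesgue_integral lborel S f" by auto
qed

text \<open>\<open>K\<close> is kept apart from \<open>A\<close> because a facet part
  \<open>T \<inter> T' \<inter> \<Omega>\<close> is in general not compact: boundedness of
  \<open>f\<close> comes from \<open>K\<close>, finiteness from the measure of
  \<open>A\<close>.\<close>

lemma set_integrable_haus:
  fixes f :: "real^'n \<Rightarrow> real"
  assumes "compact K" "continuous_on K f" "A \<subseteq> K" "A \<in> sets borel" "emeasure (haus s) A < \<infinity>"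
  shows "set_integrable (haus s) A f"
proof -
  have "bounded (f ` K)" using assms by (intro compact_imp_bounded compact_continuous_image)
  then obtain B where B: "\<And>y. y \<in> f ` K \<Longrightarrow> norm y \<le> B" unfolding bounded_iff by blast
  show ?thesis unfolding set_integrable_def
  proof (rule integrableI_bounded_set[where A=A and B=B])
    show "(\<lambda>x. indicator A x *\<^sub>R f x) \<in> borel_measurable (haus s)"
      using borel_measurable_continuous_on_indicator[OF assms(4) continuous_on_subset[OF assms(2,3)]]
      by (simp add: measurable_cong_sets[OF sets_haus refl])
    show "AE x in haus s. x \<in> A \<longrightarrow> norm (indicator A x *\<^sub>R f x) \<le> B"
      using B assms(3) by (intro AE_I2) auto
  qed (use assms in auto)
qed

text \<open>For a non-integrable \<open>f\<close> the Bochner integral is 0 by convention, so the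
  bound holds in both cases.\<close>

lemma abs_surf_int_le:
  assumes "A \<in> sets borel" "emeasure (haus s) A \<le> ennreal m" "0 \<le> m" "0 \<le> B" "\<And>x. x \<in> A \<Longrightarrow> \<bar>f x\<bar> \<le> B"
  shows "\<bar>surf_int s A f\<bar> \<le> B * m"
proof (cases "set_integrable (haus s) A f")
  case True
  have fin: "emeasure (haus s) A < \<infinity>" using assms(2) by (auto intro: le_less_trans)
  have "\<bar>surf_int s A f\<bar> \<le> (LINT x|haus s. norm (indicator A x *\<^sub>R f x))"
    unfolding surf_int_def set_lebesgue_integral_def using integral_norm_bound by (metis real_norm_def)
  also have "\<dots> \<le> (LINT x|haus s. indicator A x * B)"
    using True fin assms unfolding set_integrable_def
    by (intro integral_mono integrable_norm integrable_mult_left integrable_real_indicator)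
      (auto simp: indicator_def)
  also have "\<dots> = B * measure (haus s) A" using assms(1) by simp
  also have "\<dots> \<le> B * m"
    using assms by (intro mult_left_mono) (auto simp: measure_def enn2real_leI)
  finally show ?thesis .
next
  case False
  then have "surf_int s A f = 0"
    unfolding surf_int_def set_lebesgue_integral_def set_integrable_def by (rule not_integrable_integral_eq)
  then show ?thesis using assms by simp
qed

lemma surf_int_lincomb:
  assumes "set_integrable (haus s) A f" "set_integrable (haus s) A g"
  shows "surf_int s A (\<lambda>x. a * f x + b * g x) = a * surf_int s A f + b * surf_int s A g"
  using assms unfolding surf_int_def by (simp add: set_integral_add set_integrable_mult_right)

text \<open>Young's inequality with the weight that balances a gradient \<open>a\<close> against a
  value \<open>b\<close>: by the inverse estimates both squares then scale with the same power of
  \<open>h\<close>.\<close>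

lemma abs_mult_le_weighted:
  fixes a b h :: real assumes "h > 0" shows "\<bar>a * b\<bar> \<le> (h * a\<^sup>2 + b\<^sup>2 / h) / 2"
proof -
  have "0 \<le> (sqrt h * \<bar>a\<bar> - \<bar>b\<bar> / sqrt h)\<^sup>2" by simp
  also have "\<dots> = h * a\<^sup>2 + b\<^sup>2 / h - 2 * \<bar>a * b\<bar>"
    using assms by (simp add: power2_diff power_mult_distrib power_divide abs_mult)
  finally show ?thesis by simp
qed

lemma norm_sq_sum: "(norm (x :: real^'n))\<^sup>2 = (\<Sum>i\<in>UNIV. (x $ i)\<^sup>2)"
  by (simp add: norm_vec_def L2_set_def sum_nonneg)

lemma sum_lincomb:
  fixes f :: "'i \<Rightarrow> real"
  assumes "\<And>i. i \<in> I \<Longrightarrow> f i = a * f1 i + b * f2 i"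
  shows "sum f I = a * sum f1 I + b * sum f2 I"
proof -
  have "sum f I = (\<Sum>i\<in>I. a * f1 i + b * f2 i)" using assms by (rule sum.cong[OF refl])
  then show ?thesis by (simp add: sum.distrib sum_distrib_left)
qed

text \<open>The constants of the boundary and of the inverse estimates are parameters, so that everything
  derived from them visibly does not depend on the mesh.\<close>
locale dg = mesh M \<Omega> \<sigma> R for M :: "(real^'n) set set" and \<Omega> :: "(real^'n) set" and \<sigma> R :: real +
  fixes k :: nat and C\<Gamma> Cinv :: real
  assumes k: "k \<ge> 1" and C2: "C2_domain \<Omega>"
    and C\<Gamma>: "C\<Gamma> > 0" "\<And>c h. h > 0 \<Longrightarrow>
      hausdorff_outer (real CARD('n) - 1) (frontier \<Omega> \<inter> cball c h) \<le> ennreal (C\<Gamma> * h ^ (CARD('n) - 1))"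
    and Cinv: "Cinv > 0" "\<And>(p :: real^'n \<Rightarrow> real) c r x. poly_deg_le k p \<Longrightarrow> r > 0 \<Longrightarrow> x \<in> cball c (max 1 (2 * \<sigma>) * r) \<Longrightarrow>
      (p x)\<^sup>2 \<le> Cinv / r ^ CARD('n) * integral (cball c r) (\<lambda>x. (p x)\<^sup>2) \<and>
      (norm (grad p x))\<^sup>2 \<le> Cinv / r ^ (CARD('n) + 2) * integral (cball c r) (\<lambda>x. (p x)\<^sup>2)"
begin

abbreviation "V \<equiv> Vh k M \<Omega>"

lemma V_poly: "v \<in> V \<Longrightarrow> poly_deg_le k (v T)"
  by (cases "T \<in> \<T>") (auto simp: Vh_def)

lemma V_lincomb: "u \<in> V \<Longrightarrow> v \<in> V \<Longrightarrow> (\<lambda>T x. a * u T x + b * v T x) \<in> V"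
  by (auto simp: Vh_def intro!: poly_deg_le_add poly_deg_le_cmult)

lemma V_continuous: "v \<in> V \<Longrightarrow> continuous_on A (v T)" and V_grad_continuous: "v \<in> V \<Longrightarrow> continuous_on A (grad (v T))"
  using V_poly poly_continuous poly_grad_continuous by blast+

lemma V_grad_lincomb: "u \<in> V \<Longrightarrow> v \<in> V \<Longrightarrow>
   grad (\<lambda>x. a * u T x + b * v T x) x = a *\<^sub>R grad (u T) x + b *\<^sub>R grad (v T) x"
  using grad_lincomb V_poly by blast

text \<open>\<open>Q\<close>, like \<open>D\<close> below, integrates over the whole element;
  inverse estimates on the cut part would have constants depending on the cut.\<close>

definition Q :: "'n dgfun \<Rightarrow> (real^'n) set \<Rightarrow> real" where
  "Q v T = integral T (\<lambda>x. (v T x)\<^sup>2)"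

definition D :: "'n dgfun \<Rightarrow> (real^'n) set \<Rightarrow> real" where
  "D v T = integral T (\<lambda>x. (norm (grad (v T) x))\<^sup>2)"

lemma Q_nonneg: "v \<in> V \<Longrightarrow> T \<in> M \<Longrightarrow> 0 \<le> Q v T"
  unfolding Q_def using M_borel M_bounded
  by (intro integral_nonneg continuous_integrable_lborel(2) continuous_intros V_continuous) auto

lemma D_nonneg: "v \<in> V \<Longrightarrow> T \<in> M \<Longrightarrow> 0 \<le> D v T"
  unfolding D_def using M_borel M_bounded
  by (intro integral_nonneg continuous_integrable_lborel(2) continuous_intros V_grad_continuous) auto

text \<open>The inverse estimate on the inscribed ball reaches the whole element, which lies in the
  concentric ball of radius \<open>h = 2 * \<sigma> * r\<close>.\<close>

lemma poly_inverse_on_element: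
  assumes "poly_deg_le k p" "T \<in> M" "x \<in> T"
  shows "(p x)\<^sup>2 \<le> Cinv / r ^ CARD('n) * integral T (\<lambda>x. (p x)\<^sup>2)"
    and "(norm (grad p x))\<^sup>2 \<le> Cinv / r ^ (CARD('n) + 2) * integral T (\<lambda>x. (p x)\<^sup>2)"
proof -
  have "integral (cball (ctr T) r) (\<lambda>x. (p x)\<^sup>2) \<le> integral T (\<lambda>x. (p x)\<^sup>2)"
    using assms ctr_inner M_borel M_bounded
    by (intro integral_subset_le continuous_integrable_lborel(2) continuous_intros poly_continuous[OF assms(1)]) auto
  then have le: "Cinv / r ^ m * integral (cball (ctr T) r) (\<lambda>x. (p x)\<^sup>2) \<le> Cinv / r ^ m * integral T (\<lambda>x. (p x)\<^sup>2)" for m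
    using Cinv(1) r_pos by (intro mult_left_mono) auto
  have "x \<in> cball (ctr T) (2 * \<sigma> * r)" using ctr_outer[OF assms(2)] assms(3) by (auto simp: h_eq_r)
  moreover have "2 * \<sigma> * r \<le> max 1 (2 * \<sigma>) * r" using r_pos by (intro mult_right_mono) auto
  ultimately have x: "x \<in> cball (ctr T) (max 1 (2 * \<sigma>) * r)" by (meson order_trans mem_cball)
  show "(p x)\<^sup>2 \<le> Cinv / r ^ CARD('n) * integral T (\<lambda>x. (p x)\<^sup>2)"
    "(norm (grad p x))\<^sup>2 \<le> Cinv / r ^ (CARD('n) + 2) * integral T (\<lambda>x. (p x)\<^sup>2)"
    using Cinv(2)[OF assms(1) r_pos x] le order_trans by blast+
qed

text \<open>The inverse constants after \<open>r\<close> is expressed by \<open>h\<close>: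
  \<open>Ci\<close> for values, \<open>Cg\<close> for gradients.\<close>

definition Ci :: real where "Ci = Cinv * (2 * \<sigma>) ^ CARD('n)"
definition Cg :: real where "Cg = Cinv * (2 * \<sigma>) ^ (CARD('n) + 2)"

lemma Ci_pos: "Ci > 0" and Cg_pos: "Cg > 0"
  using Cinv(1) \<sigma> by (auto simp: Ci_def Cg_def)

lemma Ci_eq: "Cinv / r ^ CARD('n) = Ci / h ^ CARD('n)" and Cg_eq: "Cinv / r ^ (CARD('n) + 2) = Cg / h ^ (CARD('n) + 2)"
  unfolding Ci_def Cg_def h_eq_r power_mult_distrib[of "2 * \<sigma>"] using \<sigma> by simp_all

lemma value_sq_le: "v \<in> V \<Longrightarrow> T \<in> M \<Longrightarrow> x \<in> T \<Longrightarrow> (v T x)\<^sup>2 \<le> Ci / h ^ CARD('n) * Q v T"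
  using poly_inverse_on_element(1)[OF V_poly] unfolding Ci_eq Q_def by blast

lemma grad_sq_le: "v \<in> V \<Longrightarrow> T \<in> M \<Longrightarrow> x \<in> T \<Longrightarrow> (norm (grad (v T) x))\<^sup>2 \<le> Cg / h ^ (CARD('n) + 2) * Q v T"
  using poly_inverse_on_element(2)[OF V_poly] unfolding Cg_eq Q_def by blast

text \<open>The components of the gradient are polynomials themselves, so the value estimate applies
  to each. The oscillation needs this form, in which no norm of \<open>v\<close> itself
  appears.\<close>

lemma grad_sq_le_D:
  assumes "v \<in> V" "T \<in> M" "x \<in> T"
  shows "(norm (grad (v T) x))\<^sup>2 \<le> Ci / h ^ CARD('n) * D v T"
proof -
  have pg: "poly_deg_le k (\<lambda>x. grad (v T) x $ i)" for i by (rule poly_grad_component[OF V_poly[OF assms(1)]])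
  have "(norm (grad (v T) x))\<^sup>2 \<le> (\<Sum>i\<in>UNIV. Ci / h ^ CARD('n) * integral T (\<lambda>x. (grad (v T) x $ i)\<^sup>2))"
    unfolding norm_sq_sum using poly_inverse_on_element(1)[OF pg assms(2,3)] unfolding Ci_eq by (rule sum_mono)
  also have "\<dots> = Ci / h ^ CARD('n) * (\<Sum>i\<in>UNIV. integral T (\<lambda>x. (grad (v T) x $ i)\<^sup>2))"
    by (rule sum_distrib_left[symmetric])
  also have "(\<Sum>i\<in>UNIV. integral T (\<lambda>x. (grad (v T) x $ i)\<^sup>2)) = D v T"
    unfolding D_def norm_sq_sum using assms(2) M_borel M_bounded
    by (intro integral_sum[symmetric] continuous_integrable_lborel(2) continuous_intros poly_continuous[OF pg]) auto
  finally show ?thesis .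
qed

lemma measure_element_le:
  assumes "T \<in> M" shows "measure lebesgue T \<le> unit_ball_vol (real CARD('n)) * h ^ CARD('n)"
proof -
  have "measure lebesgue T \<le> measure lebesgue (cball (ctr T) h)"
    using ctr_outer[OF assms] M_compact[OF assms]
    by (intro measure_mono_fmeasurable) (auto intro!: fmeasurableD lmeasurable_compact)
  also have "\<dots> = unit_ball_vol (real CARD('n)) * h ^ CARD('n)"
    using h_pos by (intro measure_lebesgue_cball) auto
  finally show ?thesis .
qed

lemma integral_le_sup_mult_measure:
  fixes f :: "real^'n \<Rightarrow> real"
  assumes "continuous_on UNIV f" "T \<in> M" "\<And>x. x \<in> T \<Longrightarrow> f x \<le> B" "0 \<le> B"
  shows "integral T f \<le> B * (unit_ball_vol (real CARD('n)) * h ^ CARD('n))"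
proof -
  have "integral T f \<le> integral T (\<lambda>_. B)"
    using assms M_borel M_bounded by (intro integral_le continuous_integrable_lborel(2)) auto
  also have "\<dots> = B * measure lebesgue T"
    using lmeasure_integral[OF lmeasurable_compact[OF M_compact[OF assms(2)]]] integral_mult_right[of T B "\<lambda>_. 1"] by simp
  also have "\<dots> \<le> B * (unit_ball_vol (real CARD('n)) * h ^ CARD('n))"
    using measure_element_le[OF assms(2)] assms(4) by (intro mult_left_mono)
  finally show ?thesis .
qed

lemma D_le_Q:
  assumes "v \<in> V" "T \<in> M" shows "D v T \<le> Cg * unit_ball_vol (real CARD('n)) / h\<^sup>2 * Q v T"
proof -
  have "D v T \<le> Cg / h ^ (CARD('n) + 2) * Q v T * (unit_ball_vol (real CARD('n)) * h ^ CARD('n))"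
    unfolding D_def using grad_sq_le[OF assms] Cg_pos h_pos Q_nonneg[OF assms]
    by (intro integral_le_sup_mult_measure continuous_intros V_grad_continuous assms) auto
  also have "\<dots> = Cg * unit_ball_vol (real CARD('n)) / h\<^sup>2 * Q v T"
    using h_pos by (simp add: power_add power2_eq_square mult_ac)
  finally show ?thesis .
qed

section \<open>Surface integrability on boundary pieces and facets\<close>

lemma frontier_T: "T \<in> M \<Longrightarrow> compact (frontier \<Omega> \<inter> T)" "T \<in> M \<Longrightarrow> frontier \<Omega> \<inter> T \<in> sets borel"
  "T \<in> M \<Longrightarrow> emeasure (haus (real CARD('n) - 1)) (frontier \<Omega> \<inter> T) \<le> ennreal (C\<Gamma> * h ^ (CARD('n) - 1))"
proof -
  assume T: "T \<in> M"
  show c: "compact (frontier \<Omega> \<inter> T)" using M_compact[OF T] by (simp add: closed_Int_compact)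
  show b: "frontier \<Omega> \<inter> T \<in> sets borel" by (rule borel_closed[OF compact_imp_closed[OF c]])
  have "hausdorff_outer (real CARD('n) - 1) (frontier \<Omega> \<inter> T) \<le> hausdorff_outer (real CARD('n) - 1) (frontier \<Omega> \<inter> cball (ctr T) h)"
    using ctr_outer[OF T] by (intro hausdorff_outer_mono) auto
  also have "\<dots> \<le> ennreal (C\<Gamma> * h ^ (CARD('n) - 1))" using C\<Gamma>(2) h_pos by blast
  finally show "emeasure (haus (real CARD('n) - 1)) (frontier \<Omega> \<inter> T) \<le> ennreal (C\<Gamma> * h ^ (CARD('n) - 1))"
    by (simp add: emeasure_haus[OF b])
qed

lemma facet_borel: "(T, T') \<in> \<F> \<Longrightarrow> T \<inter> T' \<inter> \<Omega> \<in> sets borel"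
  using M_borel facet_pairsD \<Omega>_borel by blast

lemma facet_integrable:
  fixes f :: "real^'n \<Rightarrow> real"
  assumes "(T, T') \<in> \<F>" "continuous_on UNIV f"
  shows "set_integrable (haus (real CARD('n) - 1)) (T \<inter> T' \<inter> \<Omega>) f"
proof (rule set_integrable_haus[of "T \<inter> T'"])
  show "compact (T \<inter> T')" using facet_pairsD[OF assms(1)] M_compact by (intro compact_Int) auto
  show "emeasure (haus (real CARD('n) - 1)) (T \<inter> T' \<inter> \<Omega>) < \<infinity>"
    using hausdorff_facet_le[OF assms(1)] by (auto intro: le_less_trans)
qed (use assms facet_borel continuous_on_subset[OF assms(2)] in auto)

lemma frontier_integrable:
  fixes f :: "real^'n \<Rightarrow> real"
  assumes "T \<in> M" "continuous_on (frontier \<Omega> \<inter> T) f"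
  shows "set_integrable (haus (real CARD('n) - 1)) (frontier \<Omega> \<inter> T) f"
  by (rule set_integrable_haus[OF frontier_T(1)[OF assms(1)] assms(2)])
    (use assms frontier_T le_less_trans[OF frontier_T(3)[OF assms(1)] ennreal_less_top] in auto)

lemma normal_continuous: "continuous_on (frontier \<Omega> \<inter> T) (outward_normal \<Omega>)"
  using continuous_on_outward_normal[OF C2 \<Omega>(1)] continuous_on_subset by blast

definition t_vol :: "'n dgfun \<Rightarrow> 'n dgfun \<Rightarrow> real" where
  "t_vol v w = (\<Sum>T\<in>\<T>. integral (T \<inter> \<Omega>) (\<lambda>x. grad (v T) x \<bullet> grad (w T) x))"
definition t_flux :: "'n dgfun \<Rightarrow> 'n dgfun \<Rightarrow> real" where
  "t_flux v w = (\<Sum>T\<in>\<T>. surf_int (real CARD('n) - 1) (frontier \<Omega> \<inter> T) (\<lambda>x. (outward_normal \<Omega> x \<bullet> grad (v T) x) * w T x))"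
definition t_bdry :: "'n dgfun \<Rightarrow> 'n dgfun \<Rightarrow> real" where
  "t_bdry v w = (\<Sum>T\<in>\<T>. surf_int (real CARD('n) - 1) (frontier \<Omega> \<inter> T) (\<lambda>x. v T x * w T x / h))"
definition t_avg :: "'n dgfun \<Rightarrow> 'n dgfun \<Rightarrow> real" where
  "t_avg v w = (\<Sum>(T,T')\<in>\<F>. (1/2) * surf_int (real CARD('n) - 1) (T \<inter> T' \<inter> \<Omega>)
     (\<lambda>x. (1/2) * (facet_normal T (T \<inter> T') \<bullet> (grad (v T) x + grad (v T') x)) * (w T x - w T' x)))"
definition t_jump :: "'n dgfun \<Rightarrow> 'n dgfun \<Rightarrow> real" where
  "t_jump v w = (\<Sum>(T,T')\<in>\<F>. (1/2) * surf_int (real CARD('n) - 1) (T \<inter> T' \<inter> \<Omega>) (\<lambda>x. (v T x - v T' x) * (w T x - w T' x) / h))"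

lemma ah_eq: "ah \<Omega> M \<beta> v w = t_vol v w - t_flux v w - t_flux w v + \<beta> * t_bdry v w - t_avg v w - t_avg w v + \<beta> * t_jump v w"
  unfolding ah_def Let_def t_vol_def t_flux_def t_bdry_def t_avg_def t_jump_def by (simp add: mult.commute)

text \<open>\<open>t_flux\<close> and \<open>t_avg\<close> occur in both orders of the arguments;
  the other three terms are symmetric.\<close>

lemma ah_commute: "ah \<Omega> M \<beta> v w = ah \<Omega> M \<beta> w v"
proof -
  have "t_vol v w = t_vol w v" "t_bdry v w = t_bdry w v" "t_jump v w = t_jump w v"
    by (simp_all only: t_vol_def t_bdry_def t_jump_def inner_commute mult.commute)
  then show ?thesis unfolding ah_eq by simp
qed

section \<open>Linearity of the form, term by term\<close>

context
  fixes u v w :: "'n dgfun" and a b :: real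
  assumes u: "u \<in> V" and v: "v \<in> V" and w: "w \<in> V"
begin

abbreviation "uv \<equiv> (\<lambda>T x. a * u T x + b * v T x)"

lemma t_vol_lin: "t_vol uv w = a * t_vol u w + b * t_vol v w"
  unfolding t_vol_def
proof (rule sum_lincomb)
  fix T assume T: "T \<in> \<T>"
  have i: "(\<lambda>x. grad (f T) x \<bullet> grad (w T) x) integrable_on (T \<inter> \<Omega>)" if "f \<in> V" for f
    using T active_M M_borel M_bounded \<Omega>_borel that
    by (intro continuous_integrable_lborel(2) continuous_intros V_grad_continuous w) auto
  have "integral (T \<inter> \<Omega>) (\<lambda>x. a * (grad (u T) x \<bullet> grad (w T) x) + b * (grad (v T) x \<bullet> grad (w T) x))
     = a * integral (T \<inter> \<Omega>) (\<lambda>x. grad (u T) x \<bullet> grad (w T) x) + b * integral (T \<inter> \<Omega>) (\<lambda>x. grad (v T) x \<bullet> grad (w T) x)"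
    using i[OF u] i[OF v] by (subst integral_add) (auto intro: integrable_on_mult_right)
  then show "integral (T \<inter> \<Omega>) (\<lambda>x. grad (\<lambda>x. a * u T x + b * v T x) x \<bullet> grad (w T) x)
     = a * integral (T \<inter> \<Omega>) (\<lambda>x. grad (u T) x \<bullet> grad (w T) x) + b * integral (T \<inter> \<Omega>) (\<lambda>x. grad (v T) x \<bullet> grad (w T) x)"
    by (simp add: V_grad_lincomb[OF u v] inner_add_left)
qed

lemma t_flux_lin1: "t_flux uv w = a * t_flux u w + b * t_flux v w"
  unfolding t_flux_def
proof (rule sum_lincomb)
  fix T assume T: "T \<in> \<T>"
  have i: "set_integrable (haus (real CARD('n) - 1)) (frontier \<Omega> \<inter> T) (\<lambda>x. (outward_normal \<Omega> x \<bullet> grad (f T) x) * w T x)" if "f \<in> V" for f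
    using T active_M that
    by (intro frontier_integrable continuous_intros V_grad_continuous V_continuous w normal_continuous) auto
  show "surf_int (real CARD('n) - 1) (frontier \<Omega> \<inter> T) (\<lambda>x. (outward_normal \<Omega> x \<bullet> grad (\<lambda>x. a * u T x + b * v T x) x) * w T x)
    = a * surf_int (real CARD('n) - 1) (frontier \<Omega> \<inter> T) (\<lambda>x. (outward_normal \<Omega> x \<bullet> grad (u T) x) * w T x)
      + b * surf_int (real CARD('n) - 1) (frontier \<Omega> \<inter> T) (\<lambda>x. (outward_normal \<Omega> x \<bullet> grad (v T) x) * w T x)"
    unfolding surf_int_lincomb[OF i[OF u] i[OF v], symmetric]
    by (simp add: V_grad_lincomb[OF u v] inner_add_right distrib_right mult.assoc)
qed

lemma t_flux_lin2: "t_flux w uv = a * t_flux w u + b * t_flux w v"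
  unfolding t_flux_def
proof (rule sum_lincomb)
  fix T assume T: "T \<in> \<T>"
  have i: "set_integrable (haus (real CARD('n) - 1)) (frontier \<Omega> \<inter> T) (\<lambda>x. (outward_normal \<Omega> x \<bullet> grad (w T) x) * f T x)" if "f \<in> V" for f
    using T active_M that
    by (intro frontier_integrable continuous_intros V_grad_continuous V_continuous w normal_continuous) auto
  show "surf_int (real CARD('n) - 1) (frontier \<Omega> \<inter> T) (\<lambda>x. (outward_normal \<Omega> x \<bullet> grad (w T) x) * (a * u T x + b * v T x))
    = a * surf_int (real CARD('n) - 1) (frontier \<Omega> \<inter> T) (\<lambda>x. (outward_normal \<Omega> x \<bullet> grad (w T) x) * u T x)
      + b * surf_int (real CARD('n) - 1) (frontier \<Omega> \<inter> T) (\<lambda>x. (outward_normal \<Omega> x \<bullet> grad (w T) x) * v T x)"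
    unfolding surf_int_lincomb[OF i[OF u] i[OF v], symmetric]
    by (simp add: distrib_left mult_ac)
qed

lemma t_bdry_lin: "t_bdry uv w = a * t_bdry u w + b * t_bdry v w"
  unfolding t_bdry_def
proof (rule sum_lincomb)
  fix T assume T: "T \<in> \<T>"
  have i: "set_integrable (haus (real CARD('n) - 1)) (frontier \<Omega> \<inter> T) (\<lambda>x. f T x * w T x / h)" if "f \<in> V" for f
    using T active_M that h_pos
    by (intro frontier_integrable continuous_intros V_continuous w) auto
  show "surf_int (real CARD('n) - 1) (frontier \<Omega> \<inter> T) (\<lambda>x. (a * u T x + b * v T x) * w T x / h)
    = a * surf_int (real CARD('n) - 1) (frontier \<Omega> \<inter> T) (\<lambda>x. u T x * w T x / h) + b * surf_int (real CARD('n) - 1) (frontier \<Omega> \<inter> T) (\<lambda>x. v T x * w T x / h)"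
    unfolding surf_int_lincomb[OF i[OF u] i[OF v], symmetric]
    by (simp add: distrib_right add_divide_distrib mult.assoc)
qed

lemma t_avg_lin1: "t_avg uv w = a * t_avg u w + b * t_avg v w"
  unfolding t_avg_def
proof (rule sum_lincomb, clarify)
  fix T T' assume F: "(T, T') \<in> \<F>"
  have i: "set_integrable (haus (real CARD('n) - 1)) (T \<inter> T' \<inter> \<Omega>) (\<lambda>x. (1/2) * (facet_normal T (T \<inter> T') \<bullet> (grad (f T) x + grad (f T') x)) * (w T x - w T' x))"
    if "f \<in> V" for f
    using that by (intro facet_integrable[OF F] continuous_intros V_grad_continuous V_continuous w) auto
  show "(1/2) * surf_int (real CARD('n) - 1) (T \<inter> T' \<inter> \<Omega>) (\<lambda>x. (1/2) * (facet_normal T (T \<inter> T') \<bullet>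
        (grad (\<lambda>x. a * u T x + b * v T x) x + grad (\<lambda>x. a * u T' x + b * v T' x) x)) * (w T x - w T' x))
    = a * ((1/2) * surf_int (real CARD('n) - 1) (T \<inter> T' \<inter> \<Omega>) (\<lambda>x. (1/2) * (facet_normal T (T \<inter> T') \<bullet> (grad (u T) x + grad (u T') x)) * (w T x - w T' x)))
    + b * ((1/2) * surf_int (real CARD('n) - 1) (T \<inter> T' \<inter> \<Omega>) (\<lambda>x. (1/2) * (facet_normal T (T \<inter> T') \<bullet> (grad (v T) x + grad (v T') x)) * (w T x - w T' x)))"
    (is "1/2 * ?L = a * (1/2 * ?A) + b * (1/2 * ?B)")
  proof -
    have "?L = a * ?A + b * ?B"
      unfolding surf_int_lincomb[OF i[OF u] i[OF v], symmetric] V_grad_lincomb[OF u v]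
      by (rule arg_cong[of _ _ "surf_int _ _"]) (simp add: fun_eq_iff inner_add_right algebra_simps)
    then show ?thesis by (simp add: algebra_simps)
  qed
qed

lemma t_avg_lin2: "t_avg w uv = a * t_avg w u + b * t_avg w v"
  unfolding t_avg_def
proof (rule sum_lincomb, clarify)
  fix T T' assume F: "(T, T') \<in> \<F>"
  have i: "set_integrable (haus (real CARD('n) - 1)) (T \<inter> T' \<inter> \<Omega>) (\<lambda>x. (1/2) * (facet_normal T (T \<inter> T') \<bullet> (grad (w T) x + grad (w T') x)) * (f T x - f T' x))"
    if "f \<in> V" for f
    using that by (intro facet_integrable[OF F] continuous_intros V_grad_continuous V_continuous w) auto
  show "(1/2) * surf_int (real CARD('n) - 1) (T \<inter> T' \<inter> \<Omega>) (\<lambda>x. (1/2) * (facet_normal T (T \<inter> T') \<bullet> (grad (w T) x + grad (w T') x))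
          * (a * u T x + b * v T x - (a * u T' x + b * v T' x)))
    = a * ((1/2) * surf_int (real CARD('n) - 1) (T \<inter> T' \<inter> \<Omega>) (\<lambda>x. (1/2) * (facet_normal T (T \<inter> T') \<bullet> (grad (w T) x + grad (w T') x)) * (u T x - u T' x)))
    + b * ((1/2) * surf_int (real CARD('n) - 1) (T \<inter> T' \<inter> \<Omega>) (\<lambda>x. (1/2) * (facet_normal T (T \<inter> T') \<bullet> (grad (w T) x + grad (w T') x)) * (v T x - v T' x)))"
    (is "1/2 * ?L = a * (1/2 * ?A) + b * (1/2 * ?B)")
  proof -
    have "?L = a * ?A + b * ?B"
      unfolding surf_int_lincomb[OF i[OF u] i[OF v], symmetric]
      by (rule arg_cong[of _ _ "surf_int _ _"]) (simp add: fun_eq_iff algebra_simps diff_divide_distrib add_divide_distrib)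
    then show ?thesis by (simp add: algebra_simps)
  qed
qed

lemma t_jump_lin: "t_jump uv w = a * t_jump u w + b * t_jump v w"
  unfolding t_jump_def
proof (rule sum_lincomb, clarify)
  fix T T' assume F: "(T, T') \<in> \<F>"
  have i: "set_integrable (haus (real CARD('n) - 1)) (T \<inter> T' \<inter> \<Omega>) (\<lambda>x. (f T x - f T' x) * (w T x - w T' x) / h)"
    if "f \<in> V" for f
    using that h_pos by (intro facet_integrable[OF F] continuous_intros V_continuous w) auto
  show "(1/2) * surf_int (real CARD('n) - 1) (T \<inter> T' \<inter> \<Omega>) (\<lambda>x. (a * u T x + b * v T x - (a * u T' x + b * v T' x)) * (w T x - w T' x) / h)
    = a * ((1/2) * surf_int (real CARD('n) - 1) (T \<inter> T' \<inter> \<Omega>) (\<lambda>x. (u T x - u T' x) * (w T x - w T' x) / h))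
    + b * ((1/2) * surf_int (real CARD('n) - 1) (T \<inter> T' \<inter> \<Omega>) (\<lambda>x. (v T x - v T' x) * (w T x - w T' x) / h))"
    (is "1/2 * ?L = a * (1/2 * ?A) + b * (1/2 * ?B)")
  proof -
    have "?L = a * ?A + b * ?B"
      unfolding surf_int_lincomb[OF i[OF u] i[OF v], symmetric]
      by (rule arg_cong[of _ _ "surf_int _ _"]) (simp add: fun_eq_iff algebra_simps diff_divide_distrib add_divide_distrib)
    then show ?thesis by (simp add: algebra_simps)
  qed
qed

lemma ah_lin: "ah \<Omega> M \<beta> uv w = a * ah \<Omega> M \<beta> u w + b * ah \<Omega> M \<beta> v w"
  unfolding ah_eq t_vol_lin t_flux_lin1 t_flux_lin2 t_bdry_lin t_avg_lin1 t_avg_lin2 t_jump_lin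
  by (simp add: algebra_simps)

end

end


section \<open>The upper bound\<close>

lemma add_sq_le: "(a + b)\<^sup>2 \<le> 2 * (a\<^sup>2 + b\<^sup>2)" and diff_sq_le: "(a - b)\<^sup>2 \<le> 2 * (a\<^sup>2 + b\<^sup>2)" for a b :: real
  using sum_squares_bound[of a b] sum_squares_bound[of a "-b"] by (simp_all add: power2_sum power2_diff)

context mesh begin


text \<open>The interiors of the two elements are disjoint, convex and nonempty. A hyperplane
  separating them, extended to the elements by closure, provides a vector to choose.\<close>

lemma norm_facet_normal:
  assumes "(T, T') \<in> \<F>" shows "norm (facet_normal T (T \<inter> T')) = 1"
proof -
  note T = facet_pairsD[OF assms]
  have int: "interior S \<noteq> {}" if "S \<in> M" for S
    using ctr_inner[OF that] r_pos by (metis interior_cball interior_mono ball_eq_empty not_le subset_empty)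
  have cl: "S \<subseteq> closure (interior S)" if "S \<in> M" for S
    using convex_closure_interior[OF M_convex[OF that] int[OF that]] closure_subset by blast
  have "interior (T \<inter> T') = {}"
    using Int_negligible[OF T(1-3)] open_not_negligible[OF open_interior] negligible_subset interior_subset by metis
  then have "interior T \<inter> interior T' = {}" by simp
  then obtain a b where ab: "a \<noteq> 0" "\<forall>x\<in>interior T. a \<bullet> x \<le> b" "\<forall>x\<in>interior T'. b \<le> a \<bullet> x"
    using separating_hyperplane_sets[of "interior T" "interior T'"] T M_convex int by (metis convex_interior)
  have "closure (interior T) \<subseteq> {x. a \<bullet> x \<le> b}"
    by (rule closure_minimal) (use ab in \<open>auto simp: closed_halfspace_le\<close>)
  then have le: "a \<bullet> x \<le> b" if "x \<in> T" for x using cl[OF T(1)] that by auto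
  have "closure (interior T') \<subseteq> {x. b \<le> a \<bullet> x}"
    by (rule closure_minimal) (use ab closed_halfspace_ge[of b a] in auto)
  then have ge: "b \<le> a \<bullet> x" if "x \<in> T'" for x using cl[OF T(2)] that by auto
  define \<nu> where "\<nu> = a /\<^sub>R norm a"
  have "norm \<nu> = 1 \<and> (\<forall>x\<in>T. \<forall>y\<in>T \<inter> T'. \<nu> \<bullet> (x - y) \<le> 0)"
  proof (intro conjI ballI)
    show "norm \<nu> = 1" using ab by (simp add: \<nu>_def)
    fix x y assume "x \<in> T" "y \<in> T \<inter> T'"
    then have "a \<bullet> (x - y) \<le> 0" using le[of x] ge[of y] by (simp add: inner_diff_right)
    then show "\<nu> \<bullet> (x - y) \<le> 0" by (simp add: \<nu>_def mult_nonneg_nonpos)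
  qed
  then show ?thesis unfolding facet_normal_def by (rule someI2) simp
qed

lemma facet_sym: "(T, T') \<in> \<F> \<Longrightarrow> (T', T) \<in> \<F>"
  by (auto simp: facet_pairs_def Int_commute)

lemma card_facet_neighbours: "T \<in> \<T> \<Longrightarrow> real (card {T'. (T, T') \<in> \<F>}) \<le> (4 * \<sigma>) ^ CARD('n)"
  using card_mono[of "{T'\<in>M. T \<inter> T' \<noteq> {}}" "{T'. (T, T') \<in> \<F>}"] facet_pairsD(2,6) card_neighbours_le[OF active_M, of T]
  by (fastforce intro: order_trans)

lemma sum_facets_nested: "(\<Sum>p\<in>\<F>. f p) = (\<Sum>T\<in>\<T>. \<Sum>T'\<in>{T'. (T, T') \<in> \<F>}. f (T, T'))"
proof -
  have "\<F> = Sigma \<T> (\<lambda>T. {T'. (T, T') \<in> \<F>})" using facet_pairsD(4) by auto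
  moreover have "finite {T'. (T, T') \<in> \<F>}" for T
    by (rule finite_subset[of _ \<T>]) (auto dest: facet_pairsD)
  ultimately show ?thesis by (subst sum.Sigma) (auto simp: split_def)
qed

text \<open>Each element is counted once per neighbour, and the symmetry of the facet pairs treats
  both summands alike.\<close>

lemma sum_facets_le:
  assumes "\<And>T. T \<in> \<T> \<Longrightarrow> f T \<ge> 0"
  shows "(\<Sum>(T, T')\<in>\<F>. f T + f T') \<le> 2 * (4 * \<sigma>) ^ CARD('n) * (\<Sum>T\<in>\<T>. f T)"
proof -
  have 1: "(\<Sum>(T, T')\<in>\<F>. f T) \<le> (4 * \<sigma>) ^ CARD('n) * (\<Sum>T\<in>\<T>. f T)"
    unfolding sum_facets_nested sum_distrib_left
    using assms card_facet_neighbours by (auto intro!: sum_mono mult_right_mono)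
  have "(\<Sum>(T, T')\<in>\<F>. f T') = (\<Sum>(T, T')\<in>\<F>. f T)"
    by (rule sum.reindex_bij_witness[of _ prod.swap prod.swap]) (auto intro: facet_sym)
  then show ?thesis using 1 by (simp add: split_def sum.distrib)
qed

end

section \<open>Scaling of the terms of the form\<close>

context dg begin

text \<open>The scale of the surface measure of facets and boundary pieces.\<close>

abbreviation "p \<equiv> h ^ (CARD('n) - 1)"

lemma p_pos: "p > 0" and h_pow: "h ^ CARD('n) = p * h" "h ^ (CARD('n) + 2) = p * h ^ 3"
proof -
  show "p > 0" using h_pos by simp
  have "CARD('n) = Suc (CARD('n) - 1)" using d by simp
  then show 1: "h ^ CARD('n) = p * h" by (metis power_Suc2)
  show "h ^ (CARD('n) + 2) = p * h ^ 3" unfolding power_add 1 by (simp add: power2_eq_square power3_eq_cube)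
qed

text \<open>With the weights of Young's inequality, values and gradients both scale like
  \<open>1 / (p * h ^ 2)\<close>; a surface of measure of order \<open>p\<close> leaves
  \<open>1 / h ^ 2\<close>.\<close>

lemma value_sq_div_le: "v \<in> V \<Longrightarrow> T \<in> M \<Longrightarrow> x \<in> T \<Longrightarrow> (v T x)\<^sup>2 / h \<le> Ci / (p * h\<^sup>2) * Q v T"
  using divide_right_mono[OF value_sq_le, of v T x h] h_pos unfolding h_pow
  by (simp add: power2_eq_square mult_ac)

lemma grad_sq_mult_le: "v \<in> V \<Longrightarrow> T \<in> M \<Longrightarrow> x \<in> T \<Longrightarrow> h * (norm (grad (v T) x))\<^sup>2 \<le> Cg / (p * h\<^sup>2) * Q v T"
  using mult_left_mono[OF grad_sq_le, of v T x h] h_pos unfolding h_pow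
  by (simp add: power2_eq_square power3_eq_cube mult_ac)

definition Qs :: "'n dgfun \<Rightarrow> real" where "Qs v = (\<Sum>T\<in>\<T>. Q v T)"

lemma Qs_nonneg: "v \<in> V \<Longrightarrow> Qs v \<ge> 0"
  unfolding Qs_def using Q_nonneg active_M by (intro sum_nonneg) auto

lemma t_vol_le:
  assumes "v \<in> V" shows "t_vol v v \<le> Cg * unit_ball_vol (real CARD('n)) / h\<^sup>2 * Qs v"
  unfolding t_vol_def Qs_def sum_distrib_left
proof (rule sum_mono)
  fix T assume T: "T \<in> \<T>"
  have "integral (T \<inter> \<Omega>) (\<lambda>x. grad (v T) x \<bullet> grad (v T) x) \<le> integral T (\<lambda>x. grad (v T) x \<bullet> grad (v T) x)"
    using T active_M M_borel M_bounded \<Omega>_borel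
    by (intro integral_subset_le continuous_integrable_lborel(2) continuous_intros V_grad_continuous assms) auto
  also have "\<dots> = D v T" by (simp add: D_def power2_norm_eq_inner)
  also have "\<dots> \<le> Cg * unit_ball_vol (real CARD('n)) / h\<^sup>2 * Q v T" by (rule D_le_Q[OF assms active_M[OF T]])
  finally show "integral (T \<inter> \<Omega>) (\<lambda>x. grad (v T) x \<bullet> grad (v T) x) \<le> Cg * unit_ball_vol (real CARD('n)) / h\<^sup>2 * Q v T" .
qed

lemma surface_scaling: "A / (p * h\<^sup>2) * q * (B * p) = A * B / h\<^sup>2 * q"
  using p_pos by simp

lemma t_flux_le:
  assumes "v \<in> V" shows "\<bar>t_flux v v\<bar> \<le> (Ci + Cg) * C\<Gamma> / h\<^sup>2 * Qs v"
proof -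
  have "\<bar>surf_int (real CARD('n) - 1) (frontier \<Omega> \<inter> T) (\<lambda>x. (outward_normal \<Omega> x \<bullet> grad (v T) x) * v T x)\<bar>
     \<le> (Ci + Cg) * C\<Gamma> / h\<^sup>2 * Q v T" if T: "T \<in> \<T>" for T
  proof -
    note TM = active_M[OF T]
    have "\<bar>surf_int (real CARD('n) - 1) (frontier \<Omega> \<inter> T) (\<lambda>x. (outward_normal \<Omega> x \<bullet> grad (v T) x) * v T x)\<bar>
      \<le> ((Ci + Cg) / (p * h\<^sup>2) * Q v T) * (C\<Gamma> * p)"
    proof (rule abs_surf_int_le[OF frontier_T(2,3)[OF TM]])
      show "0 \<le> C\<Gamma> * p" using C\<Gamma>(1) p_pos by simp
      show "0 \<le> (Ci + Cg) / (p * h\<^sup>2) * Q v T" using Ci_pos Cg_pos p_pos Q_nonneg[OF assms TM] by simp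
      fix x assume x: "x \<in> frontier \<Omega> \<inter> T"
      have "(outward_normal \<Omega> x \<bullet> grad (v T) x)\<^sup>2 \<le> (norm (grad (v T) x))\<^sup>2"
      proof -
        have "\<bar>outward_normal \<Omega> x \<bullet> grad (v T) x\<bar> \<le> norm (outward_normal \<Omega> x) * norm (grad (v T) x)"
          by (rule Cauchy_Schwarz_ineq2)
        then have "\<bar>outward_normal \<Omega> x \<bullet> grad (v T) x\<bar> \<le> norm (grad (v T) x)"
          using norm_outward_normal[OF C2 \<Omega>(1)] x by simp
        then have "\<bar>outward_normal \<Omega> x \<bullet> grad (v T) x\<bar>\<^sup>2 \<le> (norm (grad (v T) x))\<^sup>2" by (rule power_mono) simp
        then show ?thesis by simp
      qed
      then have "h * (outward_normal \<Omega> x \<bullet> grad (v T) x)\<^sup>2 \<le> Cg / (p * h\<^sup>2) * Q v T"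
        using grad_sq_mult_le[OF assms TM, of x] x h_pos by (auto intro: order_trans[OF mult_left_mono])
      moreover have "(v T x)\<^sup>2 / h \<le> Ci / (p * h\<^sup>2) * Q v T" using value_sq_div_le[OF assms TM, of x] x by simp
      moreover have "0 \<le> h * (outward_normal \<Omega> x \<bullet> grad (v T) x)\<^sup>2" "0 \<le> (v T x)\<^sup>2 / h" using h_pos by auto
      moreover have "(Ci + Cg) / (p * h\<^sup>2) * Q v T = Ci / (p * h\<^sup>2) * Q v T + Cg / (p * h\<^sup>2) * Q v T"
        by (simp add: add_divide_distrib distrib_right)
      ultimately show "\<bar>(outward_normal \<Omega> x \<bullet> grad (v T) x) * v T x\<bar> \<le> (Ci + Cg) / (p * h\<^sup>2) * Q v T"
        using abs_mult_le_weighted[OF h_pos, of "outward_normal \<Omega> x \<bullet> grad (v T) x" "v T x"] by argo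
    qed
    then show ?thesis unfolding surface_scaling .
  qed
  then show ?thesis unfolding t_flux_def Qs_def sum_distrib_left
    by (intro order_trans[OF sum_abs] sum_mono)
qed

lemma t_bdry_le:
  assumes "v \<in> V" shows "\<bar>t_bdry v v\<bar> \<le> Ci * C\<Gamma> / h\<^sup>2 * Qs v"
proof -
  have "\<bar>surf_int (real CARD('n) - 1) (frontier \<Omega> \<inter> T) (\<lambda>x. v T x * v T x / h)\<bar>
     \<le> Ci * C\<Gamma> / h\<^sup>2 * Q v T" if T: "T \<in> \<T>" for T
  proof -
    note TM = active_M[OF T]
    have "\<bar>surf_int (real CARD('n) - 1) (frontier \<Omega> \<inter> T) (\<lambda>x. v T x * v T x / h)\<bar>
      \<le> (Ci / (p * h\<^sup>2) * Q v T) * (C\<Gamma> * p)"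
    proof (rule abs_surf_int_le[OF frontier_T(2,3)[OF TM]])
      show "0 \<le> C\<Gamma> * p" using C\<Gamma>(1) p_pos by simp
      show "0 \<le> Ci / (p * h\<^sup>2) * Q v T" using Ci_pos p_pos Q_nonneg[OF assms TM] by simp
      fix x assume x: "x \<in> frontier \<Omega> \<inter> T"
      then show "\<bar>v T x * v T x / h\<bar> \<le> Ci / (p * h\<^sup>2) * Q v T"
        using value_sq_div_le[OF assms TM, of x] h_pos by (simp add: power2_eq_square)
    qed
    then show ?thesis unfolding surface_scaling .
  qed
  then show ?thesis unfolding t_bdry_def Qs_def sum_distrib_left
    by (intro order_trans[OF sum_abs] sum_mono)
qed

lemma facet_const_pos: "facet_const > 0"
  unfolding facet_const_def using d hnorm_pos[of "real CARD('n) - 1"] by simp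

text \<open>Common frame for the jump and average terms; the factor 1/2 for the two orientations
  cancels the 2 of \<open>sum_facets_le\<close>.\<close>

lemma facet_sum_le:
  assumes "v \<in> V" "K \<ge> 0"
    and "\<And>T T' x. (T, T') \<in> \<F> \<Longrightarrow> x \<in> T \<inter> T' \<inter> \<Omega> \<Longrightarrow> \<bar>f T T' x\<bar> \<le> K / (p * h\<^sup>2) * (Q v T + Q v T')"
  shows "\<bar>\<Sum>(T,T')\<in>\<F>. (1/2) * surf_int (real CARD('n) - 1) (T \<inter> T' \<inter> \<Omega>) (f T T')\<bar>
     \<le> K * facet_const * (4 * \<sigma>) ^ CARD('n) / h\<^sup>2 * Qs v"
proof -
  have b: "\<bar>surf_int (real CARD('n) - 1) (T \<inter> T' \<inter> \<Omega>) (f T T')\<bar> \<le> K * facet_const / h\<^sup>2 * (Q v T + Q v T')"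
    if F: "(T, T') \<in> \<F>" for T T'
  proof -
    have "\<bar>surf_int (real CARD('n) - 1) (T \<inter> T' \<inter> \<Omega>) (f T T')\<bar>
       \<le> (K / (p * h\<^sup>2) * (Q v T + Q v T')) * (facet_const * p)"
      using facet_const_pos p_pos assms(2) Q_nonneg[OF assms(1)] facet_pairsD[OF F] assms(3)[OF F]
      by (intro abs_surf_int_le[OF facet_borel[OF F] hausdorff_facet_le[OF F]]) auto
    then show ?thesis unfolding surface_scaling .
  qed
  have "\<bar>\<Sum>(T,T')\<in>\<F>. (1/2) * surf_int (real CARD('n) - 1) (T \<inter> T' \<inter> \<Omega>) (f T T')\<bar>
     \<le> (\<Sum>(T,T')\<in>\<F>. (1/2) * (K * facet_const / h\<^sup>2) * (Q v T + Q v T'))"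
    using b by (intro order_trans[OF sum_abs] sum_mono) (auto simp: abs_mult)
  also have "\<dots> = (1/2) * (K * facet_const / h\<^sup>2) * (\<Sum>(T,T')\<in>\<F>. Q v T + Q v T')"
    by (simp only: sum_distrib_left split_def)
  also have "\<dots> \<le> (1/2) * (K * facet_const / h\<^sup>2) * (2 * (4 * \<sigma>) ^ CARD('n) * (\<Sum>T\<in>\<T>. Q v T))"
    using assms(2) facet_const_pos Q_nonneg[OF assms(1)] active_M by (intro mult_left_mono sum_facets_le) auto
  also have "\<dots> = K * facet_const * (4 * \<sigma>) ^ CARD('n) / h\<^sup>2 * Qs v"
    by (simp add: Qs_def)
  finally show ?thesis .
qed

lemma t_jump_le:
  assumes "v \<in> V" shows "\<bar>t_jump v v\<bar> \<le> (2 * Ci) * facet_const * (4 * \<sigma>) ^ CARD('n) / h\<^sup>2 * Qs v"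
  unfolding t_jump_def
proof (rule facet_sum_le[OF assms])
  fix T T' x assume F: "(T, T') \<in> \<F>" and x: "x \<in> T \<inter> T' \<inter> \<Omega>"
  have "\<bar>(v T x - v T' x) * (v T x - v T' x) / h\<bar> = (v T x - v T' x)\<^sup>2 / h" using h_pos by (simp add: power2_eq_square)
  also have "\<dots> \<le> 2 * ((v T x)\<^sup>2 / h + (v T' x)\<^sup>2 / h)"
    using divide_right_mono[OF diff_sq_le, of h "v T x" "v T' x"] h_pos by (simp add: add_divide_distrib)
  also have "\<dots> \<le> 2 * (Ci / (p * h\<^sup>2) * Q v T + Ci / (p * h\<^sup>2) * Q v T')"
    using x facet_pairsD[OF F] by (intro mult_left_mono add_mono value_sq_div_le assms) auto
  also have "\<dots> = 2 * Ci / (p * h\<^sup>2) * (Q v T + Q v T')" by (simp add: distrib_left)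
  finally show "\<bar>(v T x - v T' x) * (v T x - v T' x) / h\<bar> \<le> 2 * Ci / (p * h\<^sup>2) * (Q v T + Q v T')" .
qed (use Ci_pos in simp)

lemma t_avg_le:
  assumes "v \<in> V" shows "\<bar>t_avg v v\<bar> \<le> (Ci + Cg) * facet_const * (4 * \<sigma>) ^ CARD('n) / h\<^sup>2 * Qs v"
  unfolding t_avg_def
proof (rule facet_sum_le[OF assms])
  fix T T' x assume F: "(T, T') \<in> \<F>" and x: "x \<in> T \<inter> T' \<inter> \<Omega>"
  note FT = facet_pairsD[OF F]
  define av where "av = (1/2) * (facet_normal T (T \<inter> T') \<bullet> (grad (v T) x + grad (v T') x))"
  define g1 where "g1 = norm (grad (v T) x)"
  define g2 where "g2 = norm (grad (v T') x)"
  have "\<bar>facet_normal T (T \<inter> T') \<bullet> (grad (v T) x + grad (v T') x)\<bar> \<le> 1 * norm (grad (v T) x + grad (v T') x)"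
    using Cauchy_Schwarz_ineq2 norm_facet_normal[OF F] by metis
  also have "\<dots> \<le> g1 + g2" unfolding g1_def g2_def using norm_triangle_ineq by simp
  finally have "\<bar>av\<bar> \<le> (g1 + g2) / 2" by (simp add: av_def abs_mult)
  then have "\<bar>av\<bar>\<^sup>2 \<le> ((g1 + g2) / 2)\<^sup>2" by (rule power_mono) simp
  also have "\<dots> \<le> (g1\<^sup>2 + g2\<^sup>2) / 2" using add_sq_le[of g1 g2] by (simp add: power_divide)
  finally have "h * av\<^sup>2 \<le> h * ((g1\<^sup>2 + g2\<^sup>2) / 2)" using h_pos by simp
  moreover have "h * g1\<^sup>2 \<le> Cg / (p * h\<^sup>2) * Q v T" "h * g2\<^sup>2 \<le> Cg / (p * h\<^sup>2) * Q v T'"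
    unfolding g1_def g2_def using x grad_sq_mult_le[OF assms FT(1), of x] grad_sq_mult_le[OF assms FT(2), of x] by auto
  ultimately have 1: "h * av\<^sup>2 \<le> (Cg / (p * h\<^sup>2) * Q v T + Cg / (p * h\<^sup>2) * Q v T') / 2"
    by (simp add: distrib_left)
  have "(v T x - v T' x)\<^sup>2 / h \<le> 2 * ((v T x)\<^sup>2 / h + (v T' x)\<^sup>2 / h)"
    using divide_right_mono[OF diff_sq_le, of h "v T x" "v T' x"] h_pos by (simp add: add_divide_distrib)
  also have "\<dots> \<le> 2 * (Ci / (p * h\<^sup>2) * Q v T + Ci / (p * h\<^sup>2) * Q v T')"
    using x FT by (intro mult_left_mono add_mono value_sq_div_le assms) auto
  finally have 2: "(v T x - v T' x)\<^sup>2 / h \<le> 2 * (Ci / (p * h\<^sup>2) * Q v T + Ci / (p * h\<^sup>2) * Q v T')" .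
  have e: "(Ci + Cg) / (p * h\<^sup>2) * (Q v T + Q v T') =
     (Ci / (p * h\<^sup>2) * Q v T + Ci / (p * h\<^sup>2) * Q v T') + (Cg / (p * h\<^sup>2) * Q v T + Cg / (p * h\<^sup>2) * Q v T')"
    by (simp add: add_divide_distrib algebra_simps)
  have "0 \<le> Cg / (p * h\<^sup>2) * Q v T" "0 \<le> Cg / (p * h\<^sup>2) * Q v T'"
    using Cg_pos p_pos Q_nonneg[OF assms] FT by auto
  then have "\<bar>av * (v T x - v T' x)\<bar> \<le> (Ci + Cg) / (p * h\<^sup>2) * (Q v T + Q v T')"
    unfolding e using abs_mult_le_weighted[OF h_pos, of av "v T x - v T' x"] 1 2 by argo
  then show "\<bar>(1/2) * (facet_normal T (T \<inter> T') \<bullet> (grad (v T) x + grad (v T') x)) * (v T x - v T' x)\<bar>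
    \<le> (Ci + Cg) / (p * h\<^sup>2) * (Q v T + Q v T')" by (simp only: av_def)
qed (use Ci_pos Cg_pos in simp)

text \<open>Summands in the order volume, flux twice, boundary penalty, average twice, jump
  penalty.\<close>

definition Cup :: "real \<Rightarrow> real" where
  "Cup \<beta> = Cg * unit_ball_vol (real CARD('n)) + 2 * ((Ci + Cg) * C\<Gamma>) + \<bar>\<beta>\<bar> * (Ci * C\<Gamma>)
     + 2 * ((Ci + Cg) * facet_const * (4 * \<sigma>) ^ CARD('n)) + \<bar>\<beta>\<bar> * ((2 * Ci) * facet_const * (4 * \<sigma>) ^ CARD('n))"

lemma Cup_pos: "Cup \<beta> > 0"
  unfolding Cup_def using Ci_pos Cg_pos C\<Gamma>(1) facet_const_pos \<sigma>
  by (intro add_pos_nonneg mult_nonneg_nonneg mult_pos_pos) auto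

lemma ah_le:
  assumes "v \<in> V" shows "ah \<Omega> M \<beta> v v \<le> Cup \<beta> / h\<^sup>2 * Qs v"
proof -
  have "\<beta> * t_bdry v v \<le> \<bar>\<beta>\<bar> * \<bar>t_bdry v v\<bar>" "\<beta> * t_jump v v \<le> \<bar>\<beta>\<bar> * \<bar>t_jump v v\<bar>"
    by (metis abs_ge_self abs_mult)+
  moreover have "\<bar>\<beta>\<bar> * \<bar>t_bdry v v\<bar> \<le> \<bar>\<beta>\<bar> * (Ci * C\<Gamma> / h\<^sup>2 * Qs v)"
    "\<bar>\<beta>\<bar> * \<bar>t_jump v v\<bar> \<le> \<bar>\<beta>\<bar> * ((2 * Ci) * facet_const * (4 * \<sigma>) ^ CARD('n) / h\<^sup>2 * Qs v)"
    by (intro mult_left_mono t_bdry_le t_jump_le assms; simp)+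
  moreover have "Cup \<beta> / h\<^sup>2 * Qs v = Cg * unit_ball_vol (real CARD('n)) / h\<^sup>2 * Qs v + 2 * ((Ci + Cg) * C\<Gamma> / h\<^sup>2 * Qs v)
     + \<bar>\<beta>\<bar> * (Ci * C\<Gamma> / h\<^sup>2 * Qs v) + 2 * ((Ci + Cg) * facet_const * (4 * \<sigma>) ^ CARD('n) / h\<^sup>2 * Qs v)
     + \<bar>\<beta>\<bar> * ((2 * Ci) * facet_const * (4 * \<sigma>) ^ CARD('n) / h\<^sup>2 * Qs v)"
  proof -
    have "(A1 + 2 * A2 + b * A3 + 2 * A4 + b * A5) / H * q =
      A1 / H * q + 2 * (A2 / H * q) + b * (A3 / H * q) + 2 * (A4 / H * q) + b * (A5 / H * q)"
      for A1 A2 A3 A4 A5 b H q :: real by (simp add: add_divide_distrib distrib_right)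
    then show ?thesis unfolding Cup_def .
  qed
  ultimately show ?thesis
    unfolding ah_eq using t_vol_le[OF assms] t_flux_le[OF assms] t_avg_le[OF assms] by linarith
qed

end


section \<open>Following a line to the boundary\<close>

lemma sq_sum3_le: "(a + b + c)\<^sup>2 \<le> 3 * (a\<^sup>2 + b\<^sup>2 + c\<^sup>2)" for a b c :: real
proof -
  have "0 \<le> (a - b)\<^sup>2 + (b - c)\<^sup>2 + (a - c)\<^sup>2" by simp
  then show ?thesis by (simp add: power2_eq_square algebra_simps)
qed

context mesh begin

text \<open>The value 0 off \<open>\<Omega>\<close> gives a total nonnegative function whose Borel
  measurability can be stated.\<close>

definition exit_time :: "'n \<Rightarrow> real^'n \<Rightarrow> real" where
  "exit_time i0 x = (if x \<in> \<Omega> then Inf {t. 0 \<le> t \<and> x + t *\<^sub>R axis i0 1 \<notin> \<Omega>} else 0)"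

lemma exit_time:
  assumes "x \<in> \<Omega>"
  shows "0 \<le> exit_time i0 x" "x + exit_time i0 x *\<^sub>R axis i0 1 \<in> frontier \<Omega>"
    "0 \<le> t \<Longrightarrow> t < exit_time i0 x \<Longrightarrow> x + t *\<^sub>R axis i0 1 \<in> \<Omega>"
proof -
  let ?e = "axis i0 (1::real)"
  let ?S = "{t. 0 \<le> t \<and> x + t *\<^sub>R ?e \<notin> \<Omega>}"
  have e: "exit_time i0 x = Inf ?S" using assms by (simp add: exit_time_def)
  have "\<bar>x $ i0\<bar> \<le> R" using component_le_norm_cart[of x i0] \<Omega>(2) assms by (auto intro: order_trans)
  \<comment> \<open>At parameter \<open>2 * R + 1\<close> the coordinate \<open>i0\<close> exceeds
    \<open>R\<close>, so the line has left the ball containing \<open>\<Omega>\<close>.\<close>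
  then have "(x + (2 * R + 1) *\<^sub>R ?e) $ i0 > R" using R by simp
  then have "norm (x + (2 * R + 1) *\<^sub>R ?e) > R"
    using component_le_norm_cart[of "x + (2 * R + 1) *\<^sub>R ?e" i0] by linarith
  then have ne: "2 * R + 1 \<in> ?S" using \<Omega>(2) R by auto
  have bb: "bdd_below ?S" by (rule bdd_belowI[of _ 0]) auto
  have "closed ((\<lambda>t. x + t *\<^sub>R ?e) -` (- \<Omega>))"
    by (rule continuous_closed_vimage) (use \<Omega>(1) in auto)
  then have "closed ({0..} \<inter> (\<lambda>t. x + t *\<^sub>R ?e) -` (- \<Omega>))" by (intro closed_Int) auto
  also have "{0..} \<inter> (\<lambda>t. x + t *\<^sub>R ?e) -` (- \<Omega>) = ?S" by auto
  finally have mem: "Inf ?S \<in> ?S" using ne bb by (intro closed_contains_Inf) auto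
  then show 0: "0 \<le> exit_time i0 x" using e by simp
  have in\<Omega>: "x + t *\<^sub>R ?e \<in> \<Omega>" if "0 \<le> t" "t < exit_time i0 x" for t
    using cInf_lower[OF _ bb, of t] that e by fastforce
  then show "0 \<le> t \<Longrightarrow> t < exit_time i0 x \<Longrightarrow> x + t *\<^sub>R ?e \<in> \<Omega>" .
  let ?\<tau> = "exit_time i0 x"
  have out: "x + ?\<tau> *\<^sub>R ?e \<notin> \<Omega>" using mem e by simp
  then have "?\<tau> \<noteq> 0" using assms by auto
  then have pos: "?\<tau> > 0" using 0 by simp
  have "((\<lambda>t. x + t *\<^sub>R ?e) \<longlongrightarrow> x + ?\<tau> *\<^sub>R ?e) (at_left ?\<tau>)" by (intro tendsto_intros)
  moreover have "\<forall>\<^sub>F t in at_left ?\<tau>. x + t *\<^sub>R ?e \<in> closure \<Omega>"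
    using eventually_at_left_real[OF pos] by eventually_elim (rule subsetD[OF closure_subset], use in\<Omega> in auto)
  ultimately have "x + ?\<tau> *\<^sub>R ?e \<in> closure \<Omega>"
    by (intro Lim_in_closed_set[OF closed_closure]) auto
  then show "x + ?\<tau> *\<^sub>R ?e \<in> frontier \<Omega>" using out \<Omega>(1) by (simp add: frontier_def interior_open)
qed

text \<open>The exit time is lower semicontinuous: it exceeds \<open>y\<close> if and only if the
  compact segment of parameters up to \<open>y\<close> lies in the open set \<open>\<Omega>\<close>,
  which persists for nearby \<open>x\<close>.\<close>

lemma exit_time_borel: "exit_time i0 \<in> borel_measurable borel"
proof (rule borel_measurableI_greater)
  fix y :: real
  let ?e = "axis i0 (1::real)"
  consider "y < 0" | "0 \<le> y" by linarith
  then have "{x. y < exit_time i0 x} \<in> sets borel"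
  proof cases
    case 1
    have "0 \<le> exit_time i0 x" for x using exit_time(1)[of x] by (cases "x \<in> \<Omega>") (auto simp: exit_time_def)
    then have "{x. y < exit_time i0 x} = UNIV" using 1 by (auto intro: less_le_trans)
    then show ?thesis by simp
  next
    case 2
    have e: "{x. y < exit_time i0 x} = {x. \<forall>t\<in>{0..y}. x + t *\<^sub>R ?e \<in> \<Omega>}"
    proof (intro set_eqI iffI; clarify)
      fix x t assume a: "y < exit_time i0 x" "t \<in> {0..y}"
      then have "x \<in> \<Omega>" using 2 by (auto simp: exit_time_def split: if_splits)
      then show "x + t *\<^sub>R ?e \<in> \<Omega>" using a exit_time(3)[of x t i0] by auto
    next
      fix x assume a: "\<forall>t\<in>{0..y}. x + t *\<^sub>R ?e \<in> \<Omega>"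
      then have x: "x \<in> \<Omega>" using 2 by (auto dest: bspec[of _ _ 0])
      show "y < exit_time i0 x"
      proof (rule ccontr)
        assume "\<not> y < exit_time i0 x"
        then have "x + exit_time i0 x *\<^sub>R ?e \<in> \<Omega>" using a exit_time(1)[OF x, of i0] by auto
        then show False using exit_time(2)[OF x, of i0] \<Omega>(1) by (simp add: frontier_def interior_open)
      qed
    qed
    have "open {x. y < exit_time i0 x}"
      unfolding open_contains_ball e
    proof
      fix x assume x: "x \<in> {x. \<forall>t\<in>{0..y}. x + t *\<^sub>R ?e \<in> \<Omega>}"
      have "compact ((\<lambda>t. x + t *\<^sub>R ?e) ` {0..y})" by (intro compact_continuous_image continuous_intros) auto
      moreover have "(\<lambda>t. x + t *\<^sub>R ?e) ` {0..y} \<subseteq> \<Omega>" using x by auto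
      ultimately obtain \<epsilon> where \<epsilon>: "\<epsilon> > 0" "(\<Union>z\<in>(\<lambda>t. x + t *\<^sub>R ?e) ` {0..y}. ball z \<epsilon>) \<subseteq> \<Omega>"
        using compact_subset_open_imp_ball_epsilon_subset[OF _ \<Omega>(1)] by metis
      show "\<exists>\<epsilon>>0. ball x \<epsilon> \<subseteq> {x. \<forall>t\<in>{0..y}. x + t *\<^sub>R ?e \<in> \<Omega>}"
      proof (intro exI[of _ \<epsilon>] conjI subsetI CollectI ballI)
        fix z t assume z: "z \<in> ball x \<epsilon>" and t: "t \<in> {0..y}"
        have "z + t *\<^sub>R ?e \<in> ball (x + t *\<^sub>R ?e) \<epsilon>" using z by (simp add: dist_norm)
        then show "z + t *\<^sub>R ?e \<in> \<Omega>" using \<epsilon>(2) t by blast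
      qed (rule \<epsilon>(1))
    qed
    then show ?thesis by simp
  qed
  then show "{x \<in> space borel. y < exit_time i0 x} \<in> sets borel" by simp
qed

end

section \<open>Jumps, exit values and oscillations as functions of the starting point\<close>

context dg begin

text \<open>One fixed hyperplane per facet makes the crossing point an explicit affine function of
  the starting point.\<close>

definition facet_form :: "(real^'n) set \<times> (real^'n) set \<Rightarrow> (real^'n) \<times> real" where
  "facet_form F = (SOME ab. fst ab \<noteq> 0 \<and> fst F \<inter> snd F \<subseteq> {x. fst ab \<bullet> x = snd ab})"

lemma facet_form:
  assumes "F \<in> \<F>"
  shows "fst (facet_form F) \<noteq> 0" "fst F \<inter> snd F \<subseteq> {x. fst (facet_form F) \<bullet> x = snd (facet_form F)}"
proof -
  obtain T T' where F: "F = (T, T')" by (cases F)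
  have "\<exists>ab. fst ab \<noteq> 0 \<and> fst F \<inter> snd F \<subseteq> {x. fst ab \<bullet> x = snd ab}"
    using Int_hyperplane[OF facet_pairsD(1-3)[OF assms[unfolded F]]] F by auto
  from someI_ex[OF this] show "fst (facet_form F) \<noteq> 0"
    "fst F \<inter> snd F \<subseteq> {x. fst (facet_form F) \<bullet> x = snd (facet_form F)}"
    unfolding facet_form_def by auto
qed

text \<open>The point where the line through \<open>x\<close> meets the hyperplane of the facet; it is \<open>x\<close> itself when they are parallel.\<close>
definition cross :: "'n \<Rightarrow> (real^'n) set \<times> (real^'n) set \<Rightarrow> real^'n \<Rightarrow> real^'n" where
  "cross i0 F x = x + ((snd (facet_form F) - fst (facet_form F) \<bullet> x) / fst (facet_form F) $ i0) *\<^sub>R axis i0 1"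

definition exit_point :: "'n \<Rightarrow> real^'n \<Rightarrow> real^'n" where
  "exit_point i0 x = x + exit_time i0 x *\<^sub>R axis i0 1"

lemma cross_borel: "cross i0 F \<in> borel_measurable borel"
proof (rule borel_measurable_continuous_onI)
  show "continuous_on UNIV (cross i0 F)"
    unfolding cross_def[abs_def] divide_inverse by (intro continuous_intros)
qed

lemma exit_point_borel: "exit_point i0 \<in> borel_measurable borel"
  unfolding exit_point_def[abs_def] using exit_time_borel
  by (intro borel_measurable_add borel_measurable_scaleR borel_measurable_const) auto

text \<open>A transversal line can meet the facet only at \<open>cross i0 F x\<close>; the indicator
  discards it when it misses the facet part in \<open>\<Omega>\<close>. This gives a Borel function
  of \<open>x\<close> in place of the jump met on the way.\<close>

definition jump_at :: "'n \<Rightarrow> 'n dgfun \<Rightarrow> (real^'n) set \<times> (real^'n) set \<Rightarrow> real^'n \<Rightarrow> real" where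
  "jump_at i0 v F x = (let y = cross i0 F x in
     indicator (fst F \<inter> snd F \<inter> \<Omega>) y * \<bar>v (fst F) y - v (snd F) y\<bar>)"

definition exit_value :: "'n \<Rightarrow> 'n dgfun \<Rightarrow> (real^'n) set \<Rightarrow> real^'n \<Rightarrow> real" where
  "exit_value i0 v T x = (let y = exit_point i0 x in indicator (frontier \<Omega> \<inter> T) y * \<bar>v T y\<bar>)"

text \<open>Diameter times a bound for the gradient. The absolute value makes it nonnegative for
  every \<open>T\<close>, as \<open>walk_bound\<close> asks.\<close>

definition osc :: "'n dgfun \<Rightarrow> (real^'n) set \<Rightarrow> real" where
  "osc v T = h * sqrt (Ci / h ^ CARD('n) * \<bar>D v T\<bar>)"

text \<open>A box containing every starting point in \<open>\<Omega>\<close> whose line in direction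
  \<open>i0\<close> meets \<open>T\<close>.\<close>

definition near_line :: "'n \<Rightarrow> (real^'n) set \<Rightarrow> (real^'n) set" where
  "near_line i0 T = {y. (\<forall>j. j \<noteq> i0 \<longrightarrow> \<bar>y $ j - ctr T $ j\<bar> \<le> h) \<and> \<bar>y $ i0\<bar> \<le> R}"

text \<open>The factor in front of the jumps is the number of neighbours of an element, paid when
  the square is moved inside its facet sum.\<close>

definition walk_sum :: "'n \<Rightarrow> 'n dgfun \<Rightarrow> real^'n \<Rightarrow> real" where
  "walk_sum i0 v x = (\<Sum>T\<in>\<T>. (osc v T)\<^sup>2 * indicator (near_line i0 T) x)
     + (4 * \<sigma>) ^ CARD('n) * (\<Sum>F\<in>\<F>. (jump_at i0 v F x)\<^sup>2) + (\<Sum>T\<in>\<T>. (exit_value i0 v T x)\<^sup>2)"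

lemma osc_bound:
  assumes "v \<in> V" "T \<in> \<T>" "y \<in> T" "z \<in> T" shows "\<bar>v T y - v T z\<bar> \<le> osc v T"
proof -
  have TM: "T \<in> M" using assms active_M by blast
  define K where "K = sqrt (Ci / h ^ CARD('n) * \<bar>D v T\<bar>)"
  have "norm (v T y - v T z) \<le> K * norm (y - z)"
  proof (rule differentiable_bound[of T "v T" "\<lambda>x h. grad (v T) x \<bullet> h"])
    show "convex T" by (rule M_convex[OF TM])
    fix x assume x: "x \<in> T"
    show "(v T has_derivative (\<lambda>h. grad (v T) x \<bullet> h)) (at x within T)"
      by (rule has_derivative_at_withinI[OF poly_has_derivative_grad[OF V_poly[OF assms(1)]]])
    have "(norm (grad (v T) x))\<^sup>2 \<le> Ci / h ^ CARD('n) * \<bar>D v T\<bar>"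
      using grad_sq_le_D[OF assms(1) TM x] D_nonneg[OF assms(1) TM] by simp
    then have g: "norm (grad (v T) x) \<le> K" unfolding K_def by (rule real_le_rsqrt)
    show "onorm (\<lambda>h. grad (v T) x \<bullet> h) \<le> K"
    proof (rule onorm_le)
      fix w
      have "\<bar>grad (v T) x \<bullet> w\<bar> \<le> norm (grad (v T) x) * norm w" by (rule Cauchy_Schwarz_ineq2)
      also have "\<dots> \<le> K * norm w" using g by (rule mult_right_mono) simp
      finally show "norm (grad (v T) x \<bullet> w) \<le> K * norm w" by simp
    qed
  qed (use assms in auto)
  also have "\<dots> \<le> K * h"
    using M_dist[OF TM assms(3,4)] unfolding K_def
    by (intro mult_left_mono) (auto simp: dist_norm Ci_pos[THEN less_imp_le] h_pos[THEN less_imp_le])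
  finally show ?thesis by (simp add: osc_def K_def mult.commute)
qed

text \<open>Cauchy-Schwarz over the elements on the line costs their number
  \<open>line_const / h\<close>, the splitting into oscillation, jumps and exit value costs the
  factor 3, and a further Cauchy-Schwarz treats the facets of each element.\<close>

lemma pointwise_walk_bound:
  assumes v: "v \<in> V" and x: "x \<in> \<Omega>" "x \<notin> bad_lines i0" and T: "T \<in> \<T>" "x \<in> T"
  shows "(v T x)\<^sup>2 \<le> 3 * line_const / h * walk_sum i0 v x"
proof -
  let ?e = "axis i0 (1::real)"
  define A where "A = {T\<in>\<T>. \<exists>t. x + t *\<^sub>R ?e \<in> T}"
  define o' where "o' = osc v"
  define j where "j = (\<lambda>T. \<Sum>T'\<in>{T'. (T, T') \<in> \<F>}. jump_at i0 v (T, T') x)"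
  define e' where "e' = (\<lambda>T. exit_value i0 v T x)"
  have finA: "finite A" by (simp add: A_def)
  have jn: "0 \<le> jump_at i0 v F x" for F by (simp add: jump_at_def Let_def)
  have "\<bar>v T (x + 0 *\<^sub>R ?e)\<bar> \<le> (\<Sum>T\<in>{T\<in>\<T>. \<exists>t. x + t *\<^sub>R ?e \<in> T}.
     osc v T + (\<Sum>T'\<in>{T'. (T, T') \<in> \<F>}. jump_at i0 v (T, T') x) + exit_value i0 v T x)"
  proof (rule walk_bound[where v=v and ?i0.0=i0 and \<tau>="exit_time i0 x" and jmp="\<lambda>F. jump_at i0 v F x" and ext="\<lambda>T. exit_value i0 v T x" and osc="osc v"])
    show "x \<notin> bad_lines i0" by fact
    show "\<And>t. 0 \<le> t \<Longrightarrow> t < exit_time i0 x \<Longrightarrow> x + t *\<^sub>R ?e \<in> \<Omega>" using exit_time(3)[OF x(1)] .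
    show "\<And>T y z. T \<in> \<T> \<Longrightarrow> y \<in> T \<Longrightarrow> z \<in> T \<Longrightarrow> \<bar>v T y - v T z\<bar> \<le> osc v T" by (rule osc_bound[OF v])
    show "\<And>T. 0 \<le> osc v T" using h_pos Ci_pos by (simp add: osc_def)
    show "\<And>F. 0 \<le> jump_at i0 v F x" by (rule jn)
    show "\<And>T. 0 \<le> exit_value i0 v T x" by (simp add: exit_value_def Let_def)
    show "T \<in> \<T>" "x + 0 *\<^sub>R ?e \<in> T" using T by auto
    show "(0::real) \<le> 0" "0 \<le> exit_time i0 x" using exit_time(1)[OF x(1)] by auto
    show "\<And>T. T \<in> \<T> \<Longrightarrow> x + exit_time i0 x *\<^sub>R ?e \<in> T \<Longrightarrow> \<bar>v T (x + exit_time i0 x *\<^sub>R ?e)\<bar> \<le> exit_value i0 v T x"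
      using exit_time(2)[OF x(1), of i0] by (simp add: exit_value_def exit_point_def)
    fix T T' t assume F: "(T, T') \<in> \<F>" and m: "x + t *\<^sub>R ?e \<in> T \<inter> T' \<inter> \<Omega>"
    note FT = facet_pairsD[OF F] and ff = facet_form[OF F]
    define a where "a = fst (facet_form (T, T'))"
    define b where "b = snd (facet_form (T, T'))"
    have ab: "a \<noteq> 0" "T \<inter> T' \<subseteq> {x. a \<bullet> x = b}" using ff by (auto simp: a_def b_def)
    \<comment> \<open>Off \<open>bad_lines\<close> the facet is transversal to the line, so its
      hyperplane determines \<open>t\<close>, and \<open>cross\<close> returns the very point of the
      walk.\<close>
    have "a $ i0 \<noteq> 0"
      using generic_crossing(2)[OF x(2), of t T T' a b] m FT ab by blast
    moreover have "a \<bullet> (x + t *\<^sub>R ?e) = b" using ab(2) m by blast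
    then have "a \<bullet> x + t * a $ i0 = b" by (simp add: inner_add_right inner_axis)
    ultimately have "(b - a \<bullet> x) / a $ i0 = t" by (simp add: field_simps)
    then have "cross i0 (T, T') x = x + t *\<^sub>R ?e" by (simp add: cross_def a_def b_def)
    then show "\<bar>v T (x + t *\<^sub>R ?e) - v T' (x + t *\<^sub>R ?e)\<bar> \<le> jump_at i0 v (T, T') x"
      using m by (simp add: jump_at_def Let_def)
  qed
  then have le: "\<bar>v T x\<bar> \<le> (\<Sum>T\<in>A. o' T + j T + e' T)" by (simp add: A_def o'_def j_def e'_def)
  have "(v T x)\<^sup>2 = \<bar>v T x\<bar>\<^sup>2" by simp
  also have "\<dots> \<le> (\<Sum>T\<in>A. o' T + j T + e' T)\<^sup>2" using le by (rule power_mono) simp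
  also have "\<dots> \<le> (\<Sum>T\<in>A. (o' T + j T + e' T)\<^sup>2) * real (card A)" by (rule sum_squared_le_sum_of_squares)
  also have "\<dots> \<le> (3 * walk_sum i0 v x) * (line_const / h)"
  proof (rule mult_mono)
    show "real (card A) \<le> line_const / h" unfolding A_def by (rule card_line_le)
    have jT: "(j T)\<^sup>2 \<le> (4 * \<sigma>) ^ CARD('n) * (\<Sum>T'\<in>{T'. (T, T') \<in> \<F>}. (jump_at i0 v (T, T') x)\<^sup>2)" if "T \<in> \<T>" for T
    proof -
      have "(j T)\<^sup>2 \<le> (\<Sum>T'\<in>{T'. (T, T') \<in> \<F>}. (jump_at i0 v (T, T') x)\<^sup>2) * real (card {T'. (T, T') \<in> \<F>})"
        unfolding j_def by (rule sum_squared_le_sum_of_squares)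
      also have "\<dots> \<le> (\<Sum>T'\<in>{T'. (T, T') \<in> \<F>}. (jump_at i0 v (T, T') x)\<^sup>2) * (4 * \<sigma>) ^ CARD('n)"
        using card_facet_neighbours[OF that] by (intro mult_left_mono sum_nonneg) auto
      finally show ?thesis by (simp add: mult.commute)
    qed
    have near: "x \<in> near_line i0 T" if "T \<in> A" for T
    proof -
      obtain t where t: "T \<in> \<T>" "x + t *\<^sub>R ?e \<in> T" using \<open>T \<in> A\<close> by (auto simp: A_def)
      have n: "norm (x + t *\<^sub>R ?e - ctr T) \<le> h"
        using ctr_outer[OF active_M[OF t(1)]] t(2) by (auto simp: dist_norm norm_minus_commute)
      have "\<bar>x $ j - ctr T $ j\<bar> \<le> h" if "j \<noteq> i0" for j
        using order_trans[OF component_le_norm_cart[of "x + t *\<^sub>R ?e - ctr T" j] n] that by (simp add: axis_def)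
      moreover have "\<bar>x $ i0\<bar> \<le> R" using component_le_norm_cart[of x i0] \<Omega>(2) x(1) by (auto intro: order_trans)
      ultimately show ?thesis by (simp add: near_line_def)
    qed
    have "(\<Sum>T\<in>A. (o' T + j T + e' T)\<^sup>2) \<le> (\<Sum>T\<in>A. 3 * ((o' T)\<^sup>2 + (j T)\<^sup>2 + (e' T)\<^sup>2))"
      by (intro sum_mono sq_sum3_le)
    also have "\<dots> = 3 * ((\<Sum>T\<in>A. (o' T)\<^sup>2) + (\<Sum>T\<in>A. (j T)\<^sup>2) + (\<Sum>T\<in>A. (e' T)\<^sup>2))"
      by (simp add: sum.distrib sum_distrib_left)
    also have "\<dots> \<le> 3 * walk_sum i0 v x"
      unfolding walk_sum_def
    proof (intro mult_left_mono add_mono)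
      have "(\<Sum>T\<in>A. (o' T)\<^sup>2) = (\<Sum>T\<in>A. (osc v T)\<^sup>2 * indicator (near_line i0 T) x)"
        using near by (intro sum.cong) (auto simp: o'_def)
      also have "\<dots> \<le> (\<Sum>T\<in>\<T>. (osc v T)\<^sup>2 * indicator (near_line i0 T) x)"
        by (rule sum_mono2) (auto simp: A_def)
      finally show "(\<Sum>T\<in>A. (o' T)\<^sup>2) \<le> (\<Sum>T\<in>\<T>. (osc v T)\<^sup>2 * indicator (near_line i0 T) x)" .
      have "(\<Sum>T\<in>A. (j T)\<^sup>2) \<le> (\<Sum>T\<in>\<T>. (j T)\<^sup>2)" by (rule sum_mono2) (auto simp: A_def)
      also have "\<dots> \<le> (\<Sum>T\<in>\<T>. (4 * \<sigma>) ^ CARD('n) * (\<Sum>T'\<in>{T'. (T, T') \<in> \<F>}. (jump_at i0 v (T, T') x)\<^sup>2))"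
        by (rule sum_mono[OF jT])
      also have "\<dots> = (4 * \<sigma>) ^ CARD('n) * (\<Sum>F\<in>\<F>. (jump_at i0 v F x)\<^sup>2)"
        by (subst sum_facets_nested) (simp add: sum_distrib_left)
      finally show "(\<Sum>T\<in>A. (j T)\<^sup>2) \<le> (4 * \<sigma>) ^ CARD('n) * (\<Sum>F\<in>\<F>. (jump_at i0 v F x)\<^sup>2)" .
      show "(\<Sum>T\<in>A. (e' T)\<^sup>2) \<le> (\<Sum>T\<in>\<T>. (exit_value i0 v T x)\<^sup>2)"
        unfolding e'_def by (rule sum_mono2) (auto simp: A_def)
    qed simp
    finally show "(\<Sum>T\<in>A. (o' T + j T + e' T)\<^sup>2) \<le> 3 * walk_sum i0 v x" .
    then show "0 \<le> 3 * walk_sum i0 v x" by (rule order_trans[rotated]) (simp add: sum_nonneg)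
  qed auto
  finally show ?thesis by (simp add: mult_ac)
qed

end


section \<open>The broken Poincare inequality\<close>

lemma negligible_AE: "negligible S \<Longrightarrow> AE x in lborel. x \<notin> S"
  using AE_not_in[of S lebesgue] AE_completion_iff[of "\<lambda>x. x \<notin> S" lborel]
  by (simp add: negligible_iff_null_sets)

lemma nn_integral_surf_int:
  assumes "set_integrable (haus s) A f" "\<And>x. x \<in> A \<Longrightarrow> 0 \<le> f x"
  shows "(\<integral>\<^sup>+x. ennreal (indicator A x * f x) \<partial>haus s) = ennreal (surf_int s A f)"
  unfolding surf_int_def set_lebesgue_integral_def
  using assms by (subst nn_integral_eq_integral) (auto simp: set_integrable_def indicator_def)

lemma nn_integral_add_mult_add:
  fixes f :: "'i \<Rightarrow> 'a \<Rightarrow> ennreal" and g :: "'j \<Rightarrow> 'a \<Rightarrow> ennreal"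
  assumes "\<And>i. i \<in> I \<Longrightarrow> f i \<in> borel_measurable N" "\<And>j. j \<in> J \<Longrightarrow> g j \<in> borel_measurable N"
    "\<And>i. i \<in> I \<Longrightarrow> l i \<in> borel_measurable N"
  shows "(\<integral>\<^sup>+x. a * ((\<Sum>i\<in>I. f i x) + b * (\<Sum>j\<in>J. g j x) + (\<Sum>i\<in>I. l i x)) \<partial>N) =
    a * ((\<Sum>i\<in>I. \<integral>\<^sup>+x. f i x \<partial>N) + b * (\<Sum>j\<in>J. \<integral>\<^sup>+x. g j x \<partial>N) + (\<Sum>i\<in>I. \<integral>\<^sup>+x. l i x \<partial>N))"
proof -
  have m: "(\<lambda>x. \<Sum>i\<in>I. f i x) \<in> borel_measurable N" "(\<lambda>x. \<Sum>j\<in>J. g j x) \<in> borel_measurable N"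
    "(\<lambda>x. \<Sum>i\<in>I. l i x) \<in> borel_measurable N"
    using assms by (auto intro!: borel_measurable_sum)
  then show ?thesis using assms
    by (simp add: nn_integral_cmult nn_integral_add nn_integral_sum borel_measurable_add borel_measurable_times)
qed

lemma ennreal_add_mult_add:
  assumes "0 \<le> A" "0 \<le> B" "0 \<le> C" "0 \<le> N"
  shows "ennreal A + ennreal N * ennreal B + ennreal C = ennreal (A + N * B + C)"
proof -
  have "ennreal N * ennreal B = ennreal (N * B)" using assms by (intro ennreal_mult[symmetric])
  moreover have "ennreal A + ennreal (N * B) = ennreal (A + N * B)"
    using assms by (intro ennreal_plus[symmetric]) auto
  moreover have "ennreal (A + N * B) + ennreal C = ennreal (A + N * B + C)"
    using assms by (intro ennreal_plus[symmetric] add_nonneg_nonneg mult_nonneg_nonneg)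
  ultimately show ?thesis by simp
qed

lemma surf_int_square_div: "surf_int s A (\<lambda>x. f x * f x / c) = surf_int s A (\<lambda>x. (f x)\<^sup>2) / c"
  by (simp add: surf_int_def set_lebesgue_integral_def power2_eq_square)

context dg begin

lemma walk_sum_nonneg: "0 \<le> walk_sum i0 v x"
  unfolding walk_sum_def using \<sigma> by (intro add_nonneg_nonneg mult_nonneg_nonneg sum_nonneg) auto

text \<open>Almost every point avoids the bad lines and all mutual intersections of elements, so at
  most one summand on the left is nonzero.\<close>

lemma AE_walk_bound:
  assumes "v \<in> V"
  shows "AE x in lborel. (\<Sum>T\<in>\<T>. indicator (T \<inter> \<Omega>) x * (v T x)\<^sup>2)
     \<le> indicator \<Omega> x * (3 * line_const / h * walk_sum i0 v x)"
proof -
  define O' where "O' = (\<Union>{T \<inter> T' | T T'. T \<in> M \<and> T' \<in> M \<and> T \<noteq> T'})"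
  have "negligible O'" unfolding O'_def
  proof (rule negligible_Union)
    have "{T \<inter> T' | T T'. T \<in> M \<and> T' \<in> M \<and> T \<noteq> T'} \<subseteq> (\<lambda>(T, T'). T \<inter> T') ` (M \<times> M)" by auto
    then show "finite {T \<inter> T' | T T'. T \<in> M \<and> T' \<in> M \<and> T \<noteq> T'}" by (rule finite_subset) auto
  qed (use Int_negligible in auto)
  then have "AE x in lborel. x \<notin> bad_lines i0 \<union> O'"
    by (intro negligible_AE negligible_Un negligible_bad_lines)
  then show ?thesis
  proof (rule AE_mp, intro AE_I2 impI)
    fix x assume x: "x \<notin> bad_lines i0 \<union> O'"
    show "(\<Sum>T\<in>\<T>. indicator (T \<inter> \<Omega>) x * (v T x)\<^sup>2) \<le> indicator \<Omega> x * (3 * line_const / h * walk_sum i0 v x)"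
    proof (cases "x \<in> \<Omega>")
      case True
      obtain T where T: "T \<in> \<T>" "x \<in> T" using \<Omega>_cover[OF True] by blast
      have "x \<notin> T'" if "T' \<in> \<T>" "T' \<noteq> T" for T'
        using x T that active_M unfolding O'_def by blast
      then have "(\<Sum>T'\<in>\<T>. indicator (T' \<inter> \<Omega>) x * (v T' x)\<^sup>2) = (\<Sum>T'\<in>\<T>. if T' = T then (v T x)\<^sup>2 else 0)"
        using T True by (intro sum.cong) (auto simp: indicator_def)
      also have "\<dots> = (v T x)\<^sup>2" using T by simp
      also have "\<dots> \<le> 3 * line_const / h * walk_sum i0 v x"
        using pointwise_walk_bound[OF assms True _ T] x by blast
      finally show ?thesis using True by simp
    qed simp
  qed
qed

lemma near_line_emeasure:
  "near_line i0 T \<in> sets borel" "emeasure lborel (near_line i0 T) = ennreal (2 * R * 2 ^ (CARD('n) - 1) * p)"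
  unfolding near_line_def using h_pos R
  by (auto intro!: borel_slab_box simp: emeasure_lborel_slab_box power_mult_distrib mult.assoc)

definition jump_int :: "'n dgfun \<Rightarrow> (real^'n) set \<times> (real^'n) set \<Rightarrow> real" where
  "jump_int v F = surf_int (real CARD('n) - 1) (fst F \<inter> snd F \<inter> \<Omega>) (\<lambda>x. (v (fst F) x - v (snd F) x)\<^sup>2)"

definition bdry_int :: "'n dgfun \<Rightarrow> (real^'n) set \<Rightarrow> real" where
  "bdry_int v T = surf_int (real CARD('n) - 1) (frontier \<Omega> \<inter> T) (\<lambda>x. (v T x)\<^sup>2)"

definition tc :: real where "tc = tube_const TYPE('n) * R"

text \<open>\<open>cross\<close> changes only the coordinate \<open>i0\<close>, so the tube estimate
  converts the volume integral over starting points into the surface integral over the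
  facet.\<close>

lemma nn_integral_jump_le:
  assumes "v \<in> V" "F \<in> \<F>"
  shows "(\<integral>\<^sup>+x. ennreal ((jump_at i0 v F x)\<^sup>2) * indicator \<Omega> x \<partial>lborel) \<le> ennreal (tc * jump_int v F)"
    "(\<lambda>x. ennreal ((jump_at i0 v F x)\<^sup>2)) \<in> borel_measurable borel" "0 \<le> jump_int v F"
proof -
  obtain T T' where F: "F = (T, T')" "(T, T') \<in> \<F>" using assms(2) by (cases F) auto
  let ?A = "T \<inter> T' \<inter> \<Omega>"
  define f where "f = (\<lambda>y. ennreal (indicator ?A y * (v T y - v T' y)\<^sup>2))"
  have cont: "continuous_on UNIV (\<lambda>y. (v T y - v T' y)\<^sup>2)" by (intro continuous_intros V_continuous assms)
  have f: "f \<in> borel_measurable borel" unfolding f_def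
    using borel_measurable_continuous_onI[OF cont] facet_borel[OF F(2)] by simp
  have e: "ennreal ((jump_at i0 v F x)\<^sup>2) = f (cross i0 F x)" for x
    by (simp add: jump_at_def Let_def f_def F power_mult_distrib indicator_def)
  show "(\<lambda>x. ennreal ((jump_at i0 v F x)\<^sup>2)) \<in> borel_measurable borel"
    unfolding e using measurable_compose[OF cross_borel f] .
  show j0: "0 \<le> jump_int v F" unfolding jump_int_def surf_int_def set_lebesgue_integral_def
    by (intro integral_nonneg_AE AE_I2) (auto simp: indicator_def)
  have "(\<integral>\<^sup>+x. f (cross i0 F x) * indicator \<Omega> x \<partial>lborel) \<le> ennreal tc * (\<integral>\<^sup>+x. f x \<partial>haus (real CARD('n) - 1))"
    unfolding tc_def by (rule nn_integral_tube_le[where ?i0.0=i0, OF \<Omega>(2) \<Omega>_borel R d _ cross_borel f])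
      (simp add: cross_def axis_def)
  also have "(\<integral>\<^sup>+x. f x \<partial>haus (real CARD('n) - 1)) = ennreal (jump_int v F)"
    unfolding f_def jump_int_def F fst_conv snd_conv
    by (rule nn_integral_surf_int[OF facet_integrable[OF F(2) cont]]) simp
  also have "ennreal tc * ennreal (jump_int v F) = ennreal (tc * jump_int v F)"
    using j0 by (rule ennreal_mult''[symmetric])
  finally show "(\<integral>\<^sup>+x. ennreal ((jump_at i0 v F x)\<^sup>2) * indicator \<Omega> x \<partial>lborel) \<le> ennreal (tc * jump_int v F)"
    unfolding e .
qed

text \<open>The same for \<open>exit_point\<close>; only its measurability was needed, since the
  tube estimate asks for no regularity.\<close>

lemma nn_integral_exit_le:
  assumes "v \<in> V" "T \<in> \<T>"
  shows "(\<integral>\<^sup>+x. ennreal ((exit_value i0 v T x)\<^sup>2) * indicator \<Omega> x \<partial>lborel) \<le> ennreal (tc * bdry_int v T)"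
    "(\<lambda>x. ennreal ((exit_value i0 v T x)\<^sup>2)) \<in> borel_measurable borel" "0 \<le> bdry_int v T"
proof -
  note TM = active_M[OF assms(2)]
  let ?A = "frontier \<Omega> \<inter> T"
  define f where "f = (\<lambda>y. ennreal (indicator ?A y * (v T y)\<^sup>2))"
  have cont: "continuous_on B (\<lambda>y. (v T y)\<^sup>2)" for B by (intro continuous_intros V_continuous assms)
  have f: "f \<in> borel_measurable borel" unfolding f_def
    using borel_measurable_continuous_onI[OF cont] frontier_T(2)[OF TM] by simp
  have e: "ennreal ((exit_value i0 v T x)\<^sup>2) = f (exit_point i0 x)" for x
    by (simp add: exit_value_def Let_def f_def power_mult_distrib indicator_def)
  show "(\<lambda>x. ennreal ((exit_value i0 v T x)\<^sup>2)) \<in> borel_measurable borel"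
    unfolding e using measurable_compose[OF exit_point_borel f] .
  show j0: "0 \<le> bdry_int v T" unfolding bdry_int_def surf_int_def set_lebesgue_integral_def
    by (intro integral_nonneg_AE AE_I2) (auto simp: indicator_def)
  have "(\<integral>\<^sup>+x. f (exit_point i0 x) * indicator \<Omega> x \<partial>lborel) \<le> ennreal tc * (\<integral>\<^sup>+x. f x \<partial>haus (real CARD('n) - 1))"
    unfolding tc_def by (rule nn_integral_tube_le[where ?i0.0=i0, OF \<Omega>(2) \<Omega>_borel R d _ exit_point_borel f])
      (simp add: exit_point_def axis_def)
  also have "(\<integral>\<^sup>+x. f x \<partial>haus (real CARD('n) - 1)) = ennreal (bdry_int v T)"
    unfolding f_def bdry_int_def
    by (rule nn_integral_surf_int[OF frontier_integrable[OF TM cont]]) simp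
  also have "ennreal tc * ennreal (bdry_int v T) = ennreal (tc * bdry_int v T)"
    using j0 by (rule ennreal_mult''[symmetric])
  finally show "(\<integral>\<^sup>+x. ennreal ((exit_value i0 v T x)\<^sup>2) * indicator \<Omega> x \<partial>lborel) \<le> ennreal (tc * bdry_int v T)"
    unfolding e .
qed

lemma tc_pos: "tc > 0"
  unfolding tc_def tube_const_def using R hnorm_pos[of "real CARD('n) - 1"] d by simp

text \<open>Integrated over nonnegative extended reals, where sums and integrals may be exchanged on
  measurability alone; finiteness is read off at the end.\<close>

lemma integrated_walk_bound:
  assumes v: "v \<in> V"
  shows "(\<Sum>T\<in>\<T>. integral (T \<inter> \<Omega>) (\<lambda>x. (v T x)\<^sup>2)) \<le> 3 * line_const / h *
    ((\<Sum>T\<in>\<T>. (osc v T)\<^sup>2 * (2 * R * 2 ^ (CARD('n) - 1) * p))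
      + (4 * \<sigma>) ^ CARD('n) * (\<Sum>F\<in>\<F>. tc * jump_int v F) + (\<Sum>T\<in>\<T>. tc * bdry_int v T))"
    (is "?L \<le> ?K * (?a + ?N * ?b + ?c)")
proof -
  \<comment> \<open>Any coordinate direction will do.\<close>
  obtain i0 :: 'n where True by blast
  have K: "?K > 0" using line_const_pos h_pos by simp
  have N: "?N > 0" using \<sigma> by simp
  have abc: "0 \<le> ?a" "0 \<le> ?b" "0 \<le> ?c"
    using R p_pos tc_pos nn_integral_jump_le(3)[OF v] nn_integral_exit_le(3)[OF v]
    by (auto intro!: sum_nonneg mult_nonneg_nonneg simp del: zero_le_mult_iff)
  have int: "set_integrable lborel (T \<inter> \<Omega>) (\<lambda>x. (v T x)\<^sup>2)"
    "integral (T \<inter> \<Omega>) (\<lambda>x. (v T x)\<^sup>2) = (LINT x:T \<inter> \<Omega>|lborel. (v T x)\<^sup>2)" if "T \<in> \<T>" for T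
  proof -
    have "continuous_on UNIV (\<lambda>x. (v T x)\<^sup>2)" by (intro continuous_on_power V_continuous v)
    moreover have "T \<inter> \<Omega> \<in> sets borel" "bounded (T \<inter> \<Omega>)"
      using that active_M M_borel M_bounded \<Omega>_borel by auto
    ultimately show "set_integrable lborel (T \<inter> \<Omega>) (\<lambda>x. (v T x)\<^sup>2)"
      "integral (T \<inter> \<Omega>) (\<lambda>x. (v T x)\<^sup>2) = (LINT x:T \<inter> \<Omega>|lborel. (v T x)\<^sup>2)"
      by (rule continuous_integrable_lborel(1), rule continuous_integrable_lborel(3))
  qed
  have "ennreal ?L = (\<Sum>T\<in>\<T>. ennreal (integral (T \<inter> \<Omega>) (\<lambda>x. (v T x)\<^sup>2)))"
    using int by (subst sum_ennreal) (auto simp: set_lebesgue_integral_def intro!: integral_nonneg_AE)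
  also have "\<dots> = (\<Sum>T\<in>\<T>. \<integral>\<^sup>+x. ennreal (indicator (T \<inter> \<Omega>) x * (v T x)\<^sup>2) \<partial>lborel)"
    using int by (intro sum.cong refl) (auto simp: set_lebesgue_integral_def set_integrable_def nn_integral_eq_integral)
  also have "\<dots> = (\<integral>\<^sup>+x. (\<Sum>T\<in>\<T>. ennreal (indicator (T \<inter> \<Omega>) x * (v T x)\<^sup>2)) \<partial>lborel)"
    using int by (intro nn_integral_sum[symmetric]) (auto simp: set_integrable_def dest!: borel_measurable_integrable)
  also have "\<dots> = (\<integral>\<^sup>+x. ennreal (\<Sum>T\<in>\<T>. indicator (T \<inter> \<Omega>) x * (v T x)\<^sup>2) \<partial>lborel)"
    by (intro nn_integral_cong sum_ennreal) simp
  also have "\<dots> \<le> (\<integral>\<^sup>+x. ennreal (indicator \<Omega> x * (?K * walk_sum i0 v x)) \<partial>lborel)"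
    using AE_walk_bound[OF v, of i0] by (intro nn_integral_mono_AE) (auto elim!: eventually_mono intro: ennreal_leI)
  \<comment> \<open>Jumps and exit values keep the factor \<open>indicator \<Omega>\<close> required
    by the tube estimate; the oscillations are localised by their boxes instead.\<close>
  also have "\<dots> \<le> (\<integral>\<^sup>+x. ennreal ?K * ((\<Sum>T\<in>\<T>. ennreal ((osc v T)\<^sup>2) * indicator (near_line i0 T) x)
     + ennreal ?N * (\<Sum>F\<in>\<F>. ennreal ((jump_at i0 v F x)\<^sup>2) * indicator \<Omega> x)
     + (\<Sum>T\<in>\<T>. ennreal ((exit_value i0 v T x)\<^sup>2) * indicator \<Omega> x)) \<partial>lborel)"
  proof (rule nn_integral_mono)
    fix x :: "real^'n"
    have w: "ennreal (walk_sum i0 v x) = (\<Sum>T\<in>\<T>. ennreal ((osc v T)\<^sup>2) * indicator (near_line i0 T) x)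
     + ennreal ?N * (\<Sum>F\<in>\<F>. ennreal ((jump_at i0 v F x)\<^sup>2)) + (\<Sum>T\<in>\<T>. ennreal ((exit_value i0 v T x)\<^sup>2))"
    proof -
      have "(\<Sum>T\<in>\<T>. ennreal ((osc v T)\<^sup>2) * indicator (near_line i0 T) x) = ennreal (\<Sum>T\<in>\<T>. (osc v T)\<^sup>2 * indicator (near_line i0 T) x)"
        by (subst sum_ennreal[symmetric]) (auto simp: indicator_def)
      moreover have "(\<Sum>F\<in>\<F>. ennreal ((jump_at i0 v F x)\<^sup>2)) = ennreal (\<Sum>F\<in>\<F>. (jump_at i0 v F x)\<^sup>2)"
        by (rule sum_ennreal) simp
      moreover have "(\<Sum>T\<in>\<T>. ennreal ((exit_value i0 v T x)\<^sup>2)) = ennreal (\<Sum>T\<in>\<T>. (exit_value i0 v T x)\<^sup>2)"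
        by (rule sum_ennreal) simp
      ultimately show ?thesis
        unfolding walk_sum_def using N by (simp only:) (intro ennreal_add_mult_add[symmetric] sum_nonneg; simp)
    qed
    have e: "ennreal (?K * walk_sum i0 v x) = ennreal ?K * ennreal (walk_sum i0 v x)"
      using K walk_sum_nonneg[of i0 v x] by (intro ennreal_mult) auto
    show "ennreal (indicator \<Omega> x * (?K * walk_sum i0 v x)) \<le>
      ennreal ?K * ((\<Sum>T\<in>\<T>. ennreal ((osc v T)\<^sup>2) * indicator (near_line i0 T) x)
     + ennreal ?N * (\<Sum>F\<in>\<F>. ennreal ((jump_at i0 v F x)\<^sup>2) * indicator \<Omega> x)
     + (\<Sum>T\<in>\<T>. ennreal ((exit_value i0 v T x)\<^sup>2) * indicator \<Omega> x))"
    proof (cases "x \<in> \<Omega>")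
      case True
      then show ?thesis by (simp only: indicator_simps(1) mult_1_left mult_1_right e w order_refl)
    next
      case False
      then show ?thesis by (simp only: indicator_simps(2) not_False_eq_True mult_zero_left ennreal_0 zero_le)
    qed
  qed
  also have "\<dots> = ennreal ?K * ((\<Sum>T\<in>\<T>. ennreal ((osc v T)\<^sup>2) * emeasure lborel (near_line i0 T))
     + ennreal ?N * (\<Sum>F\<in>\<F>. \<integral>\<^sup>+x. ennreal ((jump_at i0 v F x)\<^sup>2) * indicator \<Omega> x \<partial>lborel)
     + (\<Sum>T\<in>\<T>. \<integral>\<^sup>+x. ennreal ((exit_value i0 v T x)\<^sup>2) * indicator \<Omega> x \<partial>lborel))"
  proof -
    have m1: "(\<lambda>x. ennreal ((osc v T)\<^sup>2) * indicator (near_line i0 T) x) \<in> borel_measurable lborel" if "T \<in> \<T>" for T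
      using near_line_emeasure(1) by simp
    have m2: "(\<lambda>x. ennreal ((jump_at i0 v F x)\<^sup>2) * indicator \<Omega> x) \<in> borel_measurable lborel" if "F \<in> \<F>" for F
      using nn_integral_jump_le(2)[OF v that] \<Omega>_borel by simp
    have m3: "(\<lambda>x. ennreal ((exit_value i0 v T x)\<^sup>2) * indicator \<Omega> x) \<in> borel_measurable lborel" if "T \<in> \<T>" for T
      using nn_integral_exit_le(2)[OF v that] \<Omega>_borel by simp
    have n: "(\<integral>\<^sup>+x. ennreal ((osc v T)\<^sup>2) * indicator (near_line i0 T) x \<partial>lborel) = ennreal ((osc v T)\<^sup>2) * emeasure lborel (near_line i0 T)" for T
      using near_line_emeasure(1) by (intro nn_integral_cmult_indicator) simp
    show ?thesis
    proof (subst nn_integral_add_mult_add, goal_cases)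
      case (1 T) then show ?case by (rule m1)
    next
      case (2 F) then show ?case by (rule m2)
    next
      case (3 T) then show ?case by (rule m3)
    next
      case 4 show ?case unfolding n ..
    qed
  qed
  also have "\<dots> \<le> ennreal ?K * ((\<Sum>T\<in>\<T>. ennreal ((osc v T)\<^sup>2) * ennreal (2 * R * 2 ^ (CARD('n) - 1) * p))
     + ennreal ?N * (\<Sum>F\<in>\<F>. ennreal (tc * jump_int v F)) + (\<Sum>T\<in>\<T>. ennreal (tc * bdry_int v T)))"
    using nn_integral_jump_le(1)[OF v] nn_integral_exit_le(1)[OF v]
    by (intro mult_left_mono add_mono sum_mono) (auto simp: near_line_emeasure(2))
  also have "\<dots> = ennreal (?K * (?a + ?N * ?b + ?c))"
  proof -
    have "(\<Sum>T\<in>\<T>. ennreal ((osc v T)\<^sup>2) * ennreal (2 * R * 2 ^ (CARD('n) - 1) * p)) = ennreal ?a"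
      using R p_pos by (subst sum_ennreal[symmetric]) (auto simp: ennreal_mult)
    moreover have "(\<Sum>F\<in>\<F>. ennreal (tc * jump_int v F)) = ennreal ?b"
      using tc_pos nn_integral_jump_le(3)[OF v] by (intro sum_ennreal mult_nonneg_nonneg) auto
    moreover have "(\<Sum>T\<in>\<T>. ennreal (tc * bdry_int v T)) = ennreal ?c"
      using tc_pos nn_integral_exit_le(3)[OF v] by (intro sum_ennreal mult_nonneg_nonneg) auto
    moreover have "ennreal ?K * (ennreal ?a + ennreal ?N * ennreal ?b + ennreal ?c) = ennreal (?K * (?a + ?N * ?b + ?c))"
      unfolding ennreal_add_mult_add[OF abc less_imp_le[OF N]]
      using K N abc by (intro ennreal_mult[symmetric] add_nonneg_nonneg mult_nonneg_nonneg) auto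
    ultimately show ?thesis by (simp only:)
  qed
  finally have "ennreal ?L \<le> ennreal (?K * (?a + ?N * ?b + ?c))" .
  moreover have "0 \<le> ?K * (?a + ?N * ?b + ?c)"
    using K N abc by (intro mult_nonneg_nonneg add_nonneg_nonneg) auto
  ultimately show ?thesis by (simp only: ennreal_le_iff)
qed

text \<open>The factor \<open>2 * h\<close> undoes the halving for the two orientations and the
  weight \<open>1 / h\<close>.\<close>

lemma jump_int_sum: "(\<Sum>F\<in>\<F>. jump_int v F) = 2 * h * t_jump v v"
  unfolding t_jump_def jump_int_def sum_distrib_left split_def
proof (rule sum.cong[OF refl])
  fix F
  show "surf_int (real CARD('n) - 1) (fst F \<inter> snd F \<inter> \<Omega>) (\<lambda>x. (v (fst F) x - v (snd F) x)\<^sup>2)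
    = 2 * h * (1 / 2 * surf_int (real CARD('n) - 1) (fst F \<inter> snd F \<inter> \<Omega>)
        (\<lambda>x. (v (fst F) x - v (snd F) x) * (v (fst F) x - v (snd F) x) / h))"
    unfolding surf_int_square_div[where f="\<lambda>x. v (fst F) x - v (snd F) x"] using h_pos by simp
qed

lemma bdry_int_sum: "(\<Sum>T\<in>\<T>. bdry_int v T) = h * t_bdry v v"
  unfolding t_bdry_def bdry_int_def sum_distrib_left
proof (rule sum.cong[OF refl])
  fix T
  show "surf_int (real CARD('n) - 1) (frontier \<Omega> \<inter> T) (\<lambda>x. (v T x)\<^sup>2)
    = h * surf_int (real CARD('n) - 1) (frontier \<Omega> \<inter> T) (\<lambda>x. v T x * v T x / h)"
    unfolding surf_int_square_div[where f="v T"] using h_pos by simp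
qed

definition CP1 :: real where "CP1 = 6 * line_const * R * 2 ^ (CARD('n) - 1) * Ci"
definition CP2 :: real where "CP2 = 6 * line_const * (4 * \<sigma>) ^ CARD('n) * tc"
definition CP3 :: real where "CP3 = 3 * line_const * tc"

text \<open>The factor \<open>1 / h\<close> from the number of elements cancels in every term: jumps
  and boundary values carry the weight \<open>1 / h\<close> in the form, and the squared oscillation
  times the volume of its box is of order \<open>h * D v T\<close>.\<close>

lemma broken_poincare:
  assumes v: "v \<in> V"
  shows "(\<Sum>T\<in>\<T>. integral (T \<inter> \<Omega>) (\<lambda>x. (v T x)\<^sup>2)) \<le> CP1 * (\<Sum>T\<in>\<T>. D v T) + CP2 * t_jump v v + CP3 * t_bdry v v"
proof -
  have osc: "(osc v T)\<^sup>2 = h * Ci / p * D v T" if "T \<in> \<T>" for T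
  proof -
    have D0: "0 \<le> D v T" using D_nonneg[OF v active_M[OF that]] .
    then have "0 \<le> Ci / h ^ CARD('n) * \<bar>D v T\<bar>" using Ci_pos h_pos by simp
    then have "(osc v T)\<^sup>2 = h\<^sup>2 * (Ci / h ^ CARD('n) * \<bar>D v T\<bar>)"
      by (simp only: osc_def power_mult_distrib real_sqrt_pow2)
    then show ?thesis unfolding h_pow using D0 h_pos by (simp add: power2_eq_square)
  qed
  have "(\<Sum>T\<in>\<T>. (osc v T)\<^sup>2 * (2 * R * 2 ^ (CARD('n) - 1) * p)) = (\<Sum>T\<in>\<T>. h * (2 * R * 2 ^ (CARD('n) - 1) * Ci) * D v T)"
    using p_pos by (intro sum.cong refl) (simp add: osc)
  also have "\<dots> = h * (2 * R * 2 ^ (CARD('n) - 1) * Ci) * (\<Sum>T\<in>\<T>. D v T)" by (rule sum_distrib_left[symmetric])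
  finally have a: "(\<Sum>T\<in>\<T>. (osc v T)\<^sup>2 * (2 * R * 2 ^ (CARD('n) - 1) * p)) = \<dots>" .
  have b: "(\<Sum>F\<in>\<F>. tc * jump_int v F) = tc * (2 * h * t_jump v v)"
    by (simp only: sum_distrib_left[symmetric] jump_int_sum)
  have c: "(\<Sum>T\<in>\<T>. tc * bdry_int v T) = tc * (h * t_bdry v v)"
    by (simp only: sum_distrib_left[symmetric] bdry_int_sum)
  show ?thesis using integrated_walk_bound[OF v] h_pos unfolding a b c CP1_def CP2_def CP3_def
    by (simp add: distrib_left mult_ac)
qed

lemma t_jump_nonneg: "0 \<le> t_jump v v" and t_bdry_nonneg: "0 \<le> t_bdry v v"
  unfolding t_jump_def t_bdry_def surf_int_def set_lebesgue_integral_def using h_pos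
  by (auto intro!: sum_nonneg integral_nonneg_AE AE_I2 simp: indicator_def)

lemma CP_pos: "CP1 > 0" "CP2 > 0" "CP3 > 0"
  unfolding CP1_def CP2_def CP3_def using line_const_pos R Ci_pos \<sigma> tc_pos by simp_all

lemma tnorm2_eq: "tnorm2 \<Omega> M g v = (\<Sum>T\<in>\<T>. integral (T \<inter> \<Omega>) (\<lambda>x. (norm (grad (v T) x))\<^sup>2)) + t_jump v v + t_bdry v v + g v v"
  unfolding tnorm2_def Let_def t_jump_def t_bdry_def by (simp add: power2_eq_square)

text \<open>\<open>EP3\<close> reduces the norm on full elements to that on \<open>\<Omega>\<close>,
  the Poincare inequality replaces values by gradients on full elements, and \<open>EP1\<close>
  returns these to \<open>\<Omega>\<close>.\<close>

lemma Qs_le_tnorm2: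
  assumes v: "v \<in> V" and g: "g v v \<ge> 0" and E: "EP1 k \<Omega> M g CEP" "EP3 k \<Omega> M g CEP" "CEP > 0"
  shows "Qs v \<le> CEP * (CP1 * CEP + CP2 + CP3 + 1) * tnorm2 \<Omega> M g v"
proof -
  let ?G = "\<Sum>T\<in>\<T>. integral (T \<inter> \<Omega>) (\<lambda>x. (norm (grad (v T) x))\<^sup>2)"
  let ?t = "tnorm2 \<Omega> M g v"
  have G: "0 \<le> ?G"
    using active_M M_borel M_bounded \<Omega>_borel
    by (intro sum_nonneg integral_nonneg continuous_integrable_lborel(2) continuous_intros V_grad_continuous v) auto
  have le: "?G + g v v \<le> ?t" "t_jump v v \<le> ?t" "t_bdry v v \<le> ?t" "g v v \<le> ?t"
    unfolding tnorm2_eq using G g t_jump_nonneg[of v] t_bdry_nonneg[of v] by linarith+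
  have "(\<Sum>T\<in>\<T>. D v T) \<le> CEP * (?G + g v v)" using E(1) v by (simp add: EP1_def D_def)
  also have "\<dots> \<le> CEP * ?t" using le E by simp
  finally have "CP1 * (\<Sum>T\<in>\<T>. D v T) \<le> CP1 * (CEP * ?t)" using CP_pos by simp
  moreover have "CP2 * t_jump v v \<le> CP2 * ?t" "CP3 * t_bdry v v \<le> CP3 * ?t" using le CP_pos by simp_all
  ultimately have "(\<Sum>T\<in>\<T>. integral (T \<inter> \<Omega>) (\<lambda>x. (v T x)\<^sup>2)) + g v v \<le> (CP1 * CEP + CP2 + CP3 + 1) * ?t"
    using broken_poincare[OF v] le(4) by (simp add: distrib_right mult.assoc)
  then have "CEP * ((\<Sum>T\<in>\<T>. integral (T \<inter> \<Omega>) (\<lambda>x. (v T x)\<^sup>2)) + g v v) \<le> CEP * ((CP1 * CEP + CP2 + CP3 + 1) * ?t)"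
    using E by simp
  moreover have "Qs v \<le> CEP * ((\<Sum>T\<in>\<T>. integral (T \<inter> \<Omega>) (\<lambda>x. (v T x)\<^sup>2)) + g v v)"
    using E(2) v by (simp add: EP3_def Qs_def Q_def)
  ultimately show ?thesis by (simp add: mult.assoc)
qed

end


section \<open>Positive definite matrices\<close>

lemma sum_insert_notin:
  fixes f :: "'i \<Rightarrow> real"
  shows "finite I \<Longrightarrow> a \<notin> I \<Longrightarrow> (\<Sum>i\<in>insert a I. f i) = f a + (\<Sum>i\<in>I. f i)"
  by simp

text \<open>Gaussian elimination: the Schur complement of a positive definite matrix is positive definite.\<close>
lemma positive_definite_solve:
  fixes A :: "'i \<Rightarrow> 'i \<Rightarrow> real"
  assumes "finite I" "\<And>V. \<exists>i\<in>I. V i \<noteq> 0 \<Longrightarrow> 0 < (\<Sum>i\<in>I. V i * (\<Sum>j\<in>I. A i j * V j))"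
  shows "\<exists>V. \<forall>i\<in>I. (\<Sum>j\<in>I. A i j * V j) = F i"
  using assms
proof (induction I arbitrary: A F rule: finite_induct)
  case (insert a I)
  have pd: "\<And>V. \<exists>i\<in>insert a I. V i \<noteq> 0 \<Longrightarrow> 0 < (\<Sum>i\<in>insert a I. V i * (\<Sum>j\<in>insert a I. A i j * V j))"
    by (rule insert.prems)
  have aa: "A a a > 0"
  proof -
    let ?V = "\<lambda>i. if i = a then 1 else (0::real)"
    have z: "(\<Sum>j\<in>I. A i j * ?V j) = 0" for i using insert.hyps by (intro sum.neutral) auto
    have z2: "(\<Sum>i\<in>I. ?V i * A i a) = 0"
      using insert.hyps by (intro sum.neutral) auto
    have "0 < (\<Sum>i\<in>insert a I. ?V i * (\<Sum>j\<in>insert a I. A i j * ?V j))" by (rule pd) auto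
    also have "\<dots> = A a a" unfolding sum_insert_notin[OF insert.hyps] z using z2 by simp
    finally show ?thesis .
  qed
  define A' where "A' = (\<lambda>i j. A i j - A i a * A a j / A a a)"
  have A': "(\<Sum>j\<in>I. A' i j * V j) = (\<Sum>j\<in>I. A i j * V j) - A i a / A a a * (\<Sum>j\<in>I. A a j * V j)" for i V
    by (simp add: A'_def left_diff_distrib sum_subtractf sum_distrib_left mult.assoc)
  have "\<exists>V. \<forall>i\<in>I. (\<Sum>j\<in>I. A' i j * V j) = F i - A i a / A a a * F a"
  proof (rule insert.IH)
    fix V :: "'i \<Rightarrow> real" assume "\<exists>i\<in>I. V i \<noteq> 0"
    \<comment> \<open>The entry at \<open>a\<close> makes row \<open>a\<close> of the product
      vanish; the form of \<open>A\<close> at \<open>W\<close> is then the form of the Schur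
      complement at \<open>V\<close>.\<close>
    define W where "W = V(a := - (\<Sum>j\<in>I. A a j * V j) / A a a)"
    have WI: "(\<Sum>j\<in>I. A i j * W j) = (\<Sum>j\<in>I. A i j * V j)" for i
      using insert.hyps by (intro sum.cong) (auto simp: W_def)
    have row: "(\<Sum>j\<in>insert a I. A i j * W j) = (\<Sum>j\<in>I. A' i j * V j)" for i
      unfolding sum_insert_notin[OF insert.hyps] WI A' by (simp add: W_def)
    have rowa: "(\<Sum>j\<in>insert a I. A a j * W j) = 0" unfolding row A' using aa by simp
    have "0 < (\<Sum>i\<in>insert a I. W i * (\<Sum>j\<in>insert a I. A i j * W j))"
      by (rule pd) (use \<open>\<exists>i\<in>I. V i \<noteq> 0\<close> insert.hyps in \<open>auto simp: W_def\<close>)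
    also have "\<dots> = W a * 0 + (\<Sum>i\<in>I. W i * (\<Sum>j\<in>insert a I. A i j * W j))"
      unfolding sum_insert_notin[OF insert.hyps, of "\<lambda>i. W i * (\<Sum>j\<in>insert a I. A i j * W j)"] rowa ..
    also have "\<dots> = (\<Sum>i\<in>I. V i * (\<Sum>j\<in>I. A' i j * V j))"
      unfolding row using insert.hyps by (auto intro!: sum.cong simp: W_def)
    finally show "0 < (\<Sum>i\<in>I. V i * (\<Sum>j\<in>I. A' i j * V j))" .
  qed
  then obtain V where V: "\<And>i. i \<in> I \<Longrightarrow> (\<Sum>j\<in>I. A' i j * V j) = F i - A i a / A a a * F a" by blast
  \<comment> \<open>Back substitution in row \<open>a\<close>.\<close>
  define W where "W = V(a := (F a - (\<Sum>j\<in>I. A a j * V j)) / A a a)"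
  have WI: "(\<Sum>j\<in>I. A i j * W j) = (\<Sum>j\<in>I. A i j * V j)" for i
    using insert.hyps by (intro sum.cong) (auto simp: W_def)
  have "(\<Sum>j\<in>insert a I. A i j * W j) = F i" if "i \<in> insert a I" for i
  proof (cases "i = a")
    case True
    then show ?thesis unfolding sum_insert_notin[OF insert.hyps] WI using aa by (simp add: W_def)
  next
    case False
    then have "(\<Sum>j\<in>I. A i j * V j) = F i - A i a / A a a * F a + A i a / A a a * (\<Sum>j\<in>I. A a j * V j)"
      using V[of i] that unfolding A' by auto
    then show ?thesis unfolding sum_insert_notin[OF insert.hyps] WI using aa
      by (simp add: W_def diff_divide_distrib right_diff_distrib)
  qed
  then show ?case by blast
qed simp

text \<open>Solving for the unit vectors gives a right inverse. \<open>A\<close> maps each column of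
  the defect of the left identity to 0, and definiteness makes that column vanish.\<close>

lemma positive_definite_inverse:
  fixes A :: "'i \<Rightarrow> 'i \<Rightarrow> real"
  assumes "finite I" "\<And>V. \<exists>i\<in>I. V i \<noteq> 0 \<Longrightarrow> 0 < (\<Sum>i\<in>I. V i * (\<Sum>j\<in>I. A i j * V j))"
  shows "\<exists>B. is_inverse_on I A B"
proof -
  have "\<exists>V. \<forall>i\<in>I. (\<Sum>j\<in>I. A i j * V j) = F i" for F
    by (rule positive_definite_solve[OF assms(1)]) (erule assms(2))
  then have "\<forall>l. \<exists>V. \<forall>i\<in>I. (\<Sum>j\<in>I. A i j * V j) = (if i = l then 1 else 0)" by fast
  then obtain X where X: "\<And>l i. i \<in> I \<Longrightarrow> (\<Sum>j\<in>I. A i j * X l j) = (if i = l then 1 else 0)" by metis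
  define B where "B = (\<lambda>i j. X j i)"
  have right: "(\<Sum>l\<in>I. A i l * B l j) = (if i = j then 1 else 0)" if "i \<in> I" for i j
    using X[OF that, of j] by (simp add: B_def)
  have left: "(\<Sum>l\<in>I. B i l * A l j) = (if i = j then 1 else 0)" if ij: "i \<in> I" "j \<in> I" for i j
  proof (rule ccontr)
    define W where "W = (\<lambda>i. (\<Sum>l\<in>I. B i l * A l j) - (if i = j then 1 else 0))"
    assume "(\<Sum>l\<in>I. B i l * A l j) \<noteq> (if i = j then 1 else 0)"
    then have "W i \<noteq> 0" by (simp add: W_def)
    then have "\<exists>i\<in>I. W i \<noteq> 0" using ij by blast
    then have "0 < (\<Sum>i\<in>I. W i * (\<Sum>j\<in>I. A i j * W j))" by (rule assms(2))
    moreover have "(\<Sum>i\<in>I. A m i * W i) = 0" if "m \<in> I" for m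
    proof -
      have "(\<Sum>i\<in>I. A m i * W i) = (\<Sum>i\<in>I. \<Sum>l\<in>I. A m i * B i l * A l j) - (\<Sum>i\<in>I. A m i * (if i = j then 1 else 0))"
        by (simp add: W_def right_diff_distrib sum_subtractf sum_distrib_left mult.assoc)
      also have "(\<Sum>i\<in>I. \<Sum>l\<in>I. A m i * B i l * A l j) = (\<Sum>l\<in>I. (\<Sum>i\<in>I. A m i * B i l) * A l j)"
        unfolding sum_distrib_right by (rule sum.swap)
      also have "\<dots> = (\<Sum>l\<in>I. (if m = l then 1 else 0) * A l j)" using right[OF that] by simp
      also have "\<dots> = A m j" using that assms(1) by (simp add: if_distrib[of "\<lambda>a. a * _"] cong: if_cong)
      also have "(\<Sum>i\<in>I. A m i * (if i = j then 1 else 0)) = A m j"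
        using ij assms(1) by (simp add: if_distrib[of "\<lambda>a. _ * a"] cong: if_cong)
      finally show ?thesis by simp
    qed
    ultimately show False by simp
  qed
  show ?thesis unfolding is_inverse_on_def using left right by (intro exI[of _ B]) auto
qed

section \<open>Euclidean norms and the condition number\<close>

lemma vec_norm_L2: "vec_norm I V = L2_set V I"
  by (simp add: vec_norm_def L2_set_def)

lemma vec_norm_nonneg [simp]: "0 \<le> vec_norm I V"
  by (simp add: vec_norm_def sum_nonneg)

lemma vec_norm_sq: "(vec_norm I V)\<^sup>2 = (\<Sum>i\<in>I. (V i)\<^sup>2)"
  by (simp add: vec_norm_def sum_nonneg)

lemma vec_inner_le: "(\<Sum>i\<in>I. V i * W i) \<le> vec_norm I V * vec_norm I W"
proof -
  have "(\<Sum>i\<in>I. V i * W i) \<le> (\<Sum>i\<in>I. \<bar>V i\<bar> * \<bar>W i\<bar>)"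
    by (rule sum_mono) (metis abs_ge_self abs_mult)
  also have "\<dots> \<le> vec_norm I V * vec_norm I W" unfolding vec_norm_L2 by (rule L2_set_mult_ineq)
  finally show ?thesis .
qed

text \<open>\<open>mat_opnorm\<close> is a supremum of reals, so both claims need a nonempty bounded
  set of quotients; the constant vector 1 provides an element.\<close>

lemma
  assumes "finite I" "I \<noteq> {}" "\<And>V. vec_norm I (mat_vec I A V) \<le> K * vec_norm I V"
  shows mat_opnorm_le: "mat_opnorm I A \<le> K" and mat_opnorm_nonneg: "0 \<le> mat_opnorm I A"
proof -
  let ?S = "{vec_norm I (mat_vec I A V) / vec_norm I V | V. vec_norm I V \<noteq> 0}"
  obtain a where a: "a \<in> I" using assms by auto
  have "(vec_norm I (\<lambda>_. 1))\<^sup>2 > 0" unfolding vec_norm_sq using assms by (simp add: card_gt_0_iff)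
  then have n: "vec_norm I (\<lambda>_. 1) \<noteq> 0" by auto
  have b: "x \<le> K" if xS: "x \<in> ?S" for x
  proof -
    obtain V where V: "x = vec_norm I (mat_vec I A V) / vec_norm I V" "vec_norm I V \<noteq> 0" using xS by blast
    then have "vec_norm I V > 0" using vec_norm_nonneg[of I V] by linarith
    then show ?thesis using assms(3)[of V] V by (simp add: divide_le_eq)
  qed
  have m: "vec_norm I (mat_vec I A (\<lambda>_. 1)) / vec_norm I (\<lambda>_. 1) \<in> ?S" using n by blast
  show "mat_opnorm I A \<le> K" unfolding mat_opnorm_def using m b by (intro cSup_least) auto
  have "bdd_above ?S" using b by (rule bdd_aboveI)
  then show "0 \<le> mat_opnorm I A"
    unfolding mat_opnorm_def using m by (rule cSup_upper2[rotated 2]) simp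
qed

text \<open>Bounds of the quadratic form alone control both norms, without eigenvalues. For the
  inverse, \<open>c\<close> times the square of \<open>B V\<close> is at most the inner product of
  \<open>B V\<close> with \<open>V\<close>.\<close>

lemma spd_condition_number:
  fixes A :: "'i \<Rightarrow> 'i \<Rightarrow> real"
  assumes fin: "finite I" and ne: "I \<noteq> {}" and sym: "\<And>i j. i \<in> I \<Longrightarrow> j \<in> I \<Longrightarrow> A i j = A j i"
    and c: "c > 0" and low: "\<And>V. c * (vec_norm I V)\<^sup>2 \<le> (\<Sum>i\<in>I. V i * mat_vec I A V i)"
    and up: "\<And>V. (\<Sum>i\<in>I. V i * mat_vec I A V i) \<le> K * (vec_norm I V)\<^sup>2"
  shows "\<exists>B. is_inverse_on I A B \<and> mat_opnorm I A * mat_opnorm I B \<le> K / c"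
proof -
  have nz: "vec_norm I V > 0" if "\<exists>i\<in>I. V i \<noteq> 0" for V
  proof -
    have "0 < (vec_norm I V)\<^sup>2" unfolding vec_norm_sq using that fin by (metis sum_pos2 zero_le_power2 zero_less_power2)
    then show ?thesis using vec_norm_nonneg[of I V] by (metis less_eq_real_def zero_power2 less_irrefl)
  qed
  obtain B where B: "is_inverse_on I A B"
  proof -
    have "\<exists>B. is_inverse_on I A B"
    proof (rule positive_definite_inverse[OF fin])
      fix V :: "'i \<Rightarrow> real" assume "\<exists>i\<in>I. V i \<noteq> 0"
      then have "0 < c * (vec_norm I V)\<^sup>2" using nz[of V] c by simp
      then show "0 < (\<Sum>i\<in>I. V i * (\<Sum>j\<in>I. A i j * V j))" using low[of V] by (simp add: mat_vec_def)
    qed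
    then show ?thesis using that by blast
  qed
  have K: "K > 0"
  proof -
    obtain a where "a \<in> I" using ne by auto
    then have "vec_norm I (\<lambda>_. 1) > 0" by (intro nz) auto
    then have p: "0 < (vec_norm I (\<lambda>_. 1))\<^sup>2" by simp
    have "c * (vec_norm I (\<lambda>_. 1))\<^sup>2 \<le> K * (vec_norm I (\<lambda>_. 1))\<^sup>2" using low up order_trans by blast
    then have "c \<le> K" using p by simp
    then show ?thesis using c by simp
  qed
  have normA: "vec_norm I (mat_vec I A V) \<le> K * vec_norm I V" for V
  proof -
    define Y where "Y = mat_vec I A V"
    define t where "t = 1 / K"
    define q where "q = (\<lambda>V W. \<Sum>i\<in>I. W i * mat_vec I A V i)"
    have qe: "q V W = (\<Sum>i\<in>I. \<Sum>j\<in>I. W i * A i j * V j)" for V W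
      by (simp add: q_def mat_vec_def sum_distrib_left mult.assoc)
    have qs: "q V W = q W V" for V W
    proof -
      have "q V W = (\<Sum>j\<in>I. \<Sum>i\<in>I. W i * A i j * V j)" unfolding qe by (rule sum.swap)
      also have "\<dots> = q W V" unfolding qe by (intro sum.cong refl) (use sym in auto)
      finally show ?thesis .
    qed
    \<comment> \<open>The form is nonnegative at \<open>V - A V / K\<close>. Expanding it and
      bounding the form at \<open>A V\<close> by \<open>K\<close> gives that the square of
      \<open>A V\<close> is at most \<open>K\<close> times the form at \<open>V\<close>.\<close>
    define Z where "Z = (\<lambda>i. V i - t * Y i)"
    have "0 \<le> c * (vec_norm I Z)\<^sup>2" using c by simp
    also have "\<dots> \<le> q Z Z" unfolding q_def by (rule low)
    also have "q Z Z = q V V - t * q V Y - t * q Y V + t\<^sup>2 * q Y Y"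
      unfolding qe Z_def
      by (simp add: algebra_simps sum.distrib sum_subtractf sum_distrib_left power2_eq_square)
    also have "\<dots> = q V V - 2 * t * q V Y + t\<^sup>2 * q Y Y" using qs[of V Y] by simp
    also have "q V Y = (vec_norm I Y)\<^sup>2" unfolding q_def vec_norm_sq by (simp add: Y_def power2_eq_square)
    finally have "0 \<le> q V V - 2 * t * (vec_norm I Y)\<^sup>2 + t\<^sup>2 * q Y Y" .
    moreover have "t\<^sup>2 * q Y Y \<le> t\<^sup>2 * (K * (vec_norm I Y)\<^sup>2)"
      unfolding q_def by (intro mult_left_mono up) simp
    moreover have "t\<^sup>2 * (K * (vec_norm I Y)\<^sup>2) = t * (vec_norm I Y)\<^sup>2" using K by (simp add: t_def power2_eq_square)
    moreover have "q V V \<le> K * (vec_norm I V)\<^sup>2" unfolding q_def by (rule up)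
    ultimately have "t * (vec_norm I Y)\<^sup>2 \<le> K * (vec_norm I V)\<^sup>2" by linarith
    then have "(vec_norm I Y)\<^sup>2 \<le> (K * vec_norm I V)\<^sup>2"
      using K by (simp add: t_def field_simps power2_eq_square)
    then show ?thesis unfolding Y_def using K by (intro power2_le_imp_le[of "vec_norm I (mat_vec I A V)"]) auto
  qed
  have normB: "vec_norm I (mat_vec I B V) \<le> 1 / c * vec_norm I V" for V
  proof -
    define W where "W = mat_vec I B V"
    have AW: "mat_vec I A W i = V i" if "i \<in> I" for i
    proof -
      have "mat_vec I A W i = (\<Sum>j\<in>I. \<Sum>l\<in>I. A i j * B j l * V l)"
        by (simp add: mat_vec_def W_def sum_distrib_left mult.assoc)
      also have "\<dots> = (\<Sum>l\<in>I. (\<Sum>j\<in>I. A i j * B j l) * V l)"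
        unfolding sum_distrib_right by (rule sum.swap)
      also have "\<dots> = (\<Sum>l\<in>I. (if i = l then 1 else 0) * V l)"
        using B that by (intro sum.cong refl) (simp add: is_inverse_on_def)
      also have "\<dots> = V i" using that fin by (simp add: if_distrib[of "\<lambda>a. a * _"] cong: if_cong)
      finally show ?thesis .
    qed
    have "c * (vec_norm I W)\<^sup>2 \<le> (\<Sum>i\<in>I. W i * mat_vec I A W i)" by (rule low)
    also have "\<dots> = (\<Sum>i\<in>I. W i * V i)" using AW by simp
    also have "\<dots> \<le> vec_norm I W * vec_norm I V" by (rule vec_inner_le)
    finally have "vec_norm I W * (c * vec_norm I W) \<le> vec_norm I W * vec_norm I V"
      by (simp add: power2_eq_square mult_ac)
    then have "vec_norm I W = 0 \<or> c * vec_norm I W \<le> vec_norm I V"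
      using vec_norm_nonneg[of I W] by (metis less_eq_real_def mult_le_cancel_left_pos)
    then show ?thesis using c unfolding W_def by (auto simp: field_simps)
  qed
  have "mat_opnorm I A * mat_opnorm I B \<le> K * (1 / c)"
    using mat_opnorm_le[OF fin ne normA] mat_opnorm_le[OF fin ne normB] mat_opnorm_nonneg[OF fin ne normB] K
    by (intro mult_mono) auto
  then show ?thesis using B by auto
qed


section \<open>The stiffness matrix\<close>

context dg begin

lemma nodal_basis_V:
  assumes "i \<in> dof_index k M \<Omega>" shows "nodal_basis k i \<in> V"
  using assms simplex_lagrange_basis(4)[OF M_simplex[OF active_M] k]
  by (auto simp: Vh_def nodal_basis_def dof_index_def)

lemma finite_dof [simp]: "finite (dof_index k M \<Omega>)"
proof -
  have "dof_index k M \<Omega> = Sigma \<T> (lagrange_nodes k)" by (auto simp: dof_index_def)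
  then show ?thesis using simplex_lagrange_basis(1)[OF M_simplex[OF active_M] k] by auto
qed

lemma sum_dof: "(\<Sum>i\<in>dof_index k M \<Omega>. f i) = (\<Sum>T\<in>\<T>. \<Sum>z\<in>lagrange_nodes k T. f (T, z))"
proof -
  have "dof_index k M \<Omega> = Sigma \<T> (lagrange_nodes k)" by (auto simp: dof_index_def)
  then show ?thesis using simplex_lagrange_basis(1)[OF M_simplex[OF active_M] k] by (simp add: sum.Sigma)
qed

lemma zero_V: "(\<lambda>T x. 0) \<in> V" by (simp add: Vh_def)

lemma linear_on_sum:
  fixes B :: "'n dgfun \<Rightarrow> real"
  assumes lin: "\<And>u v a b. u \<in> V \<Longrightarrow> v \<in> V \<Longrightarrow> B (\<lambda>T x. a * u T x + b * v T x) = a * B u + b * B v"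
    and "finite J" "\<And>i. i \<in> J \<Longrightarrow> \<phi> i \<in> V"
  shows "(\<lambda>T x. \<Sum>i\<in>J. c i * \<phi> i T x) \<in> V \<and> B (\<lambda>T x. \<Sum>i\<in>J. c i * \<phi> i T x) = (\<Sum>i\<in>J. c i * B (\<phi> i))"
  using assms(2,3)
proof (induction J rule: finite_induct)
  case empty
  have "B (\<lambda>T x. 0 * 0 + 0 * 0) = 0 * B (\<lambda>T x. 0) + 0 * B (\<lambda>T x. 0)" by (rule lin[OF zero_V zero_V])
  then show ?case using zero_V by simp
next
  case (insert a J)
  let ?w = "\<lambda>T x. \<Sum>i\<in>J. c i * \<phi> i T x"
  have IH: "?w \<in> V" "B ?w = (\<Sum>i\<in>J. c i * B (\<phi> i))" using insert by auto
  have e: "(\<lambda>T x. \<Sum>i\<in>insert a J. c i * \<phi> i T x) = (\<lambda>T x. c a * \<phi> a T x + 1 * ?w T x)"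
    using insert.hyps by simp
  have a: "\<phi> a \<in> V" using insert.prems by simp
  show ?case unfolding e using lin[OF a IH(1), of "c a" 1] V_lincomb[OF a IH(1), of "c a" 1] IH insert.hyps by simp
qed

definition assembled :: "((real^'n) set \<times> (real^'n) \<Rightarrow> real) \<Rightarrow> 'n dgfun" where
  "assembled X = (\<lambda>T x. \<Sum>i\<in>dof_index k M \<Omega>. X i * nodal_basis k i T x)"

lemma assembled_eq:
  assumes "T \<in> \<T>" shows "assembled X T x = (\<Sum>z\<in>lagrange_nodes k T. X (T, z) * local_basis k T z x)"
proof -
  have "assembled X T x = (\<Sum>S\<in>\<T>. if S = T then \<Sum>z\<in>lagrange_nodes k T. X (T, z) * local_basis k T z x else 0)"
    unfolding assembled_def sum_dof by (intro sum.cong) (auto simp: nodal_basis_def)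
  then show ?thesis using assms by simp
qed

lemma assembled_node:
  assumes "T \<in> \<T>" "z \<in> lagrange_nodes k T" shows "assembled X T z = X (T, z)"
proof -
  note L = simplex_lagrange_basis[OF M_simplex[OF active_M[OF assms(1)]] k]
  have "assembled X T z = (\<Sum>y\<in>lagrange_nodes k T. if y = z then X (T, z) else 0)"
    unfolding assembled_eq[OF assms(1)] using L(6)[OF _ assms(2)] by (intro sum.cong) auto
  then show ?thesis using assms(2) L(1) by simp
qed

lemma assembled_V: "assembled X \<in> V"
  unfolding assembled_def
  using linear_on_sum[of "\<lambda>_. 0" "dof_index k M \<Omega>" "nodal_basis k" X] nodal_basis_V by simp

section \<open>Coefficient vectors against the norm on full elements\<close>

definition node_bound :: real where "node_bound = real ((k + 1) ^ (CARD('n) + 1))"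

lemma card_nodes_le: "T \<in> \<T> \<Longrightarrow> real (card (lagrange_nodes k T)) \<le> node_bound"
  unfolding node_bound_def using simplex_lagrange_basis(2)[OF M_simplex[OF active_M] k] of_nat_le_iff by blast

lemma vec_norm_dof: "(vec_norm (dof_index k M \<Omega>) X)\<^sup>2 = (\<Sum>T\<in>\<T>. \<Sum>z\<in>lagrange_nodes k T. (X (T, z))\<^sup>2)"
  unfolding vec_norm_sq sum_dof ..

text \<open>On each element the basis functions are bounded by \<open>k ^ k\<close> and the volume
  is of order \<open>h ^ CARD('n)\<close>.\<close>

lemma Qs_assembled_le:
  "Qs (assembled X) \<le> node_bound * (real k ^ k)\<^sup>2 * unit_ball_vol (real CARD('n)) * h ^ CARD('n) * (vec_norm (dof_index k M \<Omega>) X)\<^sup>2"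
proof -
  have "Q (assembled X) T \<le> node_bound * (real k ^ k)\<^sup>2 * unit_ball_vol (real CARD('n)) * h ^ CARD('n) * (\<Sum>z\<in>lagrange_nodes k T. (X (T, z))\<^sup>2)"
    if T: "T \<in> \<T>" for T
  proof -
    note L = simplex_lagrange_basis[OF M_simplex[OF active_M[OF T]] k]
    let ?S = "\<Sum>z\<in>lagrange_nodes k T. (X (T, z))\<^sup>2"
    have S: "0 \<le> ?S" by (simp add: sum_nonneg)
    have nb: "0 \<le> node_bound" by (simp add: node_bound_def)
    have "Q (assembled X) T \<le> (?S * (real k ^ k)\<^sup>2 * node_bound) * (unit_ball_vol (real CARD('n)) * h ^ CARD('n))"
      unfolding Q_def
    proof (rule integral_le_sup_mult_measure[OF _ active_M[OF T]])
      show "continuous_on UNIV (\<lambda>x. (assembled X T x)\<^sup>2)" by (intro continuous_on_power V_continuous assembled_V)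
      show "0 \<le> ?S * (real k ^ k)\<^sup>2 * node_bound" using S nb by simp
      fix x assume x: "x \<in> T"
      have "(assembled X T x)\<^sup>2 \<le> (\<Sum>z\<in>lagrange_nodes k T. (X (T, z) * local_basis k T z x)\<^sup>2) * real (card (lagrange_nodes k T))"
        unfolding assembled_eq[OF T] by (rule sum_squared_le_sum_of_squares)
      also have "\<dots> \<le> (?S * (real k ^ k)\<^sup>2) * node_bound"
      proof (rule mult_mono)
        show "(\<Sum>z\<in>lagrange_nodes k T. (X (T, z) * local_basis k T z x)\<^sup>2) \<le> ?S * (real k ^ k)\<^sup>2"
          unfolding sum_distrib_right power_mult_distrib
        proof (intro sum_mono mult_left_mono)
          fix z assume "z \<in> lagrange_nodes k T"
          then have "\<bar>local_basis k T z x\<bar>\<^sup>2 \<le> (real k ^ k)\<^sup>2" using L(5)[OF _ x] by (intro power_mono) auto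
          then show "(local_basis k T z x)\<^sup>2 \<le> (real k ^ k)\<^sup>2" by simp
        qed simp
      qed (use card_nodes_le[OF T] S in auto)
      finally show "(assembled X T x)\<^sup>2 \<le> ?S * (real k ^ k)\<^sup>2 * node_bound" .
    qed
    then show ?thesis by (simp add: mult_ac)
  qed
  then show ?thesis unfolding Qs_def vec_norm_dof sum_distrib_left by (rule sum_mono)
qed

text \<open>The coefficients are the values at nodes inside the element, so the pointwise inverse
  estimate applies to each of them.\<close>

lemma vec_norm_le_Qs:
  "(vec_norm (dof_index k M \<Omega>) X)\<^sup>2 \<le> node_bound * Ci / h ^ CARD('n) * Qs (assembled X)"
proof -
  have "(\<Sum>z\<in>lagrange_nodes k T. (X (T, z))\<^sup>2) \<le> node_bound * Ci / h ^ CARD('n) * Q (assembled X) T" if T: "T \<in> \<T>" for T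
  proof -
    note L = simplex_lagrange_basis[OF M_simplex[OF active_M[OF T]] k]
    have "(\<Sum>z\<in>lagrange_nodes k T. (X (T, z))\<^sup>2) \<le> (\<Sum>z\<in>lagrange_nodes k T. Ci / h ^ CARD('n) * Q (assembled X) T)"
      using value_sq_le[OF assembled_V active_M[OF T]] assembled_node[OF T] L(3) by (intro sum_mono) (metis subsetD)
    also have "\<dots> = real (card (lagrange_nodes k T)) * (Ci / h ^ CARD('n) * Q (assembled X) T)" by simp
    also have "\<dots> \<le> node_bound * (Ci / h ^ CARD('n) * Q (assembled X) T)"
      using Ci_pos h_pos Q_nonneg[OF assembled_V active_M[OF T]] by (intro mult_right_mono card_nodes_le[OF T]) auto
    finally show ?thesis by simp
  qed
  then show ?thesis unfolding Qs_def vec_norm_dof sum_distrib_left by (rule sum_mono)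
qed

text \<open>The factors of the upper bound times those of the lower bound, all powers of
  \<open>h\<close> removed.\<close>

definition cond_const :: "real \<Rightarrow> real \<Rightarrow> real \<Rightarrow> real" where
  "cond_const CEP Cc \<beta> = ((Cup \<beta> + CEP\<^sup>2) * (node_bound * (real k ^ k)\<^sup>2 * unit_ball_vol (real CARD('n)))) *
     (node_bound * Ci * (CEP * (CP1 * CEP + CP2 + CP3 + 1) * Cc))"

lemma condition_number_bound:
  assumes g: "g_sym_psd g V" and E: "EP1 k \<Omega> M g CEP" "EP3 k \<Omega> M g CEP" "EP4 k \<Omega> M g CEP" "CEP > 0"
    and co: "coercive k \<Omega> M \<beta> g Cc" "Cc > 0"
  shows "\<exists>B. is_inverse_on (dof_index k M \<Omega>) (stiffness k \<Omega> M \<beta> g) B \<and>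
     mat_opnorm (dof_index k M \<Omega>) (stiffness k \<Omega> M \<beta> g) * mat_opnorm (dof_index k M \<Omega>) B \<le> cond_const CEP Cc \<beta> / h\<^sup>2"
proof -
  let ?I = "dof_index k M \<Omega>"
  let ?A = "stiffness k \<Omega> M \<beta> g"
  let ?a = "Ah \<Omega> M \<beta> g"
  have lin: "?a (\<lambda>T x. a * u T x + b * v T x) w = a * ?a u w + b * ?a v w"
    if "u \<in> V" "v \<in> V" "w \<in> V" for u v w a b
    using ah_lin[OF that, of \<beta> a b] g that unfolding Ah_def g_sym_psd_def by (simp add: algebra_simps)
  have sym: "?a u v = ?a v u" if "u \<in> V" "v \<in> V" for u v
    using g that ah_commute unfolding Ah_def g_sym_psd_def by metis
  \<comment> \<open>Bilinearity and symmetry turn the matrix form into \<open>Ah\<close> at the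
    assembled function, to which the estimates on \<open>V\<close> apply.\<close>
  have quad: "(\<Sum>i\<in>?I. X i * mat_vec ?I ?A X i) = ?a (assembled X) (assembled X)" for X
  proof -
    have expand: "?a (assembled X) w = (\<Sum>i\<in>?I. X i * ?a (nodal_basis k i) w)" if "w \<in> V" for w
      unfolding assembled_def
      using linear_on_sum[of "\<lambda>u. ?a u w" ?I "nodal_basis k" X] lin that nodal_basis_V by simp
    have "mat_vec ?I ?A X i = ?a (assembled X) (nodal_basis k i)" if "i \<in> ?I" for i
      unfolding expand[OF nodal_basis_V[OF that]] by (simp add: mat_vec_def stiffness_def mult.commute)
    then have "(\<Sum>i\<in>?I. X i * mat_vec ?I ?A X i) = (\<Sum>i\<in>?I. X i * ?a (nodal_basis k i) (assembled X))"
      using sym[OF assembled_V nodal_basis_V] by simp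
    then show ?thesis using expand[OF assembled_V] by simp
  qed
  define CL where "CL = CEP * (CP1 * CEP + CP2 + CP3 + 1) * Cc"
  have CL: "CL > 0" unfolding CL_def using E co CP_pos by (intro mult_pos_pos add_pos_pos) auto
  have gn: "0 \<le> g v v" if "v \<in> V" for v using g that by (simp add: g_sym_psd_def)
  have lower: "Qs v \<le> CL * ?a v v" if v: "v \<in> V" for v
  proof -
    have "Qs v \<le> CEP * (CP1 * CEP + CP2 + CP3 + 1) * tnorm2 \<Omega> M g v" by (rule Qs_le_tnorm2[OF v gn[OF v] E(1,2,4)])
    also have "\<dots> \<le> CEP * (CP1 * CEP + CP2 + CP3 + 1) * (Cc * ?a v v)"
      using co(1) v E(4) CP_pos by (intro mult_left_mono mult_nonneg_nonneg add_nonneg_nonneg) (auto simp: coercive_def)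
    finally show ?thesis by (simp add: CL_def mult.assoc)
  qed
  have upper: "?a v v \<le> (Cup \<beta> + CEP\<^sup>2) / h\<^sup>2 * Qs v" if v: "v \<in> V" for v
  proof -
    have "sqrt (g v v) \<le> CEP / h * sqrt (Qs v)" using E(3) v by (simp add: EP4_def Qs_def Q_def)
    then have "(sqrt (g v v))\<^sup>2 \<le> (CEP / h * sqrt (Qs v))\<^sup>2" using gn[OF v] by (intro power_mono) auto
    then have "g v v \<le> CEP\<^sup>2 / h\<^sup>2 * Qs v"
      using gn[OF v] Qs_nonneg[OF v] by (simp add: power_mult_distrib power_divide)
    then show ?thesis using ah_le[OF v, of \<beta>] by (simp add: Ah_def add_divide_distrib distrib_right)
  qed
  define Cn where "Cn = node_bound * (real k ^ k)\<^sup>2 * unit_ball_vol (real CARD('n))"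
  \<comment> \<open>\<open>K\<close> and \<open>c\<close> bound the form from above and below; both
    contain \<open>h ^ CARD('n)\<close>, so their quotient retains only
    \<open>1 / h ^ 2\<close>.\<close>
  define K where "K = (Cup \<beta> + CEP\<^sup>2) / h\<^sup>2 * (Cn * h ^ CARD('n))"
  define c where "c = h ^ CARD('n) / (node_bound * Ci * CL)"
  have nb: "node_bound > 0" unfolding node_bound_def of_nat_0_less_iff by (rule zero_less_power) simp
  have ne: "?I \<noteq> {}"
  proof -
    obtain x where "x \<in> \<Omega>" using \<Omega>(3) by auto
    then obtain T where T: "T \<in> \<T>" using \<Omega>_cover by blast
    have "lagrange_nodes k T \<noteq> {}"
    proof
      assume "lagrange_nodes k T = {}"
      then have "(1::real) = 0"
        using simplex_lagrange_basis(7)[OF M_simplex[OF active_M[OF T]] k poly_deg_le_const[of k 1]] by simp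
      then show False by simp
    qed
    then show ?thesis using T by (auto simp: dof_index_def)
  qed
  have "\<exists>B. is_inverse_on ?I ?A B \<and> mat_opnorm ?I ?A * mat_opnorm ?I B \<le> K / c"
  proof (rule spd_condition_number[OF finite_dof ne])
    show "?A i j = ?A j i" if "i \<in> ?I" "j \<in> ?I" for i j
      unfolding stiffness_def by (rule sym[OF nodal_basis_V nodal_basis_V]) (use that in auto)
    show "c > 0" unfolding c_def using h_pos nb Ci_pos CL by simp
    show "c * (vec_norm ?I X)\<^sup>2 \<le> (\<Sum>i\<in>?I. X i * mat_vec ?I ?A X i)" for X
    proof -
      have "(vec_norm ?I X)\<^sup>2 \<le> node_bound * Ci / h ^ CARD('n) * (CL * ?a (assembled X) (assembled X))"
        using nb Ci_pos h_pos
        by (intro order_trans[OF vec_norm_le_Qs] mult_left_mono lower assembled_V) auto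
      then have "c * (vec_norm ?I X)\<^sup>2 \<le> c * (node_bound * Ci / h ^ CARD('n) * (CL * ?a (assembled X) (assembled X)))"
        using \<open>c > 0\<close> by (intro mult_left_mono) auto
      also have "\<dots> = ?a (assembled X) (assembled X)"
        unfolding c_def using h_pos nb Ci_pos CL by simp
      finally show ?thesis unfolding quad .
    qed
    show "(\<Sum>i\<in>?I. X i * mat_vec ?I ?A X i) \<le> K * (vec_norm ?I X)\<^sup>2" for X
    proof -
      have "?a (assembled X) (assembled X) \<le> (Cup \<beta> + CEP\<^sup>2) / h\<^sup>2 * (Cn * h ^ CARD('n) * (vec_norm ?I X)\<^sup>2)"
        unfolding Cn_def using Cup_pos[of \<beta>]
        by (intro order_trans[OF upper[OF assembled_V]] mult_left_mono Qs_assembled_le) auto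
      then show ?thesis unfolding quad K_def by (simp add: mult.assoc)
    qed
  qed
  moreover have "K / c = cond_const CEP Cc \<beta> / h\<^sup>2"
    unfolding K_def c_def cond_const_def Cn_def CL_def[symmetric] using h_pos by simp
  ultimately show ?thesis by simp
qed

end

theorem mainTheorem8:
  fixes \<Omega> :: "(real^'n) set" and k :: nat and \<sigma> cs CEP Ccoer \<beta> :: real
  assumes "CARD('n) = 2 \<or> CARD('n) = 3"
    and "k \<ge> 1"
    and "open \<Omega>" and "bounded \<Omega>" and "\<Omega> \<noteq> {}" and "C2_domain \<Omega>"
    and "\<sigma> > 0" and "cs > 0" and "CEP > 0" and "Ccoer > 0"
  shows "\<exists>C>0. \<forall>(M :: (real^'n) set set) (g :: 'n dgfun \<Rightarrow> 'n dgfun \<Rightarrow> real).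
     background_mesh M \<Omega> \<sigma> \<and> fat_intersection M \<Omega> cs \<and> cpp_defined M \<Omega> \<and>
     g_sym_psd g (Vh k M \<Omega>) \<and>
     EP1 k \<Omega> M g CEP \<and> EP3 k \<Omega> M g CEP \<and> EP4 k \<Omega> M g CEP \<and>
     coercive k \<Omega> M \<beta> g Ccoer
     \<longrightarrow> (\<exists>B. is_inverse_on (dof_index k M \<Omega>) (stiffness k \<Omega> M \<beta> g) B \<and>
           mat_opnorm (dof_index k M \<Omega>) (stiffness k \<Omega> M \<beta> g) * mat_opnorm (dof_index k M \<Omega>) B
             \<le> C / (meshsize M)\<^sup>2)"
proof -
  have d: "CARD('n) \<ge> 2" using assms(1) by auto
  obtain B where B: "\<And>x. x \<in> \<Omega> \<Longrightarrow> norm x \<le> B" using assms(4) unfolding bounded_iff by blast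
  define R where "R = max 1 B"
  have R: "R > 0" "\<Omega> \<subseteq> cball 0 R" using B by (auto simp: R_def le_max_iff_disj)
  obtain C\<Gamma> where C\<Gamma>: "C\<Gamma> > 0" "\<And>c h. h > 0 \<Longrightarrow>
      hausdorff_outer (real CARD('n) - 1) (frontier \<Omega> \<inter> cball c h) \<le> ennreal (C\<Gamma> * h ^ (CARD('n) - 1))"
    using hausdorff_outer_frontier_le[OF assms(6,3,4) d] by blast
  obtain Cinv where Cinv: "Cinv > 0" "\<And>(p :: real^'n \<Rightarrow> real) c r x. poly_deg_le k p \<Longrightarrow> r > 0 \<Longrightarrow> x \<in> cball c (max 1 (2 * \<sigma>) * r) \<Longrightarrow>
      (p x)\<^sup>2 \<le> Cinv / r ^ CARD('n) * integral (cball c r) (\<lambda>x. (p x)\<^sup>2) \<and>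
      (norm (grad p x))\<^sup>2 \<le> Cinv / r ^ (CARD('n) + 2) * integral (cball c r) (\<lambda>x. (p x)\<^sup>2)"
    using poly_inverse_estimate[OF assms(2), of "max 1 (2 * \<sigma>)", where 'n='n] by (meson max.cobounded1)
  have "dg M \<Omega> \<sigma> R k C\<Gamma> Cinv" if bm: "background_mesh M \<Omega> \<sigma>" and cpp: "cpp_defined M \<Omega>" for M
  proof
    \<comment> \<open>Balls inside this element lie in \<open>cball 0 R\<close>, which bounds its
      inradius and, through \<open>\<sigma>\<close>, the mesh size.\<close>
    obtain T where T: "T \<in> active M \<Omega>" "T \<subseteq> \<Omega>" using uncut_element_exists[OF bm cpp assms(3-5)] by blast
    have "inradius T \<le> R" unfolding inradius_def
    proof (rule cSup_least)
      have "0 \<in> {r. \<exists>c. ball c r \<subseteq> T}" by simp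
      then show "{r. \<exists>c. ball c r \<subseteq> T} \<noteq> {}" by blast
      fix r assume "r \<in> {r. \<exists>c. ball c r \<subseteq> T}"
      then obtain c where "ball c r \<subseteq> T" by blast
      then have "ball c r \<subseteq> cball 0 R" using T(2) R(2) by blast
      then show "r \<le> R" unfolding ball_subset_cball_iff using R(1) zero_le_dist[of c 0] by linarith
    qed
    moreover have "meshsize M \<le> \<sigma> * inradius T" using bm T by (auto simp: background_mesh_def active_def)
    ultimately show "meshsize M \<le> \<sigma> * R" using assms(7) by (meson less_eq_real_def mult_left_mono order_trans)
  qed (use bm assms R d C\<Gamma> Cinv in auto)
  \<comment> \<open>Seen from outside the locale, \<open>cond_const\<close> takes neither
    \<open>M\<close> nor \<open>g\<close> as an argument, so it can be fixed before them.\<close>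
  then have main: "\<exists>B. is_inverse_on (dof_index k M \<Omega>) (stiffness k \<Omega> M \<beta> g) B \<and>
           mat_opnorm (dof_index k M \<Omega>) (stiffness k \<Omega> M \<beta> g) * mat_opnorm (dof_index k M \<Omega>) B
             \<le> dg.cond_const TYPE('n) \<sigma> R k C\<Gamma> Cinv CEP Ccoer \<beta> / (meshsize M)\<^sup>2"
    if "background_mesh M \<Omega> \<sigma>" "cpp_defined M \<Omega>" "g_sym_psd g (Vh k M \<Omega>)" "EP1 k \<Omega> M g CEP" "EP3 k \<Omega> M g CEP"
      "EP4 k \<Omega> M g CEP" "coercive k \<Omega> M \<beta> g Ccoer" for M g
    using dg.condition_number_bound[of M \<Omega> \<sigma> R k C\<Gamma> Cinv g CEP \<beta> Ccoer] that assms(9,10) by blast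
  let ?C = "max 1 (dg.cond_const TYPE('n) \<sigma> R k C\<Gamma> Cinv CEP Ccoer \<beta>)"
  have "dg.cond_const TYPE('n) \<sigma> R k C\<Gamma> Cinv CEP Ccoer \<beta> / (meshsize M)\<^sup>2 \<le> ?C / (meshsize M)\<^sup>2" for M :: "(real^'n) set set"
    by (intro divide_right_mono) auto
  then show ?thesis using main
    by (intro exI[of _ ?C] conjI allI impI) (auto, meson order_trans)
qed


end
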